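(* For each $n\ge2$, the $n$-dimensional long glass $\Lambda^n=\mathbb B^n\cup_{\partial}(\mathbb S^{n-1}\times\mathbb L_{\ge0})$ has no dimension-one foliation.
   Context: The closed long ray $\mathbb L_{\ge 0}$ is $\omega_1\times[0,1)$ with the order topology of the lexicographic order, with least element $0$. $\mathbb B^n$ is the closed unit ball in $\mathbb R^n$. $\Lambda^n$ is the $n$-manifold obtained from the disjoint union of $\mathbb B^n$ and $\mathbb S^{n-1}\times\mathbb L_{\ge0}$ by identifying $\partial\mathbb B^n=\mathbb S^{n-1}$ with $\mathbb S^{n-1}\times\{0\}$ via $x\mapsto(x,0)$. Foliation: a foliation $\mathcal F$ of dimension $p$ on an $n$-manifold (not necessarily metrisable) is a maximal atlas $\{(U_i,\varphi_i)\}_{i\in I}$ such that all coordinate changes have the form $\varphi_j\varphi_i^{-1}(x,y)=(g_{i,j}(x,y),h_{i,j}(y))$ for $(x,y)\in\varphi_i(U_i\cap U_j)\subset\mathbb R^p\times\mathbb R^{n-p}$, where $h_{i,j}$ is an embedding of a relevant open subset of $\mathbb R^{n-p}$ into $\mathbb R^{n-p}$ (only continuity is required). *)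

theory Defs
  imports "HOL-Analysis.Analysis" "HOL-Library.Countable_Set_Type"
begin

definition order_topology_on :: "'a set \<Rightarrow> ('a \<Rightarrow> 'a \<Rightarrow> bool) \<Rightarrow> 'a topology" where
  "order_topology_on X lt =
     topology_generated_by
       (insert X ((\<lambda>a. {x \<in> X. lt a x}) ` X \<union> (\<lambda>a. {x \<in> X. lt x a}) ` X))"

lemma topspace_order_topology_on [simp]: "topspace (order_topology_on X lt) = X"
  unfolding order_topology_on_def topology_generated_by_topspace by auto

definition disjoint_union_topology ::
    "'a topology \<Rightarrow> 'b topology \<Rightarrow> ('a + 'b) topology" where
  "disjoint_union_topology X Y =
     topology (\<lambda>U. openin X (Inl -` U) \<and> openin Y (Inr -` U))"

lemma openin_disjoint_union_topology:
  "openin (disjoint_union_topology X Y) U \<longleftrightarrow> openin X (Inl -` U) \<and> openin Y (Inr -` U)"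
proof -
  have "istopology (\<lambda>U. openin X (Inl -` U) \<and> openin Y (Inr -` U))"
    unfolding istopology_def by (auto simp: vimage_Union)
  then show ?thesis
    unfolding disjoint_union_topology_def by simp
qed

lemma topspace_disjoint_union_topology [simp]:
  "topspace (disjoint_union_topology X Y) = topspace X <+> topspace Y"
proof
  let ?D = "disjoint_union_topology X Y"
  have "openin X (Inl -` topspace ?D)" "openin Y (Inr -` topspace ?D)"
    using openin_topspace[of ?D] unfolding openin_disjoint_union_topology by auto
  then have "Inl -` topspace ?D \<subseteq> topspace X" "Inr -` topspace ?D \<subseteq> topspace Y"
    by (auto dest: openin_subset)
  then show "topspace ?D \<subseteq> topspace X <+> topspace Y"
    by (auto simp: Plus_def image_iff subset_iff) (metis sumE)
  have "Inl -` (topspace X <+> topspace Y) = topspace X"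
       "Inr -` (topspace X <+> topspace Y) = topspace Y"
    by auto
  then show "topspace X <+> topspace Y \<subseteq> topspace ?D"
    by (intro openin_subset) (simp add: openin_disjoint_union_topology)
qed

definition quotient_topology :: "'a topology \<Rightarrow> ('a \<times> 'a) set \<Rightarrow> 'a set topology" where
  "quotient_topology X R =
     topology (\<lambda>U. U \<subseteq> topspace X // R \<and> openin X {x \<in> topspace X. R `` {x} \<in> U})"

lemma openin_quotient_topology:
  "openin (quotient_topology X R) U \<longleftrightarrow>
     U \<subseteq> topspace X // R \<and> openin X {x \<in> topspace X. R `` {x} \<in> U}"
proof -
  have 1: "{x \<in> topspace X. R `` {x} \<in> S \<inter> T} =
      {x \<in> topspace X. R `` {x} \<in> S} \<inter> {x \<in> topspace X. R `` {x} \<in> T}" for S T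
    by auto
  have 2: "{x \<in> topspace X. R `` {x} \<in> \<Union>\<K>} = (\<Union>K\<in>\<K>. {x \<in> topspace X. R `` {x} \<in> K})" for \<K>
    by auto
  have "istopology (\<lambda>U. U \<subseteq> topspace X // R \<and> openin X {x \<in> topspace X. R `` {x} \<in> U})"
    unfolding istopology_def 1 2 by blast
  then show ?thesis
    unfolding quotient_topology_def by simp
qed

lemma topspace_quotient_topology [simp]:
  "topspace (quotient_topology X R) = topspace X // R"
proof
  show "topspace (quotient_topology X R) \<subseteq> topspace X // R"
    using openin_topspace[of "quotient_topology X R"] unfolding openin_quotient_topology by blast
  have "{x \<in> topspace X. R `` {x} \<in> topspace X // R} = topspace X"
    by (auto simp: quotientI)
  then show "topspace X // R \<subseteq> topspace (quotient_topology X R)"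
    by (intro openin_subset) (simp add: openin_quotient_topology)
qed

lemma quotient_map_quotient_topology:
  "quotient_map X (quotient_topology X R) (\<lambda>x. R `` {x})"
  unfolding quotient_map_def by (auto simp: openin_quotient_topology quotient_def)

text \<open>
  The cardinal successor of \<open>natLeq\<close> (the order type of the natural numbers) is a
  well-order of the least uncountable order type, that is, a copy of the ordinal
  \<open>\<omega>\<^sub>1\<close>.  It is a reflexive relation, as usual for the library's well-orders.
\<close>

definition omega1 :: "nat set rel" where
  "omega1 = cardSuc natLeq"

lemma Well_order_omega1: "Well_order omega1"
  unfolding omega1_def
  using cardSuc_Card_order[OF natLeq_Card_order] by (simp add: card_order_on_def)

lemma uncountable_Field_omega1:
  includes cardinal_syntax
  shows "uncountable (Field omega1)"
proof
  assume "countable (Field omega1)"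
  then have "|Field omega1| \<le>o natLeq"
    by (simp add: countable_card_le_natLeq)
  moreover have "omega1 =o |Field omega1|"
    unfolding omega1_def
    using card_of_Field_ordIso[OF cardSuc_Card_order[OF natLeq_Card_order]] ordIso_symmetric
    by blast
  ultimately have "omega1 \<le>o natLeq"
    using ordIso_ordLeq_trans by blast
  then show False
    unfolding omega1_def
    using cardSuc_greater[OF natLeq_Card_order] not_ordLess_ordLeq by blast
qed

lemma countable_underS_omega1:
  includes cardinal_syntax
  assumes "a \<in> Field omega1"
  shows "countable (underS omega1 a)"
proof -
  have "|underS omega1 a| <o omega1"
    using card_of_underS[OF cardSuc_Card_order[OF natLeq_Card_order]] assms
    unfolding omega1_def by blast
  then have "|underS omega1 a| \<le>o natLeq"
    unfolding omega1_def
    using cardSuc_ordLeq_ordLess[OF natLeq_Card_order card_of_Card_order] by blast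
  then show ?thesis
    by (simp add: countable_card_le_natLeq)
qed

definition long_ray_points :: "(nat set \<times> real) set" where
  "long_ray_points = Field omega1 \<times> {0..<1}"

definition long_ray_less :: "nat set \<times> real \<Rightarrow> nat set \<times> real \<Rightarrow> bool" where
  "long_ray_less = (\<lambda>(a, s) (b, t). (a, b) \<in> omega1 \<and> a \<noteq> b \<or> a = b \<and> s < t)"

definition long_ray :: "(nat set \<times> real) topology" where
  "long_ray = order_topology_on long_ray_points long_ray_less"

definition long_ray_zero :: "nat set \<times> real" where
  "long_ray_zero =
     (THE z. z \<in> long_ray_points \<and> (\<forall>y\<in>long_ray_points. z = y \<or> long_ray_less z y))"

lemma long_ray_zero_eq: "long_ray_zero = (wo_rel.minim omega1 (Field omega1), 0)"
  and long_ray_zero_in: "long_ray_zero \<in> long_ray_points"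
  and long_ray_zero_least:
    "y \<in> long_ray_points \<Longrightarrow> long_ray_zero = y \<or> long_ray_less long_ray_zero y"
proof -
  interpret wo_rel omega1
    using Well_order_omega1 by (simp add: wo_rel_def)
  have ne: "Field omega1 \<noteq> {}"
    using uncountable_Field_omega1 by auto
  define z :: "nat set \<times> real" where "z = (minim (Field omega1), 0)"
  have z: "z \<in> long_ray_points"
    using minim_in[OF subset_refl ne] by (simp add: z_def long_ray_points_def)
  have least: "z = y \<or> long_ray_less z y" if "y \<in> long_ray_points" for y
  proof (cases y)
    case (Pair b t)
    with that have "(minim (Field omega1), b) \<in> omega1" "0 \<le> t"
      using minim_least[OF subset_refl] by (auto simp: long_ray_points_def)
    then show ?thesis
      unfolding Pair z_def long_ray_less_def by force
  qed
  have antisym: "\<not> long_ray_less y z" if "long_ray_less z y" for y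
    using that ANTISYM by (cases y) (auto simp: z_def long_ray_less_def antisym_def)
  have eq: "long_ray_zero = z"
    unfolding long_ray_zero_def
  proof (rule the_equality)
    show "z \<in> long_ray_points \<and> (\<forall>y\<in>long_ray_points. z = y \<or> long_ray_less z y)"
      using z least by blast
    show "w = z"
      if "w \<in> long_ray_points \<and> (\<forall>y\<in>long_ray_points. w = y \<or> long_ray_less w y)" for w
      using that z least antisym by metis
  qed
  show "long_ray_zero = (minim (Field omega1), 0)"
    using eq by (simp add: z_def)
  show "long_ray_zero \<in> long_ray_points"
    using eq z by simp
  show "long_ray_zero = y \<or> long_ray_less long_ray_zero y" if "y \<in> long_ray_points"
    using eq least[OF that] by simp
qed

text \<open>
  As in \<open>Euclidean_space n\<close>, points of \<open>n\<close>-space are sequences vanishing from index \<open>n\<close> on.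
  The boundary sphere of the unit \<open>n\<close>-ball is \<open>nsphere (n - 1)\<close>, as \<open>nsphere k\<close> is the
  unit sphere of \<open>Euclidean_space (k + 1)\<close>; for this reason \<open>n\<close> has to be positive.
\<close>

definition nball :: "nat \<Rightarrow> (nat \<Rightarrow> real) topology" where
  "nball n = subtopology (Euclidean_space n) {x. (\<Sum>i<n. (x i)\<^sup>2) \<le> 1}"

type_synonym glass_point = "(nat \<Rightarrow> real) + (nat \<Rightarrow> real) \<times> (nat set \<times> real)"

definition glass_pieces :: "nat \<Rightarrow> glass_point topology" where
  "glass_pieces n =
     disjoint_union_topology (nball n) (prod_topology (nsphere (n - 1)) long_ray)"

definition glass_glue :: "nat \<Rightarrow> glass_point rel" where
  "glass_glue n =
     Id_on (topspace (glass_pieces n))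
     \<union> {(Inl x, Inr (x, long_ray_zero)) | x. x \<in> topspace (nsphere (n - 1))}
     \<union> {(Inr (x, long_ray_zero), Inl x) | x. x \<in> topspace (nsphere (n - 1))}"

lemma topspace_nsphere_subset_nball:
  assumes "n \<ge> 1"
  shows "topspace (nsphere (n - 1)) \<subseteq> topspace (nball n)"
proof -
  have "{..n - 1} = {..<n}"
    using assms by auto
  then show ?thesis
    using assms by (auto simp: nsphere_def nball_def topspace_Euclidean_space)
qed

lemma equiv_glass_glue:
  assumes "n \<ge> 1"
  shows "equiv (topspace (glass_pieces n)) (glass_glue n)"
proof (rule equivI)
  have L: "long_ray_zero \<in> topspace long_ray"
    by (simp add: long_ray_def long_ray_zero_in)
  show "glass_glue n \<subseteq> topspace (glass_pieces n) \<times> topspace (glass_pieces n)"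
    using topspace_nsphere_subset_nball[OF assms] L
    by (auto simp: glass_glue_def glass_pieces_def)
  show "refl_on (topspace (glass_pieces n)) (glass_glue n)"
    by (auto simp: refl_on_def glass_glue_def)
  show "sym (glass_glue n)"
    by (auto simp: sym_def glass_glue_def)
  show "trans (glass_glue n)"
    using topspace_nsphere_subset_nball[OF assms] L
    by (auto simp: trans_def glass_glue_def glass_pieces_def)
qed

definition long_glass :: "nat \<Rightarrow> glass_point set topology" where
  "long_glass n = quotient_topology (glass_pieces n) (glass_glue n)"

text \<open>
  A chart is a pair of its domain and its coordinate map; the values of the coordinate
  map outside the domain are irrelevant.  Only continuity is asked of coordinate changes,
  and the first component \<open>g\<close> of a coordinate change need not be mentioned as continuous,
  since a coordinate change between two charts is always a homeomorphism.
\<close>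

type_synonym 'a fol_chart = "'a set \<times> ('a \<Rightarrow> (nat \<Rightarrow> real) \<times> (nat \<Rightarrow> real))"

definition is_chart :: "nat \<Rightarrow> nat \<Rightarrow> 'a topology \<Rightarrow> 'a fol_chart \<Rightarrow> bool" where
  "is_chart p n M = (\<lambda>(U, \<phi>).
     let E = prod_topology (Euclidean_space p) (Euclidean_space (n - p)) in
       openin M U \<and> openin E (\<phi> ` U) \<and>
       homeomorphic_map (subtopology M U) (subtopology E (\<phi> ` U)) \<phi>)"

definition foliated_change :: "nat \<Rightarrow> nat \<Rightarrow> 'a fol_chart \<Rightarrow> 'a fol_chart \<Rightarrow> bool" where
  "foliated_change p n = (\<lambda>(U, \<phi>) (V, \<psi>).
     \<exists>g h. (\<forall>(x, y) \<in> \<phi> ` (U \<inter> V). \<psi> (inv_into U \<phi> (x, y)) = (g (x, y), h y)) \<and>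
       embedding_map (subtopology (Euclidean_space (n - p)) (snd ` \<phi> ` (U \<inter> V)))
         (Euclidean_space (n - p)) h)"

definition foliated_atlas :: "nat \<Rightarrow> nat \<Rightarrow> 'a topology \<Rightarrow> 'a fol_chart set \<Rightarrow> bool" where
  "foliated_atlas p n M \<A> \<longleftrightarrow>
     (\<forall>c\<in>\<A>. is_chart p n M c) \<and> (\<Union>c\<in>\<A>. fst c) = topspace M \<and>
     (\<forall>c\<in>\<A>. \<forall>d\<in>\<A>. foliated_change p n c d)"

definition foliation :: "nat \<Rightarrow> nat \<Rightarrow> 'a topology \<Rightarrow> 'a fol_chart set \<Rightarrow> bool" where
  "foliation p n M \<F> \<longleftrightarrow>
     p \<le> n \<and> foliated_atlas p n M \<F> \<and>
     (\<forall>\<A>. foliated_atlas p n M \<A> \<and> \<F> \<subseteq> \<A> \<longrightarrow> \<A> = \<F>)"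

end

(*
  A flow box is a chart whose plaques are the lines parallel to the first axis. Since the
  transversal transition maps h are globally defined on an overlap, plaques of different boxes
  through a point can be compared, and the glass being an increasing union of balls, the leaves
  can be oriented. Pushing the ball below a level along the leaves and retracting back, Brouwer's
  theorem gives a fixed point: a leaf that rises vertically from this level; with the reversed
  orientation, one that falls. By pressing down, a finite open cover of the sphere consists of
  sets W such that W x [beta, alpha] lies in a single flow box for every alpha. A leaf climbing
  through all levels meets them at points whose spherical component is left continuous in the
  level, hence eventually constant, so vertical leaves exist. Being eventually vertical is a
  clopen condition on the sphere, so every line {x} x [delta, omega_1) is eventually in a leaf.
  Whether it is traversed upwards or downwards is locally constant in x, but both occur, while
  the sphere of dimension n - 1 >= 1 is connected.
*)

theory Submission
  imports Defs "HOL-Homology.Homology"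
begin

section \<open>The long ray as a linearly ordered space\<close>

text \<open>The foliation is merely continuous, so there is no tangent field and no flow: directions
  are compared through the order of heights on common plaques, and the push is composed of finitely
  many small shifts inside boxes. The obstacle is that a leaf may come back to a box in many
  plaques. Over the sets W this is harmless: a compact arc in W x (beta, omega_1) lies in every box
  that covers W from beta up to a high enough level, so any two arcs can be compared in one box, and
  reachability becomes a linear order along each leaf. Levels need not be monotone along a leaf,
  hence only the first hit of a level is used; its position may jump just above a level, never just
  below. Left continuity is enough, because every increasing sequence of levels converges and
  countably many bounds have a common one; these two facts do the work of closed unbounded sets. For
  n = 1 the glass is the long line, a single leaf that comes down one end and goes up the other; its
  sphere has two points, and connectedness is what rules out such a picture for larger n.\<close>

typedef lray = long_ray_points
  using long_ray_zero_in by blast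

lemma long_ray_less_irrefl: "\<not> long_ray_less x x"
  by (auto simp: long_ray_less_def)

lemma omega1_trans: "(a, b) \<in> omega1 \<Longrightarrow> (b, c) \<in> omega1 \<Longrightarrow> (a, c) \<in> omega1"
  using wo_rel.TRANS[of omega1] Well_order_omega1 unfolding wo_rel_def trans_def by blast

lemma omega1_antisym: "(a, b) \<in> omega1 \<Longrightarrow> (b, a) \<in> omega1 \<Longrightarrow> a = b"
  using wo_rel.ANTISYM[of omega1] Well_order_omega1 unfolding wo_rel_def antisym_def by blast

lemma omega1_total:
  "a \<in> Field omega1 \<Longrightarrow> b \<in> Field omega1 \<Longrightarrow> (a, b) \<in> omega1 \<or> (b, a) \<in> omega1"
  using wo_rel.TOTALS[of omega1] Well_order_omega1 unfolding wo_rel_def by blast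

lemma long_ray_less_trans:
  assumes "long_ray_less x y" "long_ray_less y z"
  shows "long_ray_less x z"
proof -
  obtain a r b s c t where xyz: "x = (a, r)" "y = (b, s)" "z = (c, t)"
    by (metis surj_pair)
  have 1: "(a, b) \<in> omega1 \<and> a \<noteq> b \<or> a = b \<and> r < s"
    and 2: "(b, c) \<in> omega1 \<and> b \<noteq> c \<or> b = c \<and> s < t"
    using assms by (auto simp: xyz long_ray_less_def)
  have "(a, c) \<in> omega1 \<and> a \<noteq> c \<or> a = c \<and> r < t"
    using 1
  proof
    assume ab: "(a, b) \<in> omega1 \<and> a \<noteq> b"
    from 2 show ?thesis
    proof
      assume "(b, c) \<in> omega1 \<and> b \<noteq> c"
      with ab show ?thesis
        using omega1_trans[of a b c] omega1_antisym[of a b] by auto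
    qed (use ab in simp)
  next
    assume "a = b \<and> r < s"
    with 2 show ?thesis by auto
  qed
  then show ?thesis
    by (simp add: xyz long_ray_less_def)
qed

lemma long_ray_less_total:
  assumes "x \<in> long_ray_points" "y \<in> long_ray_points"
  shows "long_ray_less x y \<or> x = y \<or> long_ray_less y x"
  using assms omega1_total[of "fst x" "fst y"]
  by (cases x; cases y) (auto simp: long_ray_less_def long_ray_points_def)

text \<open>With levels as a type of their own, the class \<open>linorder_topology\<close> supplies
  interval, limit and monotone-continuity arguments for them.\<close>

instantiation lray :: linorder
begin

definition less_lray :: "lray \<Rightarrow> lray \<Rightarrow> bool" where
  "less_lray x y = long_ray_less (Rep_lray x) (Rep_lray y)"

definition less_eq_lray :: "lray \<Rightarrow> lray \<Rightarrow> bool" where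
  "less_eq_lray x y \<longleftrightarrow> x < y \<or> x = y"

instance
proof
  fix x y z :: lray
  have 1: "\<not> x < x" for x :: lray
    by (simp add: less_lray_def long_ray_less_irrefl)
  have 2: "x < y \<Longrightarrow> y < z \<Longrightarrow> x < z" for x y z :: lray
    unfolding less_lray_def by (rule long_ray_less_trans)
  have 3: "x < y \<or> x = y \<or> y < x" for x y :: lray
    unfolding less_lray_def using long_ray_less_total[OF Rep_lray Rep_lray]
    by (metis Rep_lray_inject)
  show "(x < y) = (x \<le> y \<and> \<not> y \<le> x)"
    unfolding less_eq_lray_def using 1[of x] 1[of y] 2[of x y x] by blast
  show "x \<le> x"
    unfolding less_eq_lray_def by blast
  show "x \<le> z" if "x \<le> y" "y \<le> z"
    using that unfolding less_eq_lray_def using 2 by blast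
  show "x = y" if "x \<le> y" "y \<le> x"
    using that unfolding less_eq_lray_def using 1[of x] 2[of x y x] by blast
  show "x \<le> y \<or> y \<le> x"
    unfolding less_eq_lray_def using 3 by blast
qed

end

text \<open>That this topology is the one of \<open>long_ray\<close> follows from
  \<open>continuous_Abs_lray\<close> and \<open>continuous_Rep_lray\<close>.\<close>

instantiation lray :: linorder_topology
begin

definition open_lray :: "lray set \<Rightarrow> bool" where
  "open_lray = generate_topology (range lessThan \<union> range greaterThan)"

instance
  by standard (simp add: open_lray_def fun_eq_iff)

end

definition lpt :: "nat set \<Rightarrow> real \<Rightarrow> lray" where
  "lpt b s = Abs_lray (b, s)"

lemma lray_cases:
  obtains b s where "x = lpt b s" "b \<in> Field omega1" "0 \<le> s" "s < 1"
  by (cases x) (auto simp: lpt_def long_ray_points_def)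

lemma lpt_less_iff:
  assumes "a \<in> Field omega1" "0 \<le> s" "s < 1" "b \<in> Field omega1" "0 \<le> t" "t < 1"
  shows "lpt a s < lpt b t \<longleftrightarrow> (a, b) \<in> omega1 \<and> a \<noteq> b \<or> a = b \<and> s < t"
  using assms by (simp add: lpt_def less_lray_def Abs_lray_inverse long_ray_points_def long_ray_less_def)

lemma lpt_eq_iff:
  assumes "a \<in> Field omega1" "0 \<le> s" "s < 1" "b \<in> Field omega1" "0 \<le> t" "t < 1"
  shows "lpt a s = lpt b t \<longleftrightarrow> a = b \<and> s = t"
  using assms by (simp add: lpt_def Abs_lray_inject long_ray_points_def)

instance lray :: dense_order
proof
  fix x y :: lray
  assume xy: "x < y"
  obtain a s where x: "x = lpt a s" "a \<in> Field omega1" "0 \<le> s" "s < 1"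
    by (rule lray_cases)
  obtain b t where y: "y = lpt b t" "b \<in> Field omega1" "0 \<le> t" "t < 1"
    by (rule lray_cases)
  have *: "(a, b) \<in> omega1 \<and> a \<noteq> b \<or> a = b \<and> s < t"
    using xy x y by (simp add: lpt_less_iff)
  \<comment> \<open>For different ordinals the point is taken in the unit interval of the smaller
    one, halfway between \<open>s\<close> and its missing end 1.\<close>
  define r where "r = (if a = b then (s + t) / 2 else (s + 1) / 2)"
  have "x < lpt a r" "lpt a r < y"
    using x y * by (auto simp: r_def lpt_less_iff)
  then show "\<exists>z. x < z \<and> z < y" by blast
qed

text \<open>Countably many ordinals together with all their predecessors form a countable set, so
  some ordinal is missing from it and lies above them all. This is the one place where the
  uncountability of \<open>omega1\<close> enters; every choice of a common threshold below rests on
  it.\<close>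

lemma countable_bounded_lray:
  fixes X :: "lray set"
  assumes "countable X"
  obtains b where "b \<in> Field omega1" "\<And>x. x \<in> X \<Longrightarrow> x < lpt b 0"
proof -
  define I where "I = (\<lambda>x. fst (Rep_lray x)) ` X"
  define Y where "Y = I \<union> (\<Union>i\<in>I. Order_Relation.underS omega1 i)"
  have IF: "I \<subseteq> Field omega1"
    using Rep_lray unfolding I_def long_ray_points_def by (metis image_subsetI mem_Times_iff)
  have "countable Y"
    unfolding Y_def using assms countable_underS_omega1 IF by (auto simp: I_def)
  then obtain b where b: "b \<in> Field omega1" "b \<notin> Y"
    using uncountable_Field_omega1 by (metis countable_subset subsetI)
  have "x < lpt b 0" if "x \<in> X" for x
  proof (cases x rule: lray_cases)
    case (1 a s)
    have "a \<in> I"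
      using that 1 by (force simp: I_def lpt_def Abs_lray_inverse long_ray_points_def)
    then have "a \<noteq> b" "(b, a) \<notin> omega1"
      using b by (auto simp: Y_def Order_Relation.underS_def)
    then have "(a, b) \<in> omega1"
      using omega1_total 1 b by blast
    with 1 b \<open>a \<noteq> b\<close> show ?thesis
      by (simp add: lpt_less_iff)
  qed
  with b that show ?thesis by blast
qed

definition lzero :: lray where
  "lzero = Abs_lray long_ray_zero"

lemma lzero_le: "lzero \<le> x"
  unfolding less_eq_lray_def less_lray_def lzero_def Abs_lray_inverse[OF long_ray_zero_in]
  using long_ray_zero_least[OF Rep_lray[of x]] by (metis Rep_lray_inverse)

lemma omega1_finite_max:
  assumes "finite F" "F \<noteq> {}" "F \<subseteq> Field omega1"
  shows "\<exists>m\<in>F. \<forall>x\<in>F. (x, m) \<in> omega1"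
  using assms
proof (induction rule: finite_ne_induct)
  case (singleton x)
  then show ?case using omega1_total[of x x] by auto
next
  case (insert x F)
  then obtain m where m: "m \<in> F" "\<forall>x\<in>F. (x, m) \<in> omega1" by auto
  have "x \<in> Field omega1" "m \<in> Field omega1" using insert.prems m by auto
  then have "(x, m) \<in> omega1 \<or> (m, x) \<in> omega1" "(x, x) \<in> omega1"
    using omega1_total by blast+
  then show ?case
    using m omega1_trans by (metis insert_iff)
qed

text \<open>Summable positive weights on the countably many predecessors of an ordinal: its place in
  the real line is the total weight of what precedes it.\<close>

lemma lray_segment_param:
  assumes b: "b \<in> Field omega1"
  obtains \<Sigma> :: real and g :: "real \<Rightarrow> lray"
  where "strict_mono_on {0..<\<Sigma>} g" "g ` {0..<\<Sigma>} = {..<lpt b 0}"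
proof -
  define U where "U = Order_Relation.underS omega1 b"
  \<comment> \<open>The enumeration is injective on \<open>U\<close>, so the weights are distinct
    terms of the geometric series and every subset of \<open>U\<close> has a finite total
    weight.\<close>
  define c :: "nat set \<Rightarrow> real" where "c a = (1/2) ^ to_nat_on U a" for a
  have UF: "U \<subseteq> Field omega1"
    by (auto simp: U_def Order_Relation.underS_def Field_def)
  have cntU: "countable U"
    unfolding U_def using countable_underS_omega1[OF b] .
  have cpos: "c a > 0" for a
    by (simp add: c_def)
  have "(\<lambda>n. (1/2::real) ^ n) summable_on UNIV"
    by (rule summable_nonneg_imp_summable_on) (auto intro: summable_geometric)
  then have "(\<lambda>n. (1/2::real) ^ n) summable_on to_nat_on U ` U"
    by (rule summable_on_subset_banach) auto
  then have csum: "c summable_on U"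
    using summable_on_reindex[OF inj_on_to_nat_on[OF cntU], of "\<lambda>n. (1/2::real) ^ n"]
    by (simp add: o_def c_def[abs_def])
  then have csumD: "c summable_on D" if "D \<subseteq> U" for D
    using that by (rule summable_on_subset_banach)
  define C where "C = infsum c"
  have Cmono: "C D \<le> C D'" if "D \<subseteq> D'" "D' \<subseteq> U" for D D'
    unfolding C_def using that cpos
    by (intro infsum_mono_neutral csumD) (auto intro: less_imp_le)
  have Cins: "C (insert a D) = C D + c a" if "D \<subseteq> U" "a \<in> U" "a \<notin> D" for a D
    unfolding C_def using that csumD[of D] by (simp add: infsum_insert)
  have Cge: "C D \<ge> 0" for D
    unfolding C_def using cpos by (intro infsum_nonneg) (auto intro: less_imp_le)
  define B where "B a = Order_Relation.underS omega1 a" for a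
  have BU: "B a \<subseteq> U" "a \<notin> B a" "insert a (B a) \<subseteq> U" if "a \<in> U" for a
  proof -
    have ab: "(a, b) \<in> omega1" "a \<noteq> b"
      using that by (auto simp: U_def Order_Relation.underS_def)
    show "B a \<subseteq> U"
    proof
      fix x assume "x \<in> B a"
      then have "(x, a) \<in> omega1" "x \<noteq> a"
        by (auto simp: B_def Order_Relation.underS_def)
      then show "x \<in> U"
        using ab omega1_trans[of x a b] omega1_antisym[of x a] by (auto simp: U_def Order_Relation.underS_def)
    qed
    with that show "insert a (B a) \<subseteq> U" by simp
    show "a \<notin> B a" by (simp add: B_def Order_Relation.underS_def)
  qed
  \<comment> \<open>An infinite sum of positive terms is bounded by bounds on its finite parts, and
    a finite part lies in the closed initial segment of its largest element.\<close>
  have Cle: "C D \<le> v" if D: "D \<subseteq> U" and v: "v \<ge> 0" and *: "\<And>a. a \<in> D \<Longrightarrow> C (insert a (B a)) \<le> v" for D v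
    unfolding C_def
  proof (rule infsum_le_finite_sums[OF csumD[OF D]])
    fix F assume F: "finite F" "F \<subseteq> D"
    show "sum c F \<le> v"
    proof (cases "F = {}")
      case False
      obtain m where m: "m \<in> F" "\<forall>x\<in>F. (x, m) \<in> omega1"
        using omega1_finite_max[OF F(1) False] F D UF by blast
      then have "F \<subseteq> insert m (B m)"
        by (auto simp: B_def Order_Relation.underS_def)
      then have "C F \<le> C (insert m (B m))"
        using BU(3)[of m] m F D by (intro Cmono) blast+
      also have "\<dots> \<le> v"
        using * m F by blast
      finally show ?thesis
        using F by (simp add: C_def)
    qed (use v in simp)
  qed
  \<comment> \<open>The unit interval over \<open>a\<close> is stretched to length
    \<open>c a\<close>, so the images of consecutive intervals abut and leave no gap.\<close>
  define E where "E = (\<lambda>(a, s::real). C (B a) + s * c a)"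
  define P where "P = U \<times> {0..<1::real}"
  have Elt: "E (a, s) < E (a', t)"
    if "(a, s) \<in> P" "(a', t) \<in> P" "(a, a') \<in> omega1 \<and> a \<noteq> a' \<or> a = a' \<and> s < t" for a s a' t
    using that(3)
  proof
    assume aa: "(a, a') \<in> omega1 \<and> a \<noteq> a'"
    then have "insert a (B a) \<subseteq> B a'"
      using omega1_trans[of _ a a'] omega1_antisym[of a a'] by (auto simp: B_def Order_Relation.underS_def)
    then have "C (insert a (B a)) \<le> C (B a')"
      using that BU by (intro Cmono) (auto simp: P_def)
    moreover have "C (insert a (B a)) = C (B a) + c a"
      using that BU by (intro Cins) (auto simp: P_def)
    moreover have "s * c a < c a"
      using that cpos[of a] by (auto simp: P_def)
    moreover have "0 \<le> t * c a'"
      using that cpos[of a'] by (auto simp: P_def)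
    ultimately show ?thesis by (simp add: E_def)
  next
    assume "a = a' \<and> s < t"
    then show ?thesis using cpos[of a] by (auto simp: E_def)
  qed
  define e where "e x = E (Rep_lray x)" for x
  have elpt: "e (lpt a s) = E (a, s)" if "(a, s) \<in> P" for a s
    using that UF by (auto simp: e_def lpt_def P_def Abs_lray_inverse long_ray_points_def)
  have below: "x < lpt b 0 \<longleftrightarrow> (\<exists>a s. x = lpt a s \<and> (a, s) \<in> P)" for x
  proof (cases x rule: lray_cases)
    case (1 a s)
    have "(\<exists>a' s'. x = lpt a' s' \<and> (a', s') \<in> P) \<longleftrightarrow> (a, s) \<in> P"
      using 1 UF by (auto simp: P_def lpt_eq_iff subset_iff)
    then show ?thesis
      using 1 b by (auto simp: lpt_less_iff P_def U_def Order_Relation.underS_def)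
  qed
  have emono: "e x < e y" if xy: "x < y" "x < lpt b 0" "y < lpt b 0" for x y
  proof -
    obtain a s a' t where as: "x = lpt a s" "(a, s) \<in> P" "y = lpt a' t" "(a', t) \<in> P"
      using xy(2,3) unfolding below by blast
    have "a \<in> Field omega1" "a' \<in> Field omega1" "0 \<le> s" "s < 1" "0 \<le> t" "t < 1"
      using as UF unfolding P_def by auto
    then have "(a, a') \<in> omega1 \<and> a \<noteq> a' \<or> a = a' \<and> s < t"
      using xy(1) unfolding as by (simp add: lpt_less_iff)
    then show ?thesis using as Elt elpt by simp
  qed
  define \<Sigma> where "\<Sigma> = C U"
  have erange: "e x \<in> {0..<\<Sigma>}" if "x < lpt b 0" for x
  proof -
    obtain a s where as: "x = lpt a s" "(a, s) \<in> P"
      using \<open>x < lpt b 0\<close> unfolding below by blast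
    have "C (insert a (B a)) = C (B a) + c a" "C (insert a (B a)) \<le> \<Sigma>"
      using as BU unfolding \<Sigma>_def by (intro Cins Cmono; auto simp: P_def)+
    moreover have "0 \<le> s * c a" "s * c a < c a"
      using as cpos[of a] by (auto simp: P_def)
    ultimately show ?thesis
      using as Cge[of "B a"] by (simp add: elpt E_def)
  qed
  have esurj: "\<exists>x<lpt b 0. e x = v" if v: "v \<in> {0..<\<Sigma>}" for v
  proof -
    \<comment> \<open>The first ordinal whose closed initial segment outweighs \<open>v\<close>: all
      earlier ones together weigh at most \<open>v\<close>, so \<open>v\<close> falls into its
      interval.\<close>
    define A where "A = {a \<in> U. v < C (insert a (B a))}"
    have "A \<noteq> {}"
    proof
      assume "A = {}"
      then have "C U \<le> v"
        using v by - (rule Cle, simp_all add: A_def not_less)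
      with v show False by (simp add: \<Sigma>_def)
    qed
    interpret wo_rel omega1
      using Well_order_omega1 by (simp add: wo_rel_def)
    define a where "a = minim A"
    have AF: "A \<subseteq> Field omega1" using UF unfolding A_def by blast
    have aA: "a \<in> A"
      unfolding a_def by (rule minim_in[OF AF \<open>A \<noteq> {}\<close>])
    have least: "(a, x) \<in> omega1" if "x \<in> A" for x
      unfolding a_def by (rule minim_least[OF AF that])
    have aU: "a \<in> U" using aA by (simp add: A_def)
    have "C (B a) \<le> v"
    proof (rule Cle)
      fix x assume x: "x \<in> B a"
      then have "(x, a) \<in> omega1" "x \<noteq> a"
        by (simp_all add: B_def Order_Relation.underS_def)
      then have "x \<notin> A"
        using least[of x] omega1_antisym[of a x] by blast
      moreover have "x \<in> U"
        using x BU(1)[OF aU] by blast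
      ultimately show "C (insert x (B x)) \<le> v"
        unfolding A_def mem_Collect_eq by linarith
    qed (use v BU(1)[OF aU] in simp_all)
    moreover have "v < C (B a) + c a"
      using aA Cins[of "B a" a] BU[OF aU] by (simp add: A_def aU)
    ultimately have P: "(a, (v - C (B a)) / c a) \<in> P"
      using aU cpos[of a] by (simp add: P_def field_simps)
    then have "e (lpt a ((v - C (B a)) / c a)) = v"
      using cpos[of a] by (simp add: elpt E_def)
    moreover have "lpt a ((v - C (B a)) / c a) < lpt b 0"
      unfolding below using P by blast
    ultimately show ?thesis by blast
  qed
  define g where "g = inv_into {..<lpt b 0} e"
  have bij: "bij_betw e {..<lpt b 0} {0..<\<Sigma>}"
  proof (rule bij_betwI')
    show "(e x = e y) = (x = y)" if "x \<in> {..<lpt b 0}" "y \<in> {..<lpt b 0}" for x y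
      using emono[of x y] emono[of y x] that by (cases x y rule: linorder_cases) auto
  qed (use erange esurj in auto)
  then have bijg: "bij_betw g {0..<\<Sigma>} {..<lpt b 0}"
    unfolding g_def by (rule bij_betw_inv_into)
  show ?thesis
  proof (rule that)
    show "g ` {0..<\<Sigma>} = {..<lpt b 0}"
      using bijg by (simp add: bij_betw_def)
    show "strict_mono_on {0..<\<Sigma>} g"
    proof (rule strict_mono_onI)
      fix r s assume rs: "r \<in> {0..<\<Sigma>}" "s \<in> {0..<\<Sigma>}" "r < s"
      have eg: "e (g r) = r" "e (g s) = s"
        unfolding g_def using rs bij_betw_inv_into_right[OF bij] by blast+
      have gl: "g r < lpt b 0" "g s < lpt b 0"
        using bij_betwE[OF bijg] rs by blast+
      have le: "g r \<le> g s"
      proof (rule leI, rule notI)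
        assume "g s < g r"
        from emono[OF this gl(2,1)] eg rs(3) show False by simp
      qed
      have ne: "g r \<noteq> g s"
      proof
        assume "g r = g s"
        then have "e (g r) = e (g s)" by (rule arg_cong)
        with eg rs(3) show False by simp
      qed
      from order_neq_le_trans[OF ne le] show "g r < g s" .
    qed
  qed
qed

text \<open>A monotone surjection onto an open set has no jumps, whence the continuity. The constant
  extension to negative parameters lets \<open>glass_segment_ball\<close> use the one formula
  \<open>g (nrm n z - 1)\<close> on the inner ball as well.\<close>

lemma lray_param:
  fixes \<alpha> :: lray
  obtains \<rho> :: real and g :: "real \<Rightarrow> lray"
  where "0 \<le> \<rho>" "g ` {0..\<rho>} = {..\<alpha>}" "strict_mono_on {0..\<rho>} g" "\<And>s. s \<le> 0 \<Longrightarrow> g s = lzero"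
    "continuous_on {..\<rho>} g" "g \<rho> = \<alpha>"
proof -
  obtain b where b: "b \<in> Field omega1" "\<alpha> < lpt b 0"
    using countable_bounded_lray[of "{\<alpha>}"] by auto
  obtain \<Sigma> :: real and h :: "real \<Rightarrow> lray"
    where h: "strict_mono_on {0..<\<Sigma>} h" "h ` {0..<\<Sigma>} = {..<lpt b 0}"
    by (rule lray_segment_param[OF b(1)])
  have hsurj: "\<exists>s\<ge>0. s < \<Sigma> \<and> h s = x" if "x < lpt b 0" for x
  proof -
    have "x \<in> h ` {0..<\<Sigma>}" using h(2) that by simp
    then show ?thesis by auto
  qed
  obtain \<rho> where \<rho>: "0 \<le> \<rho>" "\<rho> < \<Sigma>" "h \<rho> = \<alpha>"
    using hsurj[OF b(2)] by blast
  have hmono: "h r \<le> h s" if "0 \<le> r" "r \<le> s" "s < \<Sigma>" for r s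
    using that strict_mono_onD[OF h(1), of r s] by (cases "r = s") (auto intro: less_imp_le)
  have h0: "h 0 = lzero"
  proof -
    obtain z where "0 \<le> z" "z < \<Sigma>" "h z = lzero"
      using hsurj[OF order_le_less_trans[OF lzero_le b(2)]] by blast
    then show ?thesis
      using hmono[of 0 z] lzero_le[of "h 0"] by auto
  qed
  define g where "g s = h (max 0 s)" for s
  have gim: "g ` {..<\<Sigma>} = {..<lpt b 0}"
  proof -
    have "g ` {..<\<Sigma>} = h ` {0..<\<Sigma>}"
    proof -
      have "(\<lambda>s. max 0 s) ` {..<\<Sigma>} = {0..<\<Sigma>}"
        using \<rho> by (force simp: image_iff max_def)
      then show ?thesis by (simp add: g_def[abs_def] flip: image_image)
    qed
    then show ?thesis using h by simp
  qed
  have "continuous_on {..<\<Sigma>} g"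
  proof (rule continuous_onI_mono)
    show "open (g ` {..<\<Sigma>})" unfolding gim by simp
    show "g r \<le> g s" if "r \<in> {..<\<Sigma>}" "s \<in> {..<\<Sigma>}" "r \<le> s" for r s
      using that \<rho> unfolding g_def by (intro hmono) auto
  qed
  then have cont: "continuous_on {..\<rho>} g"
    by (rule continuous_on_subset) (use \<rho> in auto)
  have smono: "strict_mono_on {0..\<rho>} g"
    using \<rho> by (intro strict_mono_onI) (auto simp: g_def intro!: strict_mono_onD[OF h(1)])
  have "g ` {0..\<rho>} = {..\<alpha>}"
  proof (intro equalityI subsetI)
    fix x assume "x \<in> g ` {0..\<rho>}"
    then obtain s where "0 \<le> s" "s \<le> \<rho>" "x = h s" by (auto simp: g_def)
    then show "x \<in> {..\<alpha>}" using hmono[of s \<rho>] \<rho> by simp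
  next
    fix x assume x: "x \<in> {..\<alpha>}"
    then have "x < lpt b 0" using b(2) by simp
    then obtain s where s: "0 \<le> s" "s < \<Sigma>" "h s = x"
      using hsurj by blast
    have "s \<le> \<rho>"
    proof (rule ccontr)
      assume "\<not> s \<le> \<rho>"
      then have "h \<rho> < h s" using strict_mono_onD[OF h(1), of \<rho> s] \<rho>(1,2) s(1,2) by simp
      then show False using \<rho>(3) s(3) x by simp
    qed
    then have "s \<in> {0..\<rho>}" using s(1) by simp
    moreover have "x = g s" unfolding g_def using s(1,3) by (simp only: max.absorb2)
    ultimately show "x \<in> g ` {0..\<rho>}" by blast
  qed
  moreover have "g s = lzero" if "s \<le> 0" for s
    using that h0 by (simp add: g_def)
  moreover have "g \<rho> = \<alpha>"
    using \<rho> by (simp add: g_def)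
  ultimately show ?thesis
    by (rule that[OF \<rho>(1) _ smono _ cont])
qed

lemma connected_lray_segment: "connected {a..b::lray}"
proof (cases "a \<le> b")
  case True
  obtain \<rho> :: real and g where g: "0 \<le> \<rho>" "g ` {0..\<rho>} = {..b}" "strict_mono_on {0..\<rho>} g" "\<And>s. s \<le> 0 \<Longrightarrow> g s = lzero"
    "continuous_on {..\<rho>} g" "g \<rho> = b"
    by (rule lray_param[of "b"]) (rule that)
  obtain r where r: "0 \<le> r" "r \<le> \<rho>" "g r = a"
  proof -
    have "a \<in> g ` {0..\<rho>}" using True g(2) by simp
    then show ?thesis using that by auto
  qed
  have gm: "g s \<le> g t \<longleftrightarrow> s \<le> t" if "s \<in> {0..\<rho>}" "t \<in> {0..\<rho>}" for s t
    using strict_mono_onD[OF g(3), of s t] strict_mono_onD[OF g(3), of t s] that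
    by (cases s t rule: linorder_cases) auto
  have "g x \<in> {a..b}" if "x \<in> {r..\<rho>}" for x
    using that gm[of r x] gm[of x \<rho>] r g(1,6) by auto
  moreover have "x \<in> g ` {r..\<rho>}" if x: "x \<in> {a..b}" for x
  proof -
    have "x \<in> g ` {0..\<rho>}" using x g(2) by simp
    then obtain s where "s \<in> {0..\<rho>}" "x = g s" by blast
    then show "x \<in> g ` {r..\<rho>}" using x r gm[of r s] by auto
  qed
  ultimately have "g ` {r..\<rho>} = {a..b}"
    by blast
  moreover have "connected (g ` {r..\<rho>})"
    by (intro connected_continuous_image continuous_on_subset[OF g(5)]) auto
  ultimately show ?thesis by simp
qed simp

text \<open>The values of a sequence are bounded, being countably many; inside a segment
  parametrised by reals, monotone convergence applies.\<close>

lemma lray_mono_limit: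
  fixes t :: "nat \<Rightarrow> lray"
  assumes "strict_mono t"
  obtains l where "\<And>k. t k < l" "\<And>s. s < l \<Longrightarrow> \<exists>k. s < t k" "t \<longlonglongrightarrow> l"
proof -
  obtain b where b: "\<And>k. t k < lpt b 0"
  proof (rule countable_bounded_lray[of "range t"])
    show thesis if "\<And>x. x \<in> range t \<Longrightarrow> x < lpt b 0" for b
      by (rule \<open>\<And>b. (\<And>k. t k < lpt b 0) \<Longrightarrow> thesis\<close>[of b]) (use that in blast)
  qed simp
  obtain \<rho> :: real and g where g: "0 \<le> \<rho>" "g ` {0..\<rho>} = {..lpt b 0}" "strict_mono_on {0..\<rho>} g" "\<And>s. s \<le> 0 \<Longrightarrow> g s = lzero"
    "continuous_on {..\<rho>} g" "g \<rho> = lpt b 0"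
    by (rule lray_param[of "lpt b 0"]) (rule that)
  have gm: "g s \<le> g t \<longleftrightarrow> s \<le> t" if "s \<in> {0..\<rho>}" "t \<in> {0..\<rho>}" for s t
    using strict_mono_onD[OF g(3), of s t] strict_mono_onD[OF g(3), of t s] that
    by (cases s t rule: linorder_cases) auto
  have "t k \<in> g ` {0..\<rho>}" for k
    using g(2) b[of k] by simp
  then have "\<exists>r. r \<in> {0..\<rho>} \<and> t k = g r" for k
    by blast
  then have "\<exists>s. \<forall>k. s k \<in> {0..\<rho>} \<and> t k = g (s k)"
    by (intro choice) blast
  then obtain s where s: "\<And>k. s k \<in> {0..\<rho>}" "\<And>k. t k = g (s k)" by blast
  have "incseq s"
  proof (rule monoI)
    fix i j :: nat assume "i \<le> j"
    then have "g (s i) \<le> g (s j)" using strict_mono_less_eq[OF assms, of i j] by (simp add: s(2))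
    then show "s i \<le> s j" using gm s(1) by blast
  qed
  moreover have "s k \<le> \<rho>" for k
    using s(1)[of k] by simp
  ultimately obtain u where u: "s \<longlonglongrightarrow> u" "\<And>k. s k \<le> u"
    using incseq_convergent[of s \<rho>] by blast
  have u\<rho>: "u \<in> {0..\<rho>}"
  proof -
    have "u \<le> \<rho>" by (rule LIMSEQ_le_const2[OF u(1)]) (use s in auto)
    then show ?thesis using u(2)[of 0] s(1)[of 0] by auto
  qed
  have lim: "t \<longlonglongrightarrow> g u"
    unfolding s(2)[abs_def]
    by (rule continuous_on_tendsto_compose[OF g(5) u(1)]) (use u\<rho> s(1) in auto)
  have le: "t k \<le> g u" for k
    unfolding s(2) using gm[OF s(1) u\<rho>, of k] u(2)[of k] by simp
  show ?thesis
  proof (rule that[of "g u"])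
    show "t k < g u" for k
      by (rule order_less_le_trans[OF strict_monoD[OF assms lessI] le])
    show "\<exists>k. x < t k" if "x < g u" for x
      using order_tendstoD(1)[OF lim that] unfolding eventually_sequentially by blast
  qed (rule lim)
qed

text \<open>A closing-off argument: iterating a step that passes \<open>\<gamma>\<close> leads to a
  limit level \<open>l\<close> that also exceeds \<open>\<gamma>\<close> of every level of the
  sequence. Contradictions are then found at \<open>l\<close>.\<close>

lemma lray_limit_above:
  assumes "\<And>\<beta>::lray. \<beta> < \<gamma> \<beta>"
  obtains t l where "strict_mono t" "t 0 = b" "\<And>k. \<gamma> (t k) < t (Suc k)" "\<And>k. t k < l"
    "\<And>s. s < l \<Longrightarrow> \<exists>k. s < t k" "t \<longlonglongrightarrow> (l :: lray)"
proof -
  have "\<exists>y. \<gamma> x < y" for x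
    using assms by blast
  then obtain n where n: "\<And>x. \<gamma> x < n x" by metis
  define t where "t k = (n ^^ k) b" for k
  have "strict_mono t"
    unfolding strict_mono_Suc_iff
  proof
    fix k show "t k < t (Suc k)"
      using less_trans[OF assms[of "t k"] n[of "t k"]] by (simp add: t_def)
  qed
  then show ?thesis
    using lray_mono_limit[of t] that[of t] n by (auto simp: t_def)
qed

lemma lray_no_max: "\<exists>y. (x::lray) < y"
  using countable_bounded_lray[of "{x}"] by auto

lemma countable_bounded_lray_above:
  fixes b :: lray
  assumes "countable X"
  obtains m where "b < m" "\<And>x. x \<in> X \<Longrightarrow> x < m"
  by (rule countable_bounded_lray[of "insert b X"]) (use assms that in auto)

section \<open>Flow boxes and their orientation\<close>

lemma connected_nonzero_sign:
  fixes f :: "'a::topological_space \<Rightarrow> real"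
  assumes "connected T" "continuous_on T f" "\<And>x. x \<in> T \<Longrightarrow> f x \<noteq> 0"
  shows "(\<forall>x\<in>T. 0 < f x) \<or> (\<forall>x\<in>T. f x < 0)"
proof (rule ccontr)
  assume "\<not> ?thesis"
  then obtain x y where xy: "x \<in> T" "y \<in> T" "f x \<le> 0" "0 \<le> f y"
    by (auto simp: not_less)
  have "connected (f ` T)"
    using assms by (intro connected_continuous_image)
  then have "0 \<in> f ` T"
    by (rule connectedD_interval) (use xy in auto)
  with assms(3) show False by force
qed

text \<open>Convexity, written in coordinates for subsets of the function space that contains
  \<open>Euclidean_space n\<close>.\<close>

definition segment_closed :: "(nat \<Rightarrow> real) set \<Rightarrow> bool" where
  "segment_closed A \<longleftrightarrow> (\<forall>x\<in>A. \<forall>y\<in>A. \<forall>s\<in>{0..1}. (\<lambda>i. (1 - s) * x i + s * y i) \<in> A)"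

lemma segment_closed_Int: "segment_closed A \<Longrightarrow> segment_closed B \<Longrightarrow> segment_closed (A \<inter> B)"
  by (simp add: segment_closed_def)

lemma segment_closed_connected:
  assumes "segment_closed A"
  shows "connected A"
proof (cases "A = {}")
  case False
  then obtain x where x: "x \<in> A" by blast
  define P where "P y = (\<lambda>s i. (1 - s) * x i + s * y i) ` {0..1::real}" for y
  have "connected (P y)" for y
    unfolding P_def by (intro connected_continuous_image continuous_intros) simp
  moreover have "x \<in> P y" "y \<in> P y" for y
    unfolding P_def by (rule image_eqI[where x = 0]; simp)(rule image_eqI[where x = 1]; simp)
  moreover have "P y \<subseteq> A" if "y \<in> A" for y
    using assms x that unfolding P_def segment_closed_def by blast
  ultimately have c: "\<And>y. connected (P y)" and xy: "\<And>y. x \<in> P y" "\<And>y. y \<in> P y"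
    and sub: "\<And>y. y \<in> A \<Longrightarrow> P y \<subseteq> A" by blast+
  have "connected (\<Union>y\<in>A. P y)"
  proof (rule connected_Union)
    have "x \<in> (\<Inter>y\<in>A. P y)" using xy by blast
    then show "(\<Inter>y\<in>A. P y) \<noteq> {}" by blast
  qed (use c in blast)
  moreover have "(\<Union>y\<in>A. P y) = A"
    using sub xy(2) by blast
  ultimately show ?thesis by simp
qed simp

lemma compact_fun_box: "compact {y::nat \<Rightarrow> real. \<forall>i. y i \<in> {- c..c}}"
proof -
  have "compactin (product_topology (\<lambda>i. euclidean) UNIV) (PiE (UNIV::nat set) (\<lambda>i. {- c..c::real}))"
    by (subst compactin_PiE) auto
  moreover have "PiE (UNIV::nat set) (\<lambda>i. {- c..c::real}) = {y. \<forall>i. y i \<in> {- c..c}}"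
    by (auto simp: PiE_def Pi_def)
  ultimately show ?thesis
    by (simp add: euclidean_product_topology)
qed

definition cell :: "nat \<Rightarrow> (nat \<Rightarrow> real) set" where
  "cell m = {y. (\<forall>i<m. \<bar>y i\<bar> < 1) \<and> (\<forall>i\<ge>m. y i = 0)}"

definition fcube :: "nat \<Rightarrow> (real \<times> (nat \<Rightarrow> real)) set" where
  "fcube m = {-1<..<1} \<times> cell m"

lemma connected_cell: "connected (cell m)"
proof (rule segment_closed_connected)
  show "segment_closed (cell m)"
    unfolding segment_closed_def cell_def
  proof (intro ballI CollectI conjI allI impI)
    fix x y :: "nat \<Rightarrow> real" and s :: real and i
    assume *: "x \<in> {y. (\<forall>i<m. \<bar>y i\<bar> < 1) \<and> (\<forall>i\<ge>m. y i = 0)}"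
      "y \<in> {y. (\<forall>i<m. \<bar>y i\<bar> < 1) \<and> (\<forall>i\<ge>m. y i = 0)}" "s \<in> {0..1}"
    show "(1 - s) * x i + s * y i = 0" if "m \<le> i"
      using * that by simp
    show "\<bar>(1 - s) * x i + s * y i\<bar> < 1" if "i < m"
    proof -
      have "{z::real. \<bar>z\<bar> < 1} = {-1<..<1}" by auto
      then have "convex {z::real. \<bar>z\<bar> < 1}" by simp
      then show ?thesis
        using * that convexD_alt[of "{z::real. \<bar>z\<bar> < 1}" "x i" "y i" s] by simp
    qed
  qed
qed

lemma connected_fcube: "connected (fcube m)"
  unfolding fcube_def by (intro connected_Times connected_cell) auto

text \<open>The field \<open>pt\<close> is meant as the inverse of \<open>crd\<close>. The first
  coordinate \<open>ht\<close> runs along the leaves, the second, \<open>tr\<close>, distinguishes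
  the plaques.\<close>

record 'a flowbox =
  dom :: "'a set"
  crd :: "'a \<Rightarrow> real \<times> (nat \<Rightarrow> real)"
  pt :: "real \<times> (nat \<Rightarrow> real) \<Rightarrow> 'a"

abbreviation ht :: "('a, 'b) flowbox_scheme \<Rightarrow> 'a \<Rightarrow> real" where
  "ht c p \<equiv> fst (crd c p)"

abbreviation tr :: "('a, 'b) flowbox_scheme \<Rightarrow> 'a \<Rightarrow> nat \<Rightarrow> real" where
  "tr c p \<equiv> snd (crd c p)"

definition is_flowbox :: "nat \<Rightarrow> 'a::topological_space set \<Rightarrow> 'a flowbox \<Rightarrow> bool" where
  "is_flowbox m M c \<longleftrightarrow> openin (top_of_set M) (dom c) \<and>
     homeomorphism (dom c) (fcube m) (crd c) (pt c)"

definition flip :: "'a flowbox \<Rightarrow> 'a flowbox" where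
  "flip c = \<lparr>dom = dom c, crd = (\<lambda>p. (- ht c p, tr c p)), pt = (\<lambda>(s, y). pt c (- s, y))\<rparr>"

lemma flip_simps [simp]:
  "dom (flip c) = dom c" "ht (flip c) p = - ht c p" "tr (flip c) p = tr c p" "flip (flip c) = c"
  by (simp_all add: flip_def)

lemma is_flowbox_flip: "is_flowbox m M c \<Longrightarrow> is_flowbox m M (flip c)"
proof -
  assume c: "is_flowbox m M c"
  then have h: "homeomorphism (dom c) (fcube m) (crd c) (pt c)"
    by (simp add: is_flowbox_def)
  have neg: "(- s, y) \<in> fcube m \<longleftrightarrow> (s, y) \<in> fcube m" for s y
    by (auto simp: fcube_def)
  have "homeomorphism (dom c) (fcube m) (\<lambda>p. (- ht c p, tr c p)) (\<lambda>z. pt c (- fst z, snd z))"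
  proof (rule homeomorphismI)
    show "continuous_on (dom c) (\<lambda>p. (- ht c p, tr c p))"
      using homeomorphism_cont1[OF h] by (intro continuous_intros)
    show "continuous_on (fcube m) (\<lambda>z. pt c (- fst z, snd z))"
    proof (rule continuous_on_compose2[OF homeomorphism_cont2[OF h]])
      show "continuous_on (fcube m) (\<lambda>z. (- fst z, snd z))"
        by (intro continuous_intros)
      show "(\<lambda>z. (- fst z, snd z)) ` fcube m \<subseteq> fcube m"
        by (auto simp: fcube_def)
    qed
    have 1: "crd c p \<in> fcube m" if "p \<in> dom c" for p
      using homeomorphism_image1[OF h] that by blast
    have 2: "pt c z \<in> dom c" if "z \<in> fcube m" for z
      using homeomorphism_image2[OF h] that by blast
    show "(\<lambda>p. (- ht c p, tr c p)) ` dom c \<subseteq> fcube m"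
      using 1 neg by auto
    show "(\<lambda>z. pt c (- fst z, snd z)) ` fcube m \<subseteq> dom c"
      using 2 neg by auto
    show "pt c (- fst (- ht c p, tr c p), snd (- ht c p, tr c p)) = p" if "p \<in> dom c" for p
      using homeomorphism_apply1[OF h that] by simp
    show "(- ht c (pt c (- fst z, snd z)), tr c (pt c (- fst z, snd z))) = z" if "z \<in> fcube m" for z
      using homeomorphism_apply2[OF h, of "(- fst z, snd z)"] that neg[of "fst z" "snd z"] by simp
  qed
  then show ?thesis
    using c by (simp add: is_flowbox_def flip_def case_prod_unfold)
qed

text \<open>The assumption \<open>agree\<close> is the trace of the transversal maps
  \<open>h\<close>: it holds on the whole overlap of two boxes, even where this is disconnected. The
  centre in \<open>small\<close> is what makes a bump positive at the chosen point.\<close>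

locale flowbox_family =
  fixes m :: nat and M :: "'a::t2_space set" and \<B> :: "'a flowbox set"
  assumes box: "c \<in> \<B> \<Longrightarrow> is_flowbox m M c"
    and agree: "\<lbrakk>c \<in> \<B>; d \<in> \<B>; p \<in> dom c \<inter> dom d; q \<in> dom c \<inter> dom d\<rbrakk>
      \<Longrightarrow> tr c p = tr c q \<longleftrightarrow> tr d p = tr d q"
    and small: "\<lbrakk>p \<in> M; openin (top_of_set M) O'; p \<in> O'\<rbrakk>
      \<Longrightarrow> \<exists>c\<in>\<B>. p \<in> dom c \<and> dom c \<subseteq> O' \<and> crd c p = (0, \<lambda>_. 0)"
begin

lemma open_dom: "c \<in> \<B> \<Longrightarrow> openin (top_of_set M) (dom c)"
  using box by (simp add: is_flowbox_def)

lemma dom_subset: "c \<in> \<B> \<Longrightarrow> dom c \<subseteq> M"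
  using open_dom openin_imp_subset by blast

lemma homeo: "c \<in> \<B> \<Longrightarrow> homeomorphism (dom c) (fcube m) (crd c) (pt c)"
  using box by (simp add: is_flowbox_def)

lemma crd_in: "c \<in> \<B> \<Longrightarrow> p \<in> dom c \<Longrightarrow> crd c p \<in> fcube m"
  using homeomorphism_image1[OF homeo] by blast

lemma pt_in: "c \<in> \<B> \<Longrightarrow> z \<in> fcube m \<Longrightarrow> pt c z \<in> dom c"
  using homeomorphism_image2[OF homeo] by blast

lemma pt_crd: "c \<in> \<B> \<Longrightarrow> p \<in> dom c \<Longrightarrow> pt c (crd c p) = p"
  using homeomorphism_apply1[OF homeo] by blast

lemma crd_pt: "c \<in> \<B> \<Longrightarrow> z \<in> fcube m \<Longrightarrow> crd c (pt c z) = z"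
  using homeomorphism_apply2[OF homeo] by blast

lemma cont_crd: "c \<in> \<B> \<Longrightarrow> continuous_on (dom c) (crd c)"
  using homeomorphism_cont1[OF homeo] by blast

lemma cont_pt: "c \<in> \<B> \<Longrightarrow> continuous_on (fcube m) (pt c)"
  using homeomorphism_cont2[OF homeo] by blast

lemma crd_eqD: "c \<in> \<B> \<Longrightarrow> p \<in> dom c \<Longrightarrow> q \<in> dom c \<Longrightarrow> ht c p = ht c q \<Longrightarrow> tr c p = tr c q \<Longrightarrow> p = q"
  using pt_crd by (metis prod.expand)

lemma connected_dom: "c \<in> \<B> \<Longrightarrow> connected (dom c)"
  using connected_continuous_image[OF cont_pt connected_fcube] homeomorphism_image2[OF homeo] by metis

text \<open>Both boxes run through the leaves near \<open>p\<close> in the same direction. Since a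
  whole neighbourhood is involved, the relation is open in \<open>p\<close>.\<close>

definition coh :: "'a flowbox \<Rightarrow> 'a flowbox \<Rightarrow> 'a \<Rightarrow> bool" where
  "coh c d p \<longleftrightarrow> (\<exists>N. openin (top_of_set M) N \<and> p \<in> N \<and> N \<subseteq> dom c \<inter> dom d \<and>
     (\<forall>q\<in>N. \<forall>r\<in>N. tr c q = tr c r \<longrightarrow> (ht c q < ht c r \<longleftrightarrow> ht d q < ht d r)))"

lemma coh_nbhd:
  assumes "coh c d p"
  obtains N where "openin (top_of_set M) N" "p \<in> N" "N \<subseteq> dom c \<inter> dom d" "\<And>q. q \<in> N \<Longrightarrow> coh c d q"
    "\<And>q r. q \<in> N \<Longrightarrow> r \<in> N \<Longrightarrow> tr c q = tr c r \<Longrightarrow> ht c q < ht c r \<longleftrightarrow> ht d q < ht d r"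
  using assms unfolding coh_def by blast

lemma coh_refl: "c \<in> \<B> \<Longrightarrow> p \<in> dom c \<Longrightarrow> coh c c p"
  unfolding coh_def using open_dom by blast

lemma coh_sym:
  assumes "c \<in> \<B>" "d \<in> \<B>" "coh c d p"
  shows "coh d c p"
proof -
  obtain N where N: "openin (top_of_set M) N" "p \<in> N" "N \<subseteq> dom c \<inter> dom d"
    "\<And>q r. q \<in> N \<Longrightarrow> r \<in> N \<Longrightarrow> tr c q = tr c r \<Longrightarrow> ht c q < ht c r \<longleftrightarrow> ht d q < ht d r"
    by (rule coh_nbhd[OF assms(3)]) (rule that)
  have "ht d q < ht d r \<longleftrightarrow> ht c q < ht c r" if "q \<in> N" "r \<in> N" "tr d q = tr d r" for q r
    using N(4)[OF that(1,2)] agree[OF assms(1,2), of q r] that N(3) by blast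
  then show ?thesis
    unfolding coh_def using N(1-3) by blast
qed

lemma coh_trans:
  assumes "c \<in> \<B>" "d \<in> \<B>" "coh c d p" "coh d e p"
  shows "coh c e p"
proof -
  obtain N where N: "openin (top_of_set M) N" "p \<in> N" "N \<subseteq> dom c \<inter> dom d"
    "\<And>q r. q \<in> N \<Longrightarrow> r \<in> N \<Longrightarrow> tr c q = tr c r \<Longrightarrow> ht c q < ht c r \<longleftrightarrow> ht d q < ht d r"
    by (rule coh_nbhd[OF assms(3)]) (rule that)
  obtain N' where N': "openin (top_of_set M) N'" "p \<in> N'" "N' \<subseteq> dom d \<inter> dom e"
    "\<And>q r. q \<in> N' \<Longrightarrow> r \<in> N' \<Longrightarrow> tr d q = tr d r \<Longrightarrow> ht d q < ht d r \<longleftrightarrow> ht e q < ht e r"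
    by (rule coh_nbhd[OF assms(4)]) (rule that)
  have "ht c q < ht c r \<longleftrightarrow> ht e q < ht e r" if "q \<in> N \<inter> N'" "r \<in> N \<inter> N'" "tr c q = tr c r" for q r
    using N(4)[of q r] N'(4)[of q r] agree[OF assms(1,2), of q r] that N(3) by blast
  then show ?thesis
    unfolding coh_def using N N' openin_Int[OF N(1) N'(1)] by (intro exI[of _ "N \<inter> N'"]) blast
qed

lemma ordered_pairs_connected: "connected {((s, t), y). -1 < s \<and> s < t \<and> t < (1::real) \<and> y \<in> cell m}"
proof -
  have "convex {(s, t). -1 < s \<and> s < t \<and> t < (1::real)}"
  proof -
    have "{(s, t). -1 < s \<and> s < t \<and> t < (1::real)}
        = {z. inner (-1, 0) z < 1} \<inter> {z. inner (1, -1) z < 0} \<inter> {z. inner (0, 1) z < (1::real)}"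
      by auto
    then show ?thesis
      by (simp only:) (intro convex_Int convex_halfspace_lt)
  qed
  then have "connected ({(s, t). -1 < s \<and> s < t \<and> t < (1::real)} \<times> cell m)"
    by (intro connected_Times convex_connected connected_cell)
  moreover have "{(s, t). -1 < s \<and> s < t \<and> t < (1::real)} \<times> cell m
      = {((s, t), y). -1 < s \<and> s < t \<and> t < (1::real) \<and> y \<in> cell m}"
    by auto
  ultimately show ?thesis by simp
qed

text \<open>For two different points of a plaque of \<open>e\<close> the \<open>c\<close>-heights
  differ, since both points lie on one plaque of \<open>c\<close>. The pairs ordered by
  \<open>e\<close>-height, taken over all plaques at once, form a connected space, so the sign of
  the difference is the same for all of them.\<close>

lemma box_monotone:
  assumes c: "c \<in> \<B>" and e: "e \<in> \<B>" and sub: "dom e \<subseteq> dom c"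
  shows "(\<forall>q\<in>dom e. \<forall>r\<in>dom e. tr e q = tr e r \<longrightarrow> (ht e q < ht e r \<longleftrightarrow> ht c q < ht c r)) \<or>
         (\<forall>q\<in>dom e. \<forall>r\<in>dom e. tr e q = tr e r \<longrightarrow> (ht e q < ht e r \<longleftrightarrow> ht c q > ht c r))"
proof -
  define T where "T = {((s, t), y). -1 < s \<and> s < t \<and> t < (1::real) \<and> y \<in> cell m}"
  define f where "f = (\<lambda>((s, t), y). ht c (pt e (t, y)) - ht c (pt e (s, y)))"
  have inT: "(s, y) \<in> fcube m" "(t, y) \<in> fcube m" if "((s, t), y) \<in> T" for s t y
    using that by (auto simp: T_def fcube_def)
  have contT: "continuous_on T (\<lambda>z. ht c (pt e (g z, snd z)))"
    if "continuous_on T g" "\<And>z. z \<in> T \<Longrightarrow> (g z, snd z) \<in> fcube m" for g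
  proof -
    have "continuous_on T (\<lambda>z. (g z, snd z))"
      using that(1) by (intro continuous_intros)
    from continuous_on_compose2[OF cont_pt[OF e] this]
    have "continuous_on T (\<lambda>z. pt e (g z, snd z))"
      using that(2) by blast
    from continuous_on_compose2[OF cont_crd[OF c] this]
    have "continuous_on T (\<lambda>z. crd c (pt e (g z, snd z)))"
      using that(2) pt_in[OF e] sub by blast
    then show ?thesis by (rule continuous_on_fst)
  qed
  have "continuous_on T (\<lambda>z. ht c (pt e (snd (fst z), snd z)) - ht c (pt e (fst (fst z), snd z)))"
  proof (rule continuous_on_diff)
    show "continuous_on T (\<lambda>z. ht c (pt e (snd (fst z), snd z)))"
      by (rule contT) (use inT in \<open>auto intro!: continuous_intros\<close>)
    show "continuous_on T (\<lambda>z. ht c (pt e (fst (fst z), snd z)))"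
      by (rule contT) (use inT in \<open>auto intro!: continuous_intros\<close>)
  qed
  then have contf: "continuous_on T f"
    by (simp add: f_def case_prod_unfold)
  have key: "ht c q = ht c r \<Longrightarrow> q = r" if "q \<in> dom e" "r \<in> dom e" "tr e q = tr e r" for q r
    using agree[OF e c, of q r] that sub crd_eqD[OF c, of q r] by blast
  have "f z \<noteq> 0" if "z \<in> T" for z
  proof -
    obtain s t y where z: "z = ((s, t), y)" by (metis surj_pair)
    have d: "pt e (s, y) \<in> dom e" "pt e (t, y) \<in> dom e"
      using inT pt_in[OF e] that z by blast+
    have "pt e (s, y) \<noteq> pt e (t, y)"
    proof
      assume "pt e (s, y) = pt e (t, y)"
      then have "crd e (pt e (s, y)) = crd e (pt e (t, y))" by simp
      moreover have "((s, t), y) \<in> T" using that z by simp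
      ultimately have "(s, y) = (t, y)"
        using crd_pt[OF e inT(1)] crd_pt[OF e inT(2)] by simp
      then show False
        using \<open>((s, t), y) \<in> T\<close> by (simp add: T_def)
    qed
    then show ?thesis
      using key[OF d] crd_pt[OF e inT(1)] crd_pt[OF e inT(2)] that z by (auto simp: f_def)
  qed
  from connected_nonzero_sign[OF _ contf this]
  have sgn: "(\<forall>z\<in>T. 0 < f z) \<or> (\<forall>z\<in>T. f z < 0)"
    using ordered_pairs_connected unfolding T_def by blast
  have fval: "((ht e q, ht e r), tr e r) \<in> T" "f ((ht e q, ht e r), tr e r) = ht c r - ht c q"
    if "q \<in> dom e" "r \<in> dom e" "tr e q = tr e r" "ht e q < ht e r" for q r
  proof -
    have "crd e q = (ht e q, tr e r)" using that(3) by (simp add: prod_eq_iff)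
    then show "f ((ht e q, ht e r), tr e r) = ht c r - ht c q"
      using pt_crd[OF e that(1)] pt_crd[OF e that(2)] by (simp add: f_def)
    show "((ht e q, ht e r), tr e r) \<in> T"
      using crd_in[OF e that(1)] crd_in[OF e that(2)] that(4)
      by (auto simp: T_def fcube_def mem_Times_iff)
  qed
  have heq: "ht e q = ht e r \<Longrightarrow> ht c q = ht c r" if "q \<in> dom e" "r \<in> dom e" "tr e q = tr e r" for q r
    using crd_eqD[OF e that(1,2)] that(3) by auto
  from sgn show ?thesis
  proof
    assume *: "\<forall>z\<in>T. 0 < f z"
    have lt: "ht c q < ht c r" if "q \<in> dom e" "r \<in> dom e" "tr e q = tr e r" "ht e q < ht e r" for q r
      using bspec[OF * fval(1)[OF that]] fval(2)[OF that] by simp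
    have "ht e q < ht e r \<longleftrightarrow> ht c q < ht c r" if qr: "q \<in> dom e" "r \<in> dom e" "tr e q = tr e r" for q r
    proof (cases "ht e q" "ht e r" rule: linorder_cases)
      case less
      then show ?thesis using lt[OF qr] by simp
    next
      case equal
      then show ?thesis using heq[OF qr] by simp
    next
      case greater
      then show ?thesis using lt[OF qr(2,1)] qr(3) by simp
    qed
    then show ?thesis by blast
  next
    assume *: "\<forall>z\<in>T. f z < 0"
    have lt: "ht c q > ht c r" if "q \<in> dom e" "r \<in> dom e" "tr e q = tr e r" "ht e q < ht e r" for q r
      using bspec[OF * fval(1)[OF that]] fval(2)[OF that] by simp
    have "ht e q < ht e r \<longleftrightarrow> ht c q > ht c r" if qr: "q \<in> dom e" "r \<in> dom e" "tr e q = tr e r" for q r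
    proof (cases "ht e q" "ht e r" rule: linorder_cases)
      case less
      then show ?thesis using lt[OF qr] by simp
    next
      case equal
      then show ?thesis using heq[OF qr] by simp
    next
      case greater
      then show ?thesis using lt[OF qr(2,1)] qr(3) by simp
    qed
    then show ?thesis by blast
  qed
qed

text \<open>In a small box \<open>e\<close> inside both domains, \<open>c\<close> and
  \<open>d\<close> are each increasing or decreasing with respect to \<open>e\<close>; comparing the
  two cases leaves one direction or the other.\<close>

lemma coh_cases:
  assumes c: "c \<in> \<B>" and d: "d \<in> \<B>" and p: "p \<in> dom c" "p \<in> dom d"
  shows "coh c d p \<longleftrightarrow> \<not> coh (flip c) d p"
proof -
  have pM: "p \<in> M" using dom_subset[OF c] p by blast
  obtain e where e: "e \<in> \<B>" "p \<in> dom e" "dom e \<subseteq> dom c \<inter> dom d" "crd e p = (0, \<lambda>_. 0)"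
    using small[OF pM openin_Int[OF open_dom[OF c] open_dom[OF d]]] p by blast
  let ?P = "\<lambda>R. \<forall>q\<in>dom e. \<forall>r\<in>dom e. tr e q = tr e r \<longrightarrow> R q r"
  have ec: "tr c q = tr c r \<longleftrightarrow> tr e q = tr e r" if "q \<in> dom e" "r \<in> dom e" for q r
    using agree[OF c e(1), of q r] that e(3) by blast
  define inc where "inc f \<longleftrightarrow> ?P (\<lambda>q r. ht e q < ht e r \<longleftrightarrow> ht f q < ht f r)" for f :: "'a flowbox"
  define dec where "dec f \<longleftrightarrow> ?P (\<lambda>q r. ht e q < ht e r \<longleftrightarrow> ht f q > ht f r)" for f :: "'a flowbox"
  have cc: "inc c \<or> dec c" and dd: "inc d \<or> dec d"
    unfolding inc_def dec_def by (rule box_monotone[OF c e(1)], use e(3) in blast) (rule box_monotone[OF d e(1)], use e(3) in blast)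
  have incD: "ht e q < ht e r \<longleftrightarrow> ht f q < ht f r" if "inc f" "q \<in> dom e" "r \<in> dom e" "tr e q = tr e r" for f q r
    using that unfolding inc_def by blast
  have decD: "ht e q < ht e r \<longleftrightarrow> ht f r < ht f q" if "dec f" "q \<in> dom e" "r \<in> dom e" "tr e q = tr e r" for f q r
    using that unfolding dec_def by blast
  have "?P (\<lambda>q r. ht c q < ht c r \<longleftrightarrow> ht d q < ht d r) \<or> ?P (\<lambda>q r. ht c q > ht c r \<longleftrightarrow> ht d q < ht d r)"
  proof (cases "inc c = inc d")
    case True
    have "ht c q < ht c r \<longleftrightarrow> ht d q < ht d r" if qr: "q \<in> dom e" "r \<in> dom e" "tr e q = tr e r" for q r
    proof (cases "inc c")
      case True
      then show ?thesis using incD[OF _ qr] \<open>inc c = inc d\<close> by blast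
    next
      case False
      then have "dec c" "dec d" using cc dd \<open>inc c = inc d\<close> by blast+
      then show ?thesis using decD[OF _ qr(2,1) qr(3)[symmetric]] by blast
    qed
    then show ?thesis by blast
  next
    case False
    have "ht c q > ht c r \<longleftrightarrow> ht d q < ht d r" if qr: "q \<in> dom e" "r \<in> dom e" "tr e q = tr e r" for q r
    proof (cases "inc c")
      case True
      then have "dec d" using dd False by blast
      then show ?thesis
        using True incD[OF _ qr(2,1) qr(3)[symmetric]] decD[OF _ qr(2,1) qr(3)[symmetric]] by blast
    next
      case False
      then have "dec c" "inc d" using cc \<open>inc c \<noteq> inc d\<close> by blast+
      then show ?thesis using decD[OF _ qr] incD[OF _ qr] by blast
    qed
    then show ?thesis by blast
  qed
  then have "coh c d p \<or> coh (flip c) d p"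
  proof
    assume "?P (\<lambda>q r. ht c q < ht c r \<longleftrightarrow> ht d q < ht d r)"
    then have *: "ht c q < ht c r \<longleftrightarrow> ht d q < ht d r"
      if "q \<in> dom e" "r \<in> dom e" "tr e q = tr e r" for q r
      using that by blast
    have "ht c q < ht c r \<longleftrightarrow> ht d q < ht d r"
      if "q \<in> dom e" "r \<in> dom e" "tr c q = tr c r" for q r
      by (rule *[OF that(1,2)]) (use ec[OF that(1,2)] that(3) in simp)
    then have "coh c d p"
      unfolding coh_def using e(2,3) open_dom[OF e(1)] by blast
    then show ?thesis ..
  next
    assume "?P (\<lambda>q r. ht c q > ht c r \<longleftrightarrow> ht d q < ht d r)"
    then have *: "ht c q > ht c r \<longleftrightarrow> ht d q < ht d r"
      if "q \<in> dom e" "r \<in> dom e" "tr e q = tr e r" for q r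
      using that by blast
    have "ht (flip c) q < ht (flip c) r \<longleftrightarrow> ht d q < ht d r"
      if "q \<in> dom e" "r \<in> dom e" "tr (flip c) q = tr (flip c) r" for q r
      unfolding flip_simps neg_less_iff_less
      by (rule *[OF that(1,2)]) (use ec[OF that(1,2)] that(3) in simp)
    moreover have "dom e \<subseteq> dom (flip c) \<inter> dom d"
      using e(3) by simp
    ultimately have "coh (flip c) d p"
      unfolding coh_def using e(2) open_dom[OF e(1)] by blast
    then show ?thesis ..
  qed
  moreover have "\<not> (coh c d p \<and> coh (flip c) d p)"
  proof
    assume *: "coh c d p \<and> coh (flip c) d p"
    obtain N where N: "openin (top_of_set M) N" "p \<in> N" "N \<subseteq> dom c \<inter> dom d"
      "\<And>q r. q \<in> N \<Longrightarrow> r \<in> N \<Longrightarrow> tr c q = tr c r \<Longrightarrow> ht c q < ht c r \<longleftrightarrow> ht d q < ht d r"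
    proof -
      have "coh c d p" using * by blast
      then show thesis
        by (rule coh_nbhd) (rule that)
    qed
    obtain N' where N': "openin (top_of_set M) N'" "p \<in> N'"
      "\<And>q r. q \<in> N' \<Longrightarrow> r \<in> N' \<Longrightarrow> tr c q = tr c r \<Longrightarrow> ht c r < ht c q \<longleftrightarrow> ht d q < ht d r"
    proof -
      have "coh (flip c) d p" using * by blast
      then show thesis
        by (rule coh_nbhd) (rule that, simp_all)
    qed
    \<comment> \<open>Both directions at once are refuted by any two different points of one plaque;
      here the heights 0 and 1/2 on the central plaque of \<open>g\<close>.\<close>
    obtain g where g: "g \<in> \<B>" "p \<in> dom g" "dom g \<subseteq> N \<inter> N'"
      using small[OF pM openin_Int[OF N(1) N'(1)]] N(2) N'(2) by blast
    have z: "(0, \<lambda>_. 0) \<in> fcube m" "(1/2, \<lambda>_. 0) \<in> fcube m"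
      by (auto simp: fcube_def cell_def)
    define q r where "q = pt g (0, \<lambda>_. 0)" and "r = pt g (1/2, \<lambda>_. 0)"
    have crd: "crd g q = (0, \<lambda>_. 0)" "crd g r = (1/2, \<lambda>_. 0)"
      unfolding q_def r_def by (rule crd_pt[OF g(1) z(1)], rule crd_pt[OF g(1) z(2)])
    have "q \<in> dom g" "r \<in> dom g"
      unfolding q_def r_def by (rule pt_in[OF g(1) z(1)], rule pt_in[OF g(1) z(2)])
    moreover have "tr g q = tr g r" "q \<noteq> r"
      using crd by auto
    ultimately have qr: "q \<in> dom g" "r \<in> dom g" "tr g q = tr g r" "q \<noteq> r"
      by simp_all
    then have "q \<in> N" "r \<in> N" "q \<in> N'" "r \<in> N'"
      using g(3) by blast+
    moreover have "tr c q = tr c r"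
      using agree[OF g(1) c, of q r] qr \<open>q \<in> N\<close> \<open>r \<in> N\<close> N(3) by blast
    ultimately have "ht c q < ht c r \<longleftrightarrow> ht c r < ht c q"
      using N(4)[of q r] N'(3)[of q r] by blast
    then have "ht c q = ht c r"
      by (cases "ht c q" "ht c r" rule: linorder_cases) simp_all
    then show False
      using crd_eqD[OF c] qr(4) \<open>tr c q = tr c r\<close> \<open>q \<in> N\<close> \<open>r \<in> N\<close> N(3) by blast
  qed
  ultimately show ?thesis by blast
qed

end

section \<open>Orientations of subsets: uniqueness, reversal and gluing\<close>

locale flip_family = flowbox_family +
  assumes flip_closed: "c \<in> \<B> \<Longrightarrow> flip c \<in> \<B>"
begin

text \<open>An orientation is a box at each point such that neighbouring boxes run in the same
  direction. Only points of \<open>A\<close> are compared, so that \<open>A\<close> may be a closed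
  set such as the image of a ball.\<close>

definition orients :: "('a \<Rightarrow> 'a flowbox) \<Rightarrow> 'a set \<Rightarrow> bool" where
  "orients \<tau> A \<longleftrightarrow> A \<subseteq> M \<and> (\<forall>p\<in>A. \<tau> p \<in> \<B> \<and> p \<in> dom (\<tau> p)) \<and>
     (\<forall>p\<in>A. \<exists>N. openin (top_of_set M) N \<and> p \<in> N \<and> (\<forall>q\<in>N \<inter> A. coh (\<tau> p) (\<tau> q) q))"

lemma coh_flip_left: "\<lbrakk>c \<in> \<B>; d \<in> \<B>; p \<in> dom c; p \<in> dom d\<rbrakk> \<Longrightarrow> coh (flip c) d p \<longleftrightarrow> \<not> coh c d p"
  using coh_cases by blast

lemma coh_comm: "\<lbrakk>c \<in> \<B>; d \<in> \<B>\<rbrakk> \<Longrightarrow> coh c d p \<longleftrightarrow> coh d c p"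
  using coh_sym by blast

lemma coh_flip_flip:
  assumes "c \<in> \<B>" "d \<in> \<B>" "p \<in> dom c" "p \<in> dom d"
  shows "coh (flip c) (flip d) p \<longleftrightarrow> coh c d p"
proof -
  have "coh (flip c) (flip d) p \<longleftrightarrow> \<not> coh c (flip d) p"
    using assms by (intro coh_flip_left flip_closed) simp_all
  also have "coh c (flip d) p \<longleftrightarrow> coh (flip d) c p"
    using assms by (intro coh_comm flip_closed)
  also have "coh (flip d) c p \<longleftrightarrow> \<not> coh d c p"
    using assms by (intro coh_flip_left)
  finally show ?thesis
    using coh_comm[OF assms(1,2)] by blast
qed

lemma coh_not_trans:
  assumes "c \<in> \<B>" "d \<in> \<B>" "e \<in> \<B>" "p \<in> dom c" "p \<in> dom d" "p \<in> dom e" "\<not> coh c d p" "coh d e p"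
  shows "\<not> coh c e p"
proof
  assume "coh c e p"
  moreover have "coh e d p" using coh_sym assms(2,3,8) by blast
  ultimately have "coh c d p" by (rule coh_trans[OF assms(1,3)])
  with assms show False by blast
qed

lemma orients_flip: "orients \<tau> A \<Longrightarrow> orients (\<lambda>p. flip (\<tau> p)) A"
proof -
  assume \<tau>: "orients \<tau> A"
  have "\<exists>N. openin (top_of_set M) N \<and> p \<in> N \<and> (\<forall>q\<in>N \<inter> A. coh (flip (\<tau> p)) (flip (\<tau> q)) q)"
    if p: "p \<in> A" for p
  proof -
    obtain N where N: "openin (top_of_set M) N" "p \<in> N" "\<forall>q\<in>N \<inter> A. coh (\<tau> p) (\<tau> q) q"
      using \<tau> p unfolding orients_def by blast
    have "coh (flip (\<tau> p)) (flip (\<tau> q)) q" if q: "q \<in> N \<inter> A" for q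
    proof -
      have c: "coh (\<tau> p) (\<tau> q) q" using N q by blast
      then have "q \<in> dom (\<tau> p)" "q \<in> dom (\<tau> q)" unfolding coh_def by blast+
      moreover have "\<tau> p \<in> \<B>" "\<tau> q \<in> \<B>" using \<tau> p q unfolding orients_def by blast+
      ultimately show ?thesis using coh_flip_flip c by blast
    qed
    with N show ?thesis by blast
  qed
  then show ?thesis
    using \<tau> flip_closed unfolding orients_def by simp
qed

lemma orients_subset: "orients \<tau> A \<Longrightarrow> A' \<subseteq> A \<Longrightarrow> orients \<tau> A'"
proof -
  assume \<tau>: "orients \<tau> A" and sub: "A' \<subseteq> A"
  have "\<exists>N. openin (top_of_set M) N \<and> p \<in> N \<and> (\<forall>q\<in>N \<inter> A'. coh (\<tau> p) (\<tau> q) q)" if p: "p \<in> A'" for p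
  proof -
    obtain N where "openin (top_of_set M) N" "p \<in> N" "\<forall>q\<in>N \<inter> A. coh (\<tau> p) (\<tau> q) q"
      using \<tau> p sub unfolding orients_def by blast
    then show ?thesis using sub by (intro exI[of _ N]) blast
  qed
  moreover have "\<tau> p \<in> \<B> \<and> p \<in> dom (\<tau> p)" if "p \<in> A'" for p
    using \<tau> that sub unfolding orients_def by blast
  moreover have "A' \<subseteq> M" using \<tau> sub unfolding orients_def by blast
  ultimately show "orients \<tau> A'" unfolding orients_def by simp
qed

lemma orients_eq_local:
  assumes \<tau>: "orients \<tau> A" and \<sigma>: "orients \<sigma> A" and p: "p \<in> A"
  obtains N where "openin (top_of_set M) N" "p \<in> N"
    "\<And>q. q \<in> N \<inter> A \<Longrightarrow> coh (\<tau> q) (\<sigma> q) q \<longleftrightarrow> coh (\<tau> p) (\<sigma> p) p"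
proof -
  obtain N where N: "openin (top_of_set M) N" "p \<in> N" "\<forall>q\<in>N \<inter> A. coh (\<tau> p) (\<tau> q) q"
    using \<tau> p unfolding orients_def by blast
  obtain N' where N': "openin (top_of_set M) N'" "p \<in> N'" "\<forall>q\<in>N' \<inter> A. coh (\<sigma> p) (\<sigma> q) q"
    using \<sigma> p unfolding orients_def by blast
  have B: "\<tau> q \<in> \<B>" "\<sigma> q \<in> \<B>" "q \<in> dom (\<tau> q)" "q \<in> dom (\<sigma> q)" if "q \<in> A" for q
    using \<tau> \<sigma> that unfolding orients_def by blast+
  \<comment> \<open>With \<open>\<tau> p\<close> reversed if necessary, agreement and disagreement
    at \<open>p\<close> both turn into coherence, which is an open condition.\<close>
  define c where "c = (if coh (\<tau> p) (\<sigma> p) p then \<tau> p else flip (\<tau> p))"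
  have "coh c (\<sigma> p) p"
    using coh_flip_left[OF B[OF p]] by (simp add: c_def)
  then obtain K where K: "openin (top_of_set M) K" "p \<in> K" "\<And>q. q \<in> K \<Longrightarrow> coh c (\<sigma> p) q"
    by (rule coh_nbhd) (rule that)
  have "coh (\<tau> q) (\<sigma> q) q \<longleftrightarrow> coh (\<tau> p) (\<sigma> p) p" if q: "q \<in> N \<inter> N' \<inter> K \<inter> A" for q
  proof -
    have 1: "coh (\<tau> p) (\<tau> q) q" "coh (\<sigma> p) (\<sigma> q) q" "coh c (\<sigma> p) q"
      using N N' K q by blast+
    then have d: "q \<in> dom (\<tau> p)" "q \<in> dom (\<sigma> p)" unfolding coh_def by blast+
    have qA: "q \<in> A" using q by blast
    have 2: "coh (\<tau> q) (\<tau> p) q" using coh_sym 1 B p qA by blast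
    show ?thesis
    proof (cases "coh (\<tau> p) (\<sigma> p) p")
      case True
      then have "coh (\<tau> p) (\<sigma> p) q" using 1 by (simp add: c_def)
      then have "coh (\<tau> q) (\<sigma> q) q"
        using coh_trans 1 2 B p qA by meson
      with True show ?thesis by blast
    next
      case False
      then have "coh (flip (\<tau> p)) (\<sigma> p) q" using 1 by (simp add: c_def)
      then have "\<not> coh (\<tau> p) (\<sigma> p) q"
        using coh_flip_left[OF B(1)[OF p] B(2)[OF p] d] by blast
      then have "\<not> coh (\<tau> p) (\<sigma> q) q"
        using coh_not_trans[OF B(1)[OF p] B(2)[OF p] B(2)[OF qA] d B(4)[OF qA]] 1 by blast
      then have "\<not> coh (\<tau> q) (\<sigma> q) q"
        using coh_trans[OF B(1)[OF p] B(1)[OF qA] 1(1)] by blast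
      with False show ?thesis by blast
    qed
  qed
  moreover have "openin (top_of_set M) (N \<inter> N' \<inter> K)" "p \<in> N \<inter> N' \<inter> K"
    using N N' K by auto
  ultimately show ?thesis by (rule_tac that)
qed

lemma orients_unique:
  assumes \<tau>: "orients \<tau> A" and \<sigma>: "orients \<sigma> A" and "connected A" "a \<in> A" "b \<in> A" "coh (\<tau> a) (\<sigma> a) a"
  shows "coh (\<tau> b) (\<sigma> b) b"
proof (rule connected_induction_simple[where S = A and a = a and b = b and P = "\<lambda>q. coh (\<tau> q) (\<sigma> q) q"])
  fix p assume p: "p \<in> A"
  obtain N where N: "openin (top_of_set M) N" "p \<in> N"
    "\<And>q. q \<in> N \<inter> A \<Longrightarrow> coh (\<tau> q) (\<sigma> q) q \<longleftrightarrow> coh (\<tau> p) (\<sigma> p) p"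
    by (rule orients_eq_local[OF \<tau> \<sigma> p]) (rule that)
  have "A \<subseteq> M" using \<tau> unfolding orients_def by blast
  then have "openin (top_of_set A) (N \<inter> A)"
  proof -
    assume AM: "A \<subseteq> M"
    obtain T where "open T" "N = M \<inter> T" using N(1) by (auto simp: openin_open)
    then show ?thesis using AM by (auto simp: openin_open)
  qed
  then show "\<exists>T. openin (top_of_set A) T \<and> p \<in> T \<and> (\<forall>x\<in>T. \<forall>y\<in>T. coh (\<tau> x) (\<sigma> x) x \<longrightarrow> coh (\<tau> y) (\<sigma> y) y)"
  proof (intro exI[of _ "N \<inter> A"] conjI ballI impI)
    show "p \<in> N \<inter> A" using N(2) p by blast
    show "coh (\<tau> y) (\<sigma> y) y" if "x \<in> N \<inter> A" "y \<in> N \<inter> A" "coh (\<tau> x) (\<sigma> x) x" for x y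
      using N(3)[OF that(1)] N(3)[OF that(2)] that(3) by blast
  qed
qed (use assms in auto)

text \<open>Closedness matters at the points of just one of the sets: the complement of the other
  one is a neighbourhood in which only one orientation is seen.\<close>

lemma orients_glue_coherent:
  assumes \<tau>: "orients \<tau> A" and \<sigma>: "orients \<sigma> B"
    and cl: "closedin (top_of_set M) A" "closedin (top_of_set M) B"
    and coh: "\<And>q. q \<in> A \<inter> B \<Longrightarrow> coh (\<tau> q) (\<sigma> q) q"
  shows "\<exists>\<theta>. orients \<theta> (A \<union> B)"
proof -
  define \<theta> where "\<theta> q = (if q \<in> A then \<tau> q else \<sigma> q)" for q
  have AM: "A \<subseteq> M" "B \<subseteq> M" using cl closedin_imp_subset by blast+
  have T: "\<tau> q \<in> \<B>" "q \<in> dom (\<tau> q)" if "q \<in> A" for q using \<tau> that unfolding orients_def by blast+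
  have S: "\<sigma> q \<in> \<B>" "q \<in> dom (\<sigma> q)" if "q \<in> B" for q using \<sigma> that unfolding orients_def by blast+
  have op: "openin (top_of_set M) (M - A)" "openin (top_of_set M) (M - B)"
    using cl openin_diff[of "top_of_set M" M] by auto
  have "\<exists>N. openin (top_of_set M) N \<and> p \<in> N \<and> (\<forall>q\<in>N \<inter> (A \<union> B). coh (\<theta> p) (\<theta> q) q)"
    if p: "p \<in> A \<union> B" for p
  proof (cases "p \<in> A")
    case pA: True
    obtain N where N: "openin (top_of_set M) N" "p \<in> N" "\<forall>q\<in>N \<inter> A. coh (\<tau> p) (\<tau> q) q"
      using \<tau> pA unfolding orients_def by blast
    show ?thesis
    proof (cases "p \<in> B")
      case False
      have "coh (\<theta> p) (\<theta> q) q" if "q \<in> (N \<inter> (M - B)) \<inter> (A \<union> B)" for q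
        using that N pA by (auto simp: \<theta>_def)
      moreover have "openin (top_of_set M) (N \<inter> (M - B))" "p \<in> N \<inter> (M - B)"
        using N(1,2) op False pA AM by auto
      ultimately show ?thesis by blast
    next
      case pB: True
      obtain N' where N': "openin (top_of_set M) N'" "p \<in> N'" "\<forall>q\<in>N' \<inter> B. coh (\<sigma> p) (\<sigma> q) q"
        using \<sigma> pB unfolding orients_def by blast
      obtain K where K: "openin (top_of_set M) K" "p \<in> K" "\<And>q. q \<in> K \<Longrightarrow> coh (\<tau> p) (\<sigma> p) q"
      proof -
        have "coh (\<tau> p) (\<sigma> p) p" using coh pA pB by blast
        then show thesis by (rule coh_nbhd) (rule that)
      qed
      have "coh (\<theta> p) (\<theta> q) q" if q: "q \<in> (N \<inter> N' \<inter> K) \<inter> (A \<union> B)" for q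
      proof (cases "q \<in> A")
        case True
        then show ?thesis using q N pA by (auto simp: \<theta>_def)
      next
        case False
        then have "coh (\<sigma> p) (\<sigma> q) q" "coh (\<tau> p) (\<sigma> p) q" using q N' K by blast+
        then have "coh (\<tau> p) (\<sigma> q) q" using coh_trans T(1)[OF pA] S(1)[OF pB] by blast
        then show ?thesis using False pA by (simp add: \<theta>_def)
      qed
      moreover have "openin (top_of_set M) (N \<inter> N' \<inter> K)" "p \<in> N \<inter> N' \<inter> K"
        using N N' K by auto
      ultimately show ?thesis by blast
    qed
  next
    case pA: False
    then have pB: "p \<in> B" using p by blast
    obtain N' where N': "openin (top_of_set M) N'" "p \<in> N'" "\<forall>q\<in>N' \<inter> B. coh (\<sigma> p) (\<sigma> q) q"
      using \<sigma> pB unfolding orients_def by blast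
    have "coh (\<theta> p) (\<theta> q) q" if "q \<in> (N' \<inter> (M - A)) \<inter> (A \<union> B)" for q
      using that N' pA by (auto simp: \<theta>_def)
    moreover have "openin (top_of_set M) (N' \<inter> (M - A))" "p \<in> N' \<inter> (M - A)"
      using N'(1,2) op pA pB AM by auto
    ultimately show ?thesis by blast
  qed
  moreover have "\<theta> q \<in> \<B> \<and> q \<in> dom (\<theta> q)" if "q \<in> A \<union> B" for q
    using T[of q] S[of q] that by (auto simp: \<theta>_def)
  ultimately have "orients \<theta> (A \<union> B)"
    unfolding orients_def using AM by simp
  then show ?thesis by (intro exI[of _ \<theta>])
qed

text \<open>On a connected overlap two orientations agree everywhere or nowhere; in the latter case
  one of them is reversed. An empty overlap falls under the second case.\<close>

lemma orients_glue:
  assumes "orients \<tau> A" "orients \<sigma> B" "closedin (top_of_set M) A" "closedin (top_of_set M) B"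
    "connected (A \<inter> B)"
  shows "\<exists>\<theta>. orients \<theta> (A \<union> B)"
proof (cases "\<exists>a\<in>A \<inter> B. coh (\<tau> a) (\<sigma> a) a")
  case True
  then obtain a where a: "a \<in> A \<inter> B" "coh (\<tau> a) (\<sigma> a) a" by blast
  have "coh (\<tau> q) (\<sigma> q) q" if "q \<in> A \<inter> B" for q
    by (rule orients_unique[OF orients_subset[OF assms(1)] orients_subset[OF assms(2)] assms(5) a(1) that a(2)]) auto
  then show ?thesis
    by (rule orients_glue_coherent[OF assms(1-4)])
next
  case False
  have "coh (flip (\<tau> q)) (\<sigma> q) q" if "q \<in> A \<inter> B" for q
    using False that coh_flip_left[of "\<tau> q" "\<sigma> q" q] assms(1,2) unfolding orients_def by blast
  then show ?thesis
    by (rule orients_glue_coherent[OF orients_flip[OF assms(1)] assms(2-4)])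
qed

lemma orients_in_box: "c \<in> \<B> \<Longrightarrow> A \<subseteq> dom c \<Longrightarrow> orients (\<lambda>_. c) A"
  unfolding orients_def using open_dom[of c] dom_subset[of c] coh_refl[of c] by blast

section \<open>Orientability of boxes\<close>

text \<open>Repeated bisection: were the image of a box not orientable, one could halve it
  in every direction, again and again, until it lies inside a flow box.\<close>

definition cut_box :: "nat \<Rightarrow> (nat \<Rightarrow> real) set \<Rightarrow> (nat \<Rightarrow> real) \<Rightarrow> (nat \<Rightarrow> real) \<Rightarrow> (nat \<Rightarrow> real) set" where
  "cut_box n Z l h = Z \<inter> {z. \<forall>i<n. l i \<le> z i \<and> z i \<le> h i}"

lemma segment_closed_cut_box: "segment_closed Z \<Longrightarrow> segment_closed (cut_box n Z l h)"
  unfolding cut_box_def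
proof (rule segment_closed_Int)
  show "segment_closed {z. \<forall>i<n. l i \<le> z i \<and> z i \<le> h i}"
    unfolding segment_closed_def
  proof (intro ballI CollectI allI impI)
    fix x y s i
    assume *: "x \<in> {z. \<forall>i<n. l i \<le> z i \<and> z i \<le> h i}" "y \<in> {z. \<forall>i<n. l i \<le> z i \<and> z i \<le> h i}"
      "s \<in> {0..1::real}" "i < n"
    then have "x i \<in> {l i..h i}" "y i \<in> {l i..h i}" by auto
    from convexD_alt[OF convex_real_interval(5) this, of s]
    show "l i \<le> (1 - s) * x i + s * y i \<and> (1 - s) * x i + s * y i \<le> h i"
      using * by simp
  qed
qed

lemma closed_box_strip: "closed {z::nat \<Rightarrow> real. \<forall>i<n. l i \<le> z i \<and> z i \<le> h i}"
proof -
  have "{z::nat \<Rightarrow> real. \<forall>i<n. l i \<le> z i \<and> z i \<le> h i} = (\<Inter>i\<in>{..<n}. {z. l i \<le> z i} \<inter> {z. z i \<le> h i})"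
    by auto
  then show ?thesis
    by (auto intro!: closed_INT closed_Int closed_Collect_le continuous_on_product_coordinates continuous_on_const)
qed

lemma orientable_image:
  fixes E :: "(nat \<Rightarrow> real) \<Rightarrow> 'a"
  assumes Z: "compact Z" "segment_closed Z" "\<And>z i. z \<in> Z \<Longrightarrow> n \<le> i \<Longrightarrow> z i = 0"
    "\<And>z i. z \<in> Z \<Longrightarrow> \<bar>z i\<bar> \<le> b"
    and E: "continuous_on Z E" "inj_on E Z" "E ` Z \<subseteq> M"
  shows "\<exists>\<tau>. orients \<tau> (E ` Z)"
proof (rule ccontr)
  assume not: "\<not> ?thesis"
  let ?C = "cut_box n Z"
  let ?bad = "\<lambda>l h. \<nexists>\<tau>. orients \<tau> (E ` ?C l h)"
  have compC: "compact (?C l h)" for l h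
    unfolding cut_box_def by (rule compact_Int_closed[OF Z(1) closed_box_strip])
  have CZ: "?C l h \<subseteq> Z" for l h unfolding cut_box_def by blast
  have closedC: "closedin (top_of_set M) (E ` ?C l h)" for l h
  proof -
    have "closed (E ` ?C l h)"
      by (rule compact_imp_closed, rule compact_continuous_image[OF continuous_on_subset[OF E(1) CZ] compC])
    moreover have "E ` ?C l h \<subseteq> M" using E(3) CZ[of l h] by blast
    ultimately show ?thesis by (simp add: closed_subset)
  qed
  \<comment> \<open>The first \<open>k\<close> sides are halved one after the other. If both halves
    were orientable, the two orientations could be glued along their common face, whose image is
    connected.\<close>
  have halve: "\<exists>l' h'. ?bad l' h' \<and> (\<forall>i. l i \<le> l' i \<and> h' i \<le> h i) \<and>
      (\<forall>i<k. h' i - l' i = (h i - l i) / 2)" if "?bad l h" "\<forall>i. l i \<le> h i" "k \<le> n" for l h k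
    using that(3)
  proof (induction k)
    case 0
    then show ?case using that by (intro exI[of _ l] exI[of _ h]) simp
  next
    case (Suc k)
    then obtain l' h' where lh: "?bad l' h'" "\<forall>i. l i \<le> l' i \<and> h' i \<le> h i"
      "\<forall>i<k. h' i - l' i = (h i - l i) / 2" by auto
    define c where "c = (l k + h k) / 2"
    define hh where "hh = h'(k := min (h' k) c)"
    define ll where "ll = l'(k := max (l' k) c)"
    have ex: "?bad l' hh \<or> ?bad ll h'"
    proof (rule ccontr)
      assume "\<not> ?thesis"
      then obtain \<tau> \<sigma> where ts: "orients \<tau> (E ` ?C l' hh)" "orients \<sigma> (E ` ?C ll h')" by blast
      have un: "?C l' hh \<union> ?C ll h' = ?C l' h'"
      proof (intro equalityI subsetI)
        fix z assume "z \<in> ?C l' hh \<union> ?C ll h'"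
        then show "z \<in> ?C l' h'"
          unfolding cut_box_def hh_def ll_def by (auto split: if_splits)
      next
        fix z assume z: "z \<in> ?C l' h'"
        show "z \<in> ?C l' hh \<union> ?C ll h'"
          using z unfolding cut_box_def hh_def ll_def
          by (cases "z k \<le> c") auto
      qed
      have int: "?C l' hh \<inter> ?C ll h' = ?C ll hh"
        unfolding cut_box_def hh_def ll_def by (auto split: if_splits)
      have "connected (E ` ?C ll hh)"
        by (intro connected_continuous_image continuous_on_subset[OF E(1) CZ]
            segment_closed_connected segment_closed_cut_box Z(2))
      moreover have "E ` ?C l' hh \<inter> E ` ?C ll h' = E ` ?C ll hh"
        unfolding int[symmetric] by (rule inj_on_image_Int[OF E(2) CZ CZ, symmetric])
      ultimately have "\<exists>\<theta>. orients \<theta> (E ` ?C l' hh \<union> E ` ?C ll h')"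
        using orients_glue[OF ts closedC closedC] by simp
      then show False
        using lh(1) un by (simp add: image_Un[symmetric])
    qed
    from ex show ?case
    proof
      assume bad: "?bad l' hh"
      \<comment> \<open>The bad part is enlarged to a full half of the original side, so that the
        widths are exact; a set containing a bad one is bad, as orientations restrict to
        subsets.\<close>
      define l2 where "l2 = l'(k := l k)"
      define h2 where "h2 = hh(k := c)"
      have sub: "?C l' hh \<subseteq> ?C l2 h2"
        unfolding cut_box_def l2_def h2_def hh_def using lh(2) by (auto split: if_splits intro: order_trans)
      then have "?bad l2 h2"
        using bad orients_subset by (meson image_mono)
      moreover have "\<forall>i. l i \<le> l2 i \<and> h2 i \<le> h i"
        using lh(2) that(2) by (auto simp: l2_def h2_def hh_def c_def field_simps)
      moreover have "\<forall>i<Suc k. h2 i - l2 i = (h i - l i) / 2"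
        using lh(3) by (auto simp: l2_def h2_def hh_def c_def less_Suc_eq field_simps)
      ultimately show ?case by blast
    next
      assume bad: "?bad ll h'"
      define l2 where "l2 = ll(k := c)"
      define h2 where "h2 = h'(k := h k)"
      have sub: "?C ll h' \<subseteq> ?C l2 h2"
        unfolding cut_box_def l2_def h2_def ll_def using lh(2) by (auto split: if_splits intro: order_trans)
      then have "?bad l2 h2"
        using bad orients_subset by (meson image_mono)
      moreover have "\<forall>i. l i \<le> l2 i \<and> h2 i \<le> h i"
        using lh(2) that(2) by (auto simp: l2_def h2_def ll_def c_def field_simps)
      moreover have "\<forall>i<Suc k. h2 i - l2 i = (h i - l i) / 2"
        using lh(3) by (auto simp: l2_def h2_def ll_def c_def less_Suc_eq field_simps)
      ultimately show ?case by blast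
    qed
  qed
  define bad2 where "bad2 = (\<lambda>(l, h). ?bad l h \<and> (\<forall>i. l i \<le> h i))"
  define good_step where "good_step = (\<lambda>(l, h) (l', h'). (\<forall>i. l i \<le> l' i \<and> h' i \<le> h i) \<and>
      (\<forall>i<n. h' i - l' i = (h i - l i) / (2::real)))"
  have step: "\<exists>y. bad2 y \<and> good_step x y" if bx: "bad2 x" for x
  proof -
    obtain l h where x: "x = (l, h)" by (cases x)
    then obtain l' h' where *: "?bad l' h'" "\<forall>i. l i \<le> l' i \<and> h' i \<le> h i"
      "\<forall>i<n. h' i - l' i = (h i - l i) / 2"
    proof -
      have "?bad l h" "\<forall>i. l i \<le> h i" using bx x unfolding bad2_def by simp_all
      from halve[OF this order_refl] show thesis using that by blast
    qed
    define l2 where "l2 i = (if i < n then l' i else l i)" for i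
    define h2 where "h2 i = (if i < n then h' i else h i)" for i
    have "?C l2 h2 = ?C l' h'" unfolding cut_box_def l2_def h2_def by auto
    with *(1) have "?bad l2 h2" by simp
    moreover have "l2 i \<le> h2 i" for i
    proof -
      have "l i \<le> h i" using bx x by (simp add: bad2_def)
      moreover have "0 \<le> h' i - l' i" if "i < n"
        using *(3)[rule_format, OF that] \<open>l i \<le> h i\<close> by simp
      ultimately show ?thesis by (auto simp: l2_def h2_def)
    qed
    ultimately have "bad2 (l2, h2)" by (simp add: bad2_def)
    moreover have "good_step x (l2, h2)"
      using * x by (auto simp: good_step_def l2_def h2_def)
    ultimately show ?thesis by blast
  qed
  have "?C (\<lambda>_. - \<bar>b\<bar>) (\<lambda>_. \<bar>b\<bar>) = Z"
    unfolding cut_box_def using Z(4) by (auto simp: abs_le_iff intro: order_trans[OF _ abs_ge_self]) (smt (verit))+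
  then have start: "bad2 ((\<lambda>_. - \<bar>b\<bar>), (\<lambda>_. \<bar>b\<bar>))"
    using not by (simp add: bad2_def)
  obtain F where F: "\<And>k. bad2 (F k)" "\<And>k. good_step (F k) (F (Suc k))"
    using dependent_nat_choice[of "\<lambda>_. bad2" "\<lambda>_. good_step"] start step by metis
  define l h where "l k = fst (F k)" and "h k = snd (F k)" for k
  have Fk: "?bad (l k) (h k)" "\<And>i. l k i \<le> l (Suc k) i" "\<And>i. h (Suc k) i \<le> h k i"
      "\<And>i. i < n \<Longrightarrow> h (Suc k) i - l (Suc k) i = (h k i - l k i) / 2" for k
    using F(1)[of k] F(2)[of k] by (auto simp: bad2_def good_step_def l_def h_def case_prod_unfold)
  have width: "h k i - l k i = (h 0 i - l 0 i) / 2 ^ k" if "i < n" for k i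
    using that by (induction k) (simp_all add: Fk(4))
  have decC: "?C (l k) (h k) \<subseteq> ?C (l j) (h j)" if "j \<le> k" for j k
  proof (rule lift_Suc_antimono_le[of "\<lambda>k. ?C (l k) (h k)", OF _ that])
    show "?C (l (Suc k)) (h (Suc k)) \<subseteq> ?C (l k) (h k)" for k
      unfolding cut_box_def using Fk(2,3)[of k] by (auto intro: order_trans)
  qed
  have nested: "(\<Inter>k. D k) \<noteq> {}" if D: "\<And>k. compact (D k)" "\<And>k. D k \<noteq> {}" "\<And>j k. j \<le> k \<Longrightarrow> D k \<subseteq> D j"
    for D :: "nat \<Rightarrow> (nat \<Rightarrow> real) set"
  proof -
    have "D 0 \<inter> (\<Inter>k\<in>UNIV. D k) \<noteq> {}"
    proof (rule compact_imp_fip_image[OF D(1)])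
      show "closed (D i)" for i using D(1) compact_imp_closed by blast
      show "D 0 \<inter> (\<Inter>i\<in>I'. D i) \<noteq> {}" if "finite I'" for I'
      proof -
        define k where "k = Max (insert 0 I')"
        have "i \<le> k" if "i \<in> insert 0 I'" for i
          unfolding k_def using \<open>finite I'\<close> that by (intro Max_ge) auto
        then have "D k \<subseteq> D 0 \<inter> (\<Inter>i\<in>I'. D i)"
          using D(3)[of _ k] by blast
        then show ?thesis using D(2)[of k] by blast
      qed
    qed
    then show ?thesis by blast
  qed
  have nonempty: "?C (l k) (h k) \<noteq> {}" for k
  proof
    assume "?C (l k) (h k) = {}"
    then have "orients (\<lambda>_. undefined) (E ` ?C (l k) (h k))"
      unfolding orients_def by simp
    with Fk(1)[of k] show False by blast
  qed
  obtain z where z: "\<And>k. z \<in> ?C (l k) (h k)"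
  proof -
    have "(\<Inter>k. ?C (l k) (h k)) \<noteq> {}"
      by (rule nested[OF compC nonempty decC])
    then show thesis using that by blast
  qed
  have zZ: "z \<in> Z" using z CZ by blast
  obtain c where c: "c \<in> \<B>" "E z \<in> dom c"
    using small[of "E z" M] E(3) zZ by auto
  obtain W where W: "open W" "dom c = M \<inter> W"
    using open_dom[OF c(1)] by (auto simp: openin_open)
  have "closedin (top_of_set Z) (Z \<inter> E -` (- W))"
    by (rule continuous_closedin_preimage[OF E(1)]) (use W in \<open>simp add: closed_def\<close>)
  then have clW: "closed (Z \<inter> E -` (- W))"
    using closedin_closed_trans compact_imp_closed[OF Z(1)] by blast
  \<comment> \<open>The part of the \<open>k\<close>-th box that leaves the flow box
    \<open>c\<close> around the common point \<open>z\<close>. No \<open>D k\<close> is empty, as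
    otherwise \<open>c\<close> would orient that box; a point common to all of them must be
    \<open>z\<close>, because the widths tend to 0.\<close>
  define D where "D k = ?C (l k) (h k) \<inter> (Z \<inter> E -` (- W))" for k
  have Dne: "D k \<noteq> {}" for k
  proof
    assume "D k = {}"
    then have "E ` ?C (l k) (h k) \<subseteq> dom c"
      unfolding D_def W(2) using CZ E(3) by blast
    from orients_in_box[OF c(1) this] Fk(1)[of k] show False by blast
  qed
  have Dcomp: "compact (D k)" for k
    unfolding D_def by (rule compact_Int_closed[OF compC clW])
  have Ddec: "D k \<subseteq> D j" if "j \<le> k" for j k
    unfolding D_def using decC[OF that] by blast
  obtain w where w: "\<And>k. w \<in> D k"
  proof -
    have "(\<Inter>k. D k) \<noteq> {}"
      by (rule nested[OF Dcomp Dne Ddec])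
    then show thesis using that by blast
  qed
  have "w = z"
  proof
    fix i
    show "w i = z i"
    proof (cases "i < n")
      case False
      have "w \<in> Z" using w[of 0] unfolding D_def by blast
      with False show ?thesis using Z(3)[of w i] Z(3)[of z i] zZ by simp
    next
      case True
      have "\<bar>w i - z i\<bar> \<le> (h 0 i - l 0 i) * (1/2) ^ k" for k
      proof -
        have "l k i \<le> w i" "w i \<le> h k i" "l k i \<le> z i" "z i \<le> h k i"
          using w[of k] z[of k] True unfolding D_def cut_box_def by blast+
        then have "\<bar>w i - z i\<bar> \<le> h k i - l k i" by linarith
        then show ?thesis using width[OF True, of k] by (simp add: power_one_over)
      qed
      moreover have "(\<lambda>k. (h 0 i - l 0 i) * (1/2) ^ k) \<longlonglongrightarrow> (h 0 i - l 0 i) * 0"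
        by (intro tendsto_mult tendsto_const LIMSEQ_realpow_zero) auto
      ultimately have "\<bar>w i - z i\<bar> \<le> 0"
        by (intro LIMSEQ_le_const) auto
      then show ?thesis by simp
    qed
  qed
  moreover have "E w \<notin> W" using w[of 0] unfolding D_def by blast
  ultimately show False using c(2) W(2) by blast
qed

end

section \<open>Pushing along oriented leaves\<close>

locale oriented_family = flowbox_family +
  assumes coherent: "\<lbrakk>c \<in> \<B>; d \<in> \<B>; p \<in> dom c; p \<in> dom d\<rbrakk> \<Longrightarrow> coh c d p"

text \<open>A box is connected, so agreement with \<open>\<tau>\<close> at its centre spreads over
  its domain. Hence each small box or its reverse is positive, and \<open>small\<close> survives the
  selection.\<close>

lemma (in flip_family) positive_boxes_oriented:
  assumes \<tau>: "orients \<tau> M"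
  shows "oriented_family m M {c \<in> \<B>. \<forall>p\<in>dom c. coh c (\<tau> p) p}"
proof
  let ?P = "{c \<in> \<B>. \<forall>p\<in>dom c. coh c (\<tau> p) p}"
  have T: "\<tau> p \<in> \<B>" "p \<in> dom (\<tau> p)" if "p \<in> M" for p
    using \<tau> that unfolding orients_def by blast+
  show "is_flowbox m M c" if "c \<in> ?P" for c using that box by blast
  show "(tr c p = tr c q) = (tr d p = tr d q)"
    if "c \<in> ?P" "d \<in> ?P" "p \<in> dom c \<inter> dom d" "q \<in> dom c \<inter> dom d" for c d p q
    using that agree by blast
  show "coh c d p" if "c \<in> ?P" "d \<in> ?P" "p \<in> dom c" "p \<in> dom d" for c d p
  proof -
    have B: "c \<in> \<B>" "d \<in> \<B>" "coh c (\<tau> p) p" "coh d (\<tau> p) p" using that by blast+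
    have "p \<in> M" using dom_subset[OF B(1)] that by blast
    show ?thesis
      by (rule coh_trans[OF B(1) T(1)[OF \<open>p \<in> M\<close>] B(3) coh_sym[OF B(2) T(1)[OF \<open>p \<in> M\<close>] B(4)]])
  qed
  show "\<exists>c\<in>?P. p \<in> dom c \<and> dom c \<subseteq> O' \<and> crd c p = (0, \<lambda>_. 0)"
    if prem: "p \<in> M" "openin (top_of_set M) O'" "p \<in> O'" for p O'
  proof -
    obtain c where c: "c \<in> \<B>" "p \<in> dom c" "dom c \<subseteq> O'" "crd c p = (0, \<lambda>_. 0)"
      using small[OF prem] by blast
    define d where "d = (if coh c (\<tau> p) p then c else flip c)"
    have d: "d \<in> \<B>" "dom d = dom c" "crd d p = (0, \<lambda>_. 0)"
      using c flip_closed by (auto simp: d_def flip_def)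
    have dp: "coh d (\<tau> p) p"
      using coh_flip_left[OF c(1) T(1)[OF prem(1)] c(2) T(2)[OF prem(1)]] by (simp add: d_def)
    have "coh d (\<tau> q) q" if "q \<in> dom d" for q
    proof (rule orients_unique[of "\<lambda>_. d" "dom d" \<tau> p q])
      show "orients (\<lambda>_. d) (dom d)" by (rule orients_in_box[OF d(1) subset_refl])
      show "orients \<tau> (dom d)" by (rule orients_subset[OF \<tau> dom_subset[OF d(1)]])
    qed (use that c d connected_dom[OF d(1)] dp in simp_all)
    then show ?thesis using d c by blast
  qed
qed

context oriented_family
begin

definition arc :: "'a flowbox \<Rightarrow> 'a \<Rightarrow> 'a \<Rightarrow> 'a set" where
  "arc c p q = pt c ` ({ht c p..ht c q} \<times> {tr c p})"

definition before :: "'a flowbox \<Rightarrow> 'a \<Rightarrow> 'a \<Rightarrow> bool" where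
  "before c p q \<longleftrightarrow> p \<in> dom c \<and> q \<in> dom c \<and> tr c p = tr c q \<and> ht c p \<le> ht c q"

lemma before_fcube:
  assumes "c \<in> \<B>" "before c p q" "s \<in> {ht c p..ht c q}"
  shows "(s, tr c p) \<in> fcube m"
  using crd_in[OF assms(1), of p] crd_in[OF assms(1), of q] assms(2,3)
  by (auto simp: before_def fcube_def mem_Times_iff)

lemma before_pt:
  assumes "c \<in> \<B>" "before c p q"
  shows "pt c (ht c p, tr c p) = p" "pt c (ht c q, tr c p) = q"
  using assms pt_crd unfolding before_def by (metis prod.collapse)+

lemma arc_iff:
  assumes "c \<in> \<B>" "before c p q"
  shows "r \<in> arc c p q \<longleftrightarrow> before c p r \<and> before c r q"
proof
  assume "r \<in> arc c p q"
  then obtain s where s: "s \<in> {ht c p..ht c q}" "r = pt c (s, tr c p)" by (auto simp: arc_def)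
  have f: "(s, tr c p) \<in> fcube m" by (rule before_fcube[OF assms s(1)])
  have "r \<in> dom c" "crd c r = (s, tr c p)"
    using pt_in[OF assms(1) f] crd_pt[OF assms(1) f] s by simp_all
  then show "before c p r \<and> before c r q"
    using assms s by (simp add: before_def)
next
  assume r: "before c p r \<and> before c r q"
  have "crd c r = (ht c r, tr c p)"
    using r by (simp add: before_def prod_eq_iff)
  then have "r = pt c (ht c r, tr c p)"
    using pt_crd[OF assms(1), of r] r by (simp add: before_def)
  moreover have "ht c r \<in> {ht c p..ht c q}"
    using r by (simp add: before_def)
  ultimately show "r \<in> arc c p q"
    unfolding arc_def by blast
qed

lemma arc_transfer:
  assumes c: "c \<in> \<B>" and d: "d \<in> \<B>" and b: "before c p q" and sub: "arc c p q \<subseteq> dom d"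
  shows "before d p q" "arc d p q = arc c p q"
proof -
  define y where "y = tr c p"
  define I where "I = {ht c p..ht c q}"
  define \<gamma> where "\<gamma> s = pt c (s, y)" for s
  define f where "f s = ht d (\<gamma> s)" for s
  have cube: "(s, y) \<in> fcube m" if "s \<in> I" for s
    using before_fcube[OF c b] that by (simp add: I_def y_def)
  have gdom: "\<gamma> s \<in> dom c" "\<gamma> s \<in> dom d" "crd c (\<gamma> s) = (s, y)" if "s \<in> I" for s
  proof -
    show "\<gamma> s \<in> dom c" "crd c (\<gamma> s) = (s, y)"
      unfolding \<gamma>_def using pt_in[OF c cube[OF that]] crd_pt[OF c cube[OF that]] by blast+
    show "\<gamma> s \<in> dom d" using sub that unfolding arc_def \<gamma>_def I_def y_def by blast
  qed
  have le: "ht c p \<le> ht c q" using b by (simp add: before_def)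
  have ends: "ht c p \<in> I" "ht c q \<in> I" using le by (auto simp: I_def)
  have gp: "\<gamma> (ht c p) = p" "\<gamma> (ht c q) = q"
    using before_pt[OF c b] by (simp_all add: \<gamma>_def y_def)
  have tr: "tr d (\<gamma> s) = tr d p" if "s \<in> I" for s
    using agree[OF c d, of "\<gamma> s" p] gdom[OF that] gdom[OF ends(1)] gp by (simp add: y_def)
  have "continuous_on I (\<lambda>s. (s, y))" by (intro continuous_intros)
  from continuous_on_compose2[OF cont_pt[OF c] this]
  have cg: "continuous_on I \<gamma>" unfolding \<gamma>_def using cube by blast
  from continuous_on_compose2[OF cont_crd[OF d] this]
  have "continuous_on I (\<lambda>s. crd d (\<gamma> s))" using gdom(2) by blast
  then have cf: "continuous_on I f" unfolding f_def by (rule continuous_on_fst)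
  define T where "T = {(s, t). s \<in> I \<and> t \<in> I \<and> s < t}"
  have "convex T"
  proof -
    have "T = (I \<times> I) \<inter> {z. inner (1, -1) z < 0}" by (auto simp: T_def)
    then show ?thesis
      unfolding I_def by (simp only:) (intro convex_Int convex_Times convex_real_interval convex_halfspace_lt)
  qed
  then have "connected T" by (rule convex_connected)
  have "continuous_on T (\<lambda>z. f (snd z) - f (fst z))"
    by (rule continuous_on_diff; rule continuous_on_compose2[OF cf])
      (auto simp: T_def intro!: continuous_intros)
  moreover have "f (snd z) - f (fst z) \<noteq> 0" if "z \<in> T" for z
  proof
    assume "f (snd z) - f (fst z) = 0"
    moreover have I: "fst z \<in> I" "snd z \<in> I" "fst z < snd z" using that by (auto simp: T_def)
    ultimately have "\<gamma> (snd z) = \<gamma> (fst z)"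
      using crd_eqD[OF d gdom(2) gdom(2), of "snd z" "fst z"] tr by (simp add: f_def)
    then have "crd c (\<gamma> (snd z)) = crd c (\<gamma> (fst z))" by simp
    with I show False using gdom(3) by simp
  qed
  ultimately have sgn: "(\<forall>z\<in>T. 0 < f (snd z) - f (fst z)) \<or> (\<forall>z\<in>T. f (snd z) - f (fst z) < 0)"
    using connected_nonzero_sign[OF \<open>connected T\<close>, of "\<lambda>z. f (snd z) - f (fst z)"] by simp
  have mono: "f s < f t" if st: "s \<in> I" "t \<in> I" "s < t" for s t
  proof -
    have ltpq: "ht c p < ht c q" using st by (auto simp: I_def)
    have "coh c d p" using coherent[OF c d] gdom[OF ends(1)] gp by simp
    then obtain N where N: "openin (top_of_set M) N" "p \<in> N"
      "\<And>q r. q \<in> N \<Longrightarrow> r \<in> N \<Longrightarrow> tr c q = tr c r \<Longrightarrow> ht c q < ht c r \<longleftrightarrow> ht d q < ht d r"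
      by (rule coh_nbhd) (rule that)
    obtain W where W: "open W" "N = M \<inter> W" using N(1) by (auto simp: openin_open)
    have "openin (top_of_set I) (I \<inter> \<gamma> -` W)"
      by (rule continuous_openin_preimage_gen[OF cg W(1)])
    then obtain V where V: "open V" "I \<inter> \<gamma> -` W = I \<inter> V" by (auto simp: openin_open)
    have "ht c p \<in> V" using V(2) ends(1) gp N(2) W(2) by auto
    then obtain e where e: "e > 0" "ball (ht c p) e \<subseteq> V" using V(1) openE by blast
    \<comment> \<open>A point slightly further along the arc, inside the neighbourhood of
      \<open>p\<close> on which coherence is known; its sign is the sign on all of
      \<open>T\<close>.\<close>
    define t' where "t' = min (ht c p + e / 2) (ht c q)"
    have t': "t' \<in> I" "ht c p < t'" "t' \<in> V"
      using e ltpq by (auto simp: t'_def I_def dist_real_def min_def intro!: subsetD[OF e(2)])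
    have "\<gamma> t' \<in> N" using t' V(2) W(2) gdom(1)[OF t'(1)] dom_subset[OF c] by blast
    moreover have "tr c p = tr c (\<gamma> t')" using gdom(3)[OF t'(1)] by (simp add: y_def)
    ultimately have "ht d p < ht d (\<gamma> t')"
      using N(3)[OF N(2), of "\<gamma> t'"] gdom(3)[OF t'(1)] t'(2) by simp
    then have pos: "0 < f (snd (ht c p, t')) - f (fst (ht c p, t'))" by (simp add: f_def gp)
    have "(ht c p, t') \<in> T" using t' ends by (simp add: T_def)
    then have "\<forall>z\<in>T. 0 < f (snd z) - f (fst z)" using sgn pos by fastforce
    moreover have "(s, t) \<in> T" using st by (simp add: T_def)
    ultimately show ?thesis by fastforce
  qed
  have pq: "p \<in> dom d" "q \<in> dom d" "tr d p = tr d q"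
    using gdom(2)[OF ends(1)] gdom(2)[OF ends(2)] tr[OF ends(2)] gp by auto
  have fpq: "f (ht c p) = ht d p" "f (ht c q) = ht d q" by (simp_all add: f_def gp)
  have "ht d p \<le> ht d q"
    using mono[OF ends] le fpq by (cases "ht c p = ht c q") auto
  then show bd: "before d p q"
    using pq by (simp add: before_def)
  have fim: "f ` I = {ht d p..ht d q}"
  proof (intro equalityI subsetI)
    fix v assume "v \<in> f ` I"
    then obtain s where s: "s \<in> I" "v = f s" by blast
    have "f (ht c p) \<le> f s" using mono[OF ends(1) s(1)] s(1) by (cases "s = ht c p") (auto simp: I_def)
    moreover have "f s \<le> f (ht c q)" using mono[OF s(1) ends(2)] s(1) by (cases "s = ht c q") (auto simp: I_def)
    ultimately show "v \<in> {ht d p..ht d q}" using s fpq by simp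
  next
    fix v assume v: "v \<in> {ht d p..ht d q}"
    have "connected (f ` I)"
      using cf by (rule connected_continuous_image) (simp add: I_def)
    then show "v \<in> f ` I"
      by (rule connectedD_interval[of _ "f (ht c p)" "f (ht c q)"]) (use v fpq imageI[OF ends(1), of f] imageI[OF ends(2), of f] in simp_all)
  qed
  have gd: "\<gamma> s = pt d (f s, tr d p)" if "s \<in> I" for s
    using pt_crd[OF d gdom(2)[OF that]] tr[OF that] by (metis f_def prod.collapse)
  have "arc d p q = (\<lambda>v. pt d (v, tr d p)) ` (f ` I)"
    unfolding arc_def fim by blast
  also have "\<dots> = \<gamma> ` I"
    unfolding image_image using gd by (intro image_cong) auto
  also have "\<dots> = arc c p q"
    unfolding arc_def \<gamma>_def I_def y_def by blast
  finally show "arc d p q = arc c p q" .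
qed

text \<open>The bump vanishes near the boundary of the box, so the shift along the leaves of the box is
  the identity there and extends continuously by the identity.\<close>

definition bump :: "'a flowbox \<Rightarrow> 'a \<Rightarrow> real" where
  "bump d q = max 0 (1/2 - \<bar>ht d q\<bar> - (\<Sum>i<m. \<bar>tr d q i\<bar>))"

definition shift :: "'a flowbox \<Rightarrow> real \<Rightarrow> 'a \<Rightarrow> 'a" where
  "shift d e q = (if q \<in> dom d then pt d (ht d q + e * bump d q, tr d q) else q)"

lemma bump_nonneg: "0 \<le> bump d q"
  by (simp add: bump_def)

text \<open>Where the bump is positive, height in absolute value plus bump is at most 1/2, so even
  the full shift keeps the point away from the end faces.\<close>

lemma shift_fcube:
  assumes d: "d \<in> \<B>" and q: "q \<in> dom d" and e: "e \<in> {0..1}"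
  shows "(ht d q + e * bump d q, tr d q) \<in> fcube m"
proof -
  have qc: "\<bar>ht d q\<bar> < 1" "tr d q \<in> cell m"
    using crd_in[OF d q] by (auto simp: fcube_def mem_Times_iff)
  have sum: "0 \<le> (\<Sum>i<m. \<bar>tr d q i\<bar>)" by (intro sum_nonneg) auto
  have "0 \<le> e * bump d q" "e * bump d q \<le> bump d q"
    using e bump_nonneg[of d q] by (auto intro: mult_left_le_one_le)
  then have "\<bar>ht d q + e * bump d q\<bar> < 1"
    using qc(1) sum unfolding bump_def by (auto simp: max_def abs_if split: if_splits)
  with qc show ?thesis by (auto simp: fcube_def abs_if split: if_splits)
qed

lemma shift_crd:
  assumes "d \<in> \<B>" "q \<in> dom d" "e \<in> {0..1}"
  shows "shift d e q \<in> dom d" "crd d (shift d e q) = (ht d q + e * bump d q, tr d q)"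
  using pt_in[OF assms(1) shift_fcube[OF assms]] crd_pt[OF assms(1) shift_fcube[OF assms]] assms(2)
  by (simp_all add: shift_def)

lemma shift_in: "d \<in> \<B> \<Longrightarrow> q \<in> M \<Longrightarrow> e \<in> {0..1} \<Longrightarrow> shift d e q \<in> M"
  using shift_crd(1)[of d q e] dom_subset[of d] by (cases "q \<in> dom d") (blast, simp add: shift_def)

lemma shift_zero: "d \<in> \<B> \<Longrightarrow> shift d 0 q = q"
  using pt_crd by (simp add: shift_def)

lemma continuous_bump:
  assumes d: "d \<in> \<B>"
  shows "continuous_on (dom d) (bump d)"
proof -
  have c: "continuous_on (dom d) (ht d)" "continuous_on (dom d) (tr d)"
    by (intro continuous_on_fst continuous_on_snd cont_crd[OF d])+
  have "continuous_on (dom d) (\<lambda>q. tr d q i)" for i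
    by (rule continuous_on_product_then_coordinatewise[OF c(2)])
  then show ?thesis
    unfolding bump_def[abs_def] by (intro continuous_intros c)
qed

text \<open>The bump vanishes outside the image of \<open>C0\<close>. This image is compact, hence
  closed in all of \<open>M\<close>, so its complement and the box form an open cover; on the one
  the shift is the identity, on the other it is given by coordinates.\<close>

lemma continuous_shift:
  assumes d: "d \<in> \<B>"
  shows "continuous_on (M \<times> {0..1}) (\<lambda>z. shift d (snd z) (fst z))"
proof -
  define C0 :: "(real \<times> (nat \<Rightarrow> real)) set" where "C0 = {z. \<bar>fst z\<bar> + (\<Sum>i<m. \<bar>snd z i\<bar>) \<le> 1/2} \<inter> (UNIV \<times> {y. \<forall>i. m \<le> i \<longrightarrow> y i = 0})"
  have coord: "continuous_on UNIV (\<lambda>z::real \<times> (nat \<Rightarrow> real). snd z i)" for i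
    by (rule continuous_on_product_then_coordinatewise) (intro continuous_intros)
  have "closed {z::real \<times> (nat \<Rightarrow> real). \<bar>fst z\<bar> + (\<Sum>i<m. \<bar>snd z i\<bar>) \<le> 1/2}"
    by (intro closed_Collect_le continuous_intros coord)
  moreover have "closed {y::nat \<Rightarrow> real. \<forall>i. m \<le> i \<longrightarrow> y i = 0}"
    by (intro closed_Collect_all closed_Collect_imp closed_Collect_eq continuous_on_product_coordinates) auto
  ultimately have clC0: "closed C0"
    unfolding C0_def by (intro closed_Int closed_Times) auto
  have le: "\<bar>snd z i\<bar> \<le> 1/2" if "z \<in> C0" for z i
  proof (cases "i < m")
    case True
    then have "\<bar>snd z i\<bar> \<le> (\<Sum>i<m. \<bar>snd z i\<bar>)"
      by (intro member_le_sum) auto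
    with that show ?thesis by (auto simp: C0_def)
  qed (use that in \<open>auto simp: C0_def mem_Times_iff\<close>)
  have le1: "\<bar>fst z\<bar> \<le> 1/2" if "z \<in> C0" for z
  proof -
    have "0 \<le> (\<Sum>i<m. \<bar>snd z i\<bar>)" by (intro sum_nonneg) auto
    moreover have "\<bar>fst z\<bar> + (\<Sum>i<m. \<bar>snd z i\<bar>) \<le> 1/2" using that by (simp add: C0_def)
    ultimately show ?thesis by linarith
  qed
  have C0f: "C0 \<subseteq> fcube m"
  proof
    fix z assume z: "z \<in> C0"
    have "\<bar>snd z i\<bar> < 1" for i using le[OF z, of i] by linarith
    moreover have "\<forall>i\<ge>m. snd z i = 0" using z by (auto simp: C0_def mem_Times_iff)
    ultimately show "z \<in> fcube m"
      using le1[OF z] by (auto simp: fcube_def cell_def mem_Times_iff abs_le_iff)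
  qed
  have "C0 \<subseteq> {-1..1} \<times> {y. \<forall>i. y i \<in> {-1..1}}"
  proof
    fix z assume z: "z \<in> C0"
    have "snd z i \<in> {-1..1}" for i using le[OF z, of i] by auto
    then show "z \<in> {-1..1} \<times> {y. \<forall>i. y i \<in> {-1..1}}"
      using le1[OF z] by (auto simp: mem_Times_iff)
  qed
  then have "C0 = ({-1..1} \<times> {y. \<forall>i. y i \<in> {-1..1}}) \<inter> C0" by blast
  moreover have "compact (({-1..1::real} \<times> {y::nat\<Rightarrow>real. \<forall>i. y i \<in> {-1..1}}) \<inter> C0)"
    by (intro compact_Int_closed compact_Times compact_fun_box clC0) simp
  ultimately have "compact C0" by simp
  then have compC: "compact (pt d ` C0)"
    by (intro compact_continuous_image continuous_on_subset[OF cont_pt[OF d] C0f])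
  define C where "C = pt d ` C0"
  have Cd: "C \<subseteq> dom d" unfolding C_def using C0f pt_in[OF d] by blast
  have "closed C" unfolding C_def using compC compact_imp_closed by blast
  then have op: "openin (top_of_set M) (M - C)" by (auto simp: openin_open)
  have un: "dom d \<times> {0..1} \<union> (M - C) \<times> {0..1} = M \<times> {0..1::real}"
    using Cd dom_subset[OF d] by blast
  have "continuous_on (dom d \<times> {0..1} \<union> (M - C) \<times> {0..1}) (\<lambda>z. shift d (snd z) (fst z))"
  proof (rule continuous_on_Un_local_open)
    show "openin (top_of_set (dom d \<times> {0..1} \<union> (M - C) \<times> {0..1})) (dom d \<times> {0..1::real})"
      unfolding un by (intro openin_Times open_dom[OF d]) auto
    show "openin (top_of_set (dom d \<times> {0..1} \<union> (M - C) \<times> {0..1})) ((M - C) \<times> {0..1::real})"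
      unfolding un by (intro openin_Times op) auto
    have cf: "continuous_on (dom d \<times> {0..1::real}) (\<lambda>z. f (fst z))" if "continuous_on (dom d) f"
      for f :: "'a \<Rightarrow> 'c::topological_space"
      by (rule continuous_on_compose2[OF that]) (auto intro!: continuous_intros)
    have cc: "continuous_on (dom d \<times> {0..1::real}) (\<lambda>z. (ht d (fst z) + snd z * bump d (fst z), tr d (fst z)))"
      by (intro continuous_intros cf[OF continuous_bump[OF d]]
        cf[OF continuous_on_fst[OF cont_crd[OF d]]] cf[OF continuous_on_snd[OF cont_crd[OF d]]])
    have "continuous_on (dom d \<times> {0..1::real}) (\<lambda>z. pt d (ht d (fst z) + snd z * bump d (fst z), tr d (fst z)))"
    proof (rule continuous_on_compose2[OF cont_pt[OF d] cc], safe)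
      fix q e assume "q \<in> dom d" "e \<in> {0..1::real}"
      then show "(ht d (fst (q, e)) + snd (q, e) * bump d (fst (q, e)), tr d (fst (q, e))) \<in> fcube m"
        using shift_fcube[OF d] by simp
    qed
    then show "continuous_on (dom d \<times> {0..1::real}) (\<lambda>z. shift d (snd z) (fst z))"
      by (rule continuous_on_eq) (auto simp: shift_def)
    have "continuous_on ((M - C) \<times> {0..1::real}) fst" by (intro continuous_intros)
    then show "continuous_on ((M - C) \<times> {0..1::real}) (\<lambda>z. shift d (snd z) (fst z))"
    proof (rule continuous_on_eq)
      fix z assume z: "z \<in> (M - C) \<times> {0..1::real}"
      show "fst z = shift d (snd z) (fst z)"
      proof (cases "fst z \<in> dom d")
        case True
        have "crd d (fst z) \<notin> C0"
          using z pt_crd[OF d True] unfolding C_def by (metis DiffE imageI mem_Times_iff)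
        moreover have "\<forall>i\<ge>m. tr d (fst z) i = 0"
          using crd_in[OF d True] by (auto simp: fcube_def cell_def mem_Times_iff)
        ultimately have "bump d (fst z) = 0"
          by (auto simp: C0_def bump_def mem_Times_iff)
        then show ?thesis using pt_crd[OF d True] True by (simp add: shift_def)
      qed (simp add: shift_def)
    qed
  qed
  then show ?thesis unfolding un .
qed

end

section \<open>Composition of small shifts over a compact set\<close>

lemma compact_finite_subcover_in:
  assumes "compact K" "K \<subseteq> M" and N: "\<And>p. p \<in> K \<Longrightarrow> openin (top_of_set M) (N p) \<and> p \<in> N p"
  obtains P where "finite P" "P \<subseteq> K" "K \<subseteq> (\<Union>p\<in>P. N p)"
proof -
  have "\<exists>W. open W \<and> N p = M \<inter> W" if "p \<in> K" for p
    using N[OF that] unfolding openin_open by blast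
  then obtain W where W: "\<And>p. p \<in> K \<Longrightarrow> open (W p) \<and> N p = M \<inter> W p"
    by metis
  have "\<And>p. p \<in> K \<Longrightarrow> open (W p)" using W by blast
  moreover have "K \<subseteq> (\<Union>p\<in>K. W p)" using W N by blast
  ultimately obtain P where P: "P \<subseteq> K" "finite P" "K \<subseteq> (\<Union>p\<in>P. W p)"
    by (rule compactE_image[OF assms(1)])
  have "K \<subseteq> (\<Union>p\<in>P. N p)"
  proof
    fix x assume x: "x \<in> K"
    then obtain p where p: "p \<in> P" "x \<in> W p" using P(3) by blast
    have "N p = M \<inter> W p" using W p(1) P(1) by blast
    then show "x \<in> (\<Union>p\<in>P. N p)" using p x assms(2) by blast
  qed
  then show ?thesis using that P by blast
qed

lemma parametrised_nbhd:
  fixes F :: "'a::topological_space \<times> real \<Rightarrow> 'b::topological_space"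
  assumes F: "continuous_on (M \<times> {0..1}) F" "F ` (M \<times> {0..1}) \<subseteq> M'"
    and W: "openin (top_of_set M') W" and p: "p \<in> M" "F (p, 0) \<in> W"
  obtains N e where "openin (top_of_set M) N" "p \<in> N" "0 < e" "e \<le> 1"
    "\<And>q t. q \<in> N \<Longrightarrow> t \<in> {0..e} \<Longrightarrow> F (q, t) \<in> W"
proof -
  obtain W' where W': "open W'" "W = M' \<inter> W'" using W by (auto simp: openin_open)
  have "openin (top_of_set (M \<times> {0..1})) ((M \<times> {0..1}) \<inter> F -` W')"
    by (rule continuous_openin_preimage_gen[OF F(1) W'(1)])
  then obtain V where V: "open V" "(M \<times> {0..1}) \<inter> F -` W' = (M \<times> {0..1}) \<inter> V"
    by (auto simp: openin_open)
  have "(p, 0) \<in> (M \<times> {0..1}) \<inter> F -` W'" using p W' by simp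
  then have "(p, 0) \<in> V" unfolding V(2) by blast
  then obtain A B where AB: "open A" "open B" "(p, 0) \<in> A \<times> B" "A \<times> B \<subseteq> V"
    by (rule open_prod_elim[OF V(1)])
  then obtain e where e: "e > 0" "ball 0 e \<subseteq> B" using openE[of B 0] by blast
  define e' where "e' = min 1 (e / 2)"
  have "F (q, t) \<in> W" if q: "q \<in> M \<inter> A" and t: "t \<in> {0..e'}" for q t
  proof -
    have "t \<in> ball 0 e" using t e(1) by (auto simp: e'_def dist_real_def)
    then have "(q, t) \<in> V" using AB(4) e(2) q by blast
    moreover have m: "(q, t) \<in> M \<times> {0..1}" using q t by (auto simp: e'_def)
    ultimately have "(q, t) \<in> (M \<times> {0..1}) \<inter> F -` W'" unfolding V(2) by blast
    moreover have "F (q, t) \<in> M'" using F(2) m by blast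
    ultimately show ?thesis unfolding W'(2) by blast
  qed
  moreover have "openin (top_of_set M) (M \<inter> A)" "p \<in> M \<inter> A" "0 < e'" "e' \<le> 1"
    using AB p e by (auto simp: openin_open e'_def)
  ultimately show ?thesis by (rule_tac that)
qed

context oriented_family
begin

lemma before_refl: "p \<in> dom c \<Longrightarrow> before c p p"
  by (simp add: before_def)

lemma before_trans: "before c p q \<Longrightarrow> before c q r \<Longrightarrow> before c p r"
  by (simp add: before_def)

lemma before_strict: "c \<in> \<B> \<Longrightarrow> before c p q \<Longrightarrow> p \<noteq> q \<Longrightarrow> ht c p < ht c q"
  using crd_eqD[of c p q] unfolding before_def by (cases "ht c p = ht c q") auto

text \<open>A homotopy from the identity that moves points forward in every box, as long as the time
  is small for the point and the box in question. A uniform time appears only over a compact set, in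
  \<open>push_exists\<close>. The second clause keeps account of the points that really
  move.\<close>

definition pushes :: "('a \<times> real \<Rightarrow> 'a) \<Rightarrow> 'a flowbox set \<Rightarrow> bool" where
  "pushes F cs \<longleftrightarrow> continuous_on (M \<times> {0..1}) F \<and> F ` (M \<times> {0..1}) \<subseteq> M \<and> (\<forall>p\<in>M. F (p, 0) = p) \<and>
     (\<forall>c\<in>\<B>. \<forall>p\<in>dom c. \<exists>N e. openin (top_of_set M) N \<and> p \<in> N \<and> 0 < e \<and> e \<le> 1 \<and>
       (\<forall>q\<in>N. \<forall>t\<in>{0..e}. before c q (F (q, t)) \<and>
         (0 < t \<and> (\<exists>d\<in>cs. q \<in> dom d \<and> 0 < bump d q) \<longrightarrow> F (q, t) \<noteq> q)))"

text \<open>The arc from \<open>q\<close> to its image consists of the images of \<open>q\<close> at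
  earlier times, so it lies in \<open>c\<close> whenever these do, and \<open>arc_transfer\<close>
  carries the order over.\<close>

lemma shift_before:
  assumes d: "d \<in> \<B>" and c: "c \<in> \<B>" and e: "e \<le> 1"
    and q: "q \<in> dom c" "\<And>t. t \<in> {0..e} \<Longrightarrow> shift d t q \<in> dom c" and t: "t \<in> {0..e}"
  shows "before c q (shift d t q)"
proof (cases "q \<in> dom d")
  case False
  then show ?thesis using q(1) by (simp add: shift_def before_refl)
next
  case True
  have t1: "s \<in> {0..1}" if "s \<in> {0..e}" for s using that e by auto
  note cr = shift_crd[OF d True t1]
  have b: "before d q (shift d t q)"
    using True cr[OF t] t bump_nonneg[of d q] by (simp add: before_def)
  have "arc d q (shift d t q) \<subseteq> dom c"
  proof
    fix r assume "r \<in> arc d q (shift d t q)"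
    then obtain s where s: "ht d q \<le> s" "s \<le> ht d q + t * bump d q" "r = pt d (s, tr d q)"
      unfolding arc_def using cr(2)[OF t] by auto
    \<comment> \<open>The time at which the shift has reached height \<open>s\<close>; if the bump
      is 0, the arc is the single point \<open>q\<close> and time 0 serves.\<close>
    define t' where "t' = (if bump d q = 0 then 0 else (s - ht d q) / bump d q)"
    have bpos: "0 < bump d q" if "bump d q \<noteq> 0" using that bump_nonneg[of d q] by linarith
    have "s = ht d q + t' * bump d q" using s by (auto simp: t'_def)
    moreover have "t' \<in> {0..e}"
      using s t bpos by (auto simp: t'_def field_simps intro: order_trans)
    ultimately show "r \<in> dom c"
      using q(2)[of t'] s(3) True by (simp add: shift_def)
  qed
  then show ?thesis by (rule arc_transfer(1)[OF d c b])
qed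

lemma pushes_shift:
  assumes d: "d \<in> \<B>"
  shows "pushes (\<lambda>z. shift d (snd z) (fst z)) {d}"
  unfolding pushes_def
proof (intro conjI ballI)
  show c: "continuous_on (M \<times> {0..1}) (\<lambda>z. shift d (snd z) (fst z))"
    by (rule continuous_shift[OF d])
  show im: "(\<lambda>z. shift d (snd z) (fst z)) ` (M \<times> {0..1}) \<subseteq> M"
    using shift_in[OF d] by auto
  show "shift d (snd (p, 0)) (fst (p, 0)) = p" if "p \<in> M" for p
    using shift_zero[OF d] by simp
  fix c p assume c': "c \<in> \<B>" "p \<in> dom c"
  have pM: "p \<in> M" using dom_subset[OF c'(1)] c'(2) by blast
  have p0: "shift d (snd (p, 0)) (fst (p, 0)) \<in> dom c"
    using shift_zero[OF d] c' by simp
  obtain N e where N: "openin (top_of_set M) N" "p \<in> N" "0 < e" "e \<le> 1"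
    "\<And>q t. q \<in> N \<Longrightarrow> t \<in> {0..e} \<Longrightarrow> shift d (snd (q, t)) (fst (q, t)) \<in> dom c"
    by (rule parametrised_nbhd[OF c im open_dom[OF c'(1)] pM p0]) (rule that)
  have "before c q (shift d t q)" if "q \<in> N" "t \<in> {0..e}" for q t
  proof (rule shift_before[OF d c'(1) N(4) _ _ that(2)])
    show "q \<in> dom c" using N(5)[OF that(1), of 0] N(3) shift_zero[OF d] by simp
    show "shift d t q \<in> dom c" if "t \<in> {0..e}" for t using N(5)[OF \<open>q \<in> N\<close> that] by simp
  qed
  moreover have "shift d t q \<noteq> q" if "t \<in> {0..e}" "0 < t" "0 < bump d q" "q \<in> dom d" for q t
  proof
    assume eq: "shift d t q = q"
    have "t \<in> {0..1}" using that(1) N(4) by auto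
    from shift_crd(2)[OF d that(4) this] have "crd d q = (ht d q + t * bump d q, tr d q)"
      unfolding eq .
    then have "ht d q = ht d q + t * bump d q" by (metis fst_conv)
    with that(2,3) show False by simp
  qed
  ultimately show "\<exists>N e. openin (top_of_set M) N \<and> p \<in> N \<and> 0 < e \<and> e \<le> 1 \<and>
       (\<forall>q\<in>N. \<forall>t\<in>{0..e}. before c q (shift d (snd (q, t)) (fst (q, t))) \<and>
         (0 < t \<and> (\<exists>d\<in>{d}. q \<in> dom d \<and> 0 < bump d q) \<longrightarrow> shift d (snd (q, t)) (fst (q, t)) \<noteq> q))"
    using N(1-4) by (intro exI[of _ N] exI[of _ e]) auto
qed

text \<open>If the first push moves a point, its height rises strictly and the second push cannot
  lower it again; if it leaves the point in place, the second push acts on that same point.\<close>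

lemma pushes_compose:
  assumes F: "pushes F cs" and G: "pushes G ds"
  shows "pushes (\<lambda>z. G (F z, snd z)) (cs \<union> ds)"
  unfolding pushes_def
proof (intro conjI ballI)
  note F' = F[unfolded pushes_def] and G' = G[unfolded pushes_def]
  have Fc: "continuous_on (M \<times> {0..1}) F" "F ` (M \<times> {0..1}) \<subseteq> M" "\<And>p. p \<in> M \<Longrightarrow> F (p, 0) = p"
    using F' by blast+
  have Gc: "continuous_on (M \<times> {0..1}) G" "G ` (M \<times> {0..1}) \<subseteq> M" "\<And>p. p \<in> M \<Longrightarrow> G (p, 0) = p"
    using G' by blast+
  have FM: "F z \<in> M" if "z \<in> M \<times> {0..1}" for z using Fc(2) that by blast
  have FS: "(F z, snd z) \<in> M \<times> {0..1}" if "z \<in> M \<times> {0..1}" for z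
    using FM[OF that] that by auto
  show "continuous_on (M \<times> {0..1}) (\<lambda>z. G (F z, snd z))"
  proof (rule continuous_on_compose2[OF Gc(1)])
    show "continuous_on (M \<times> {0..1}) (\<lambda>z. (F z, snd z))"
      by (intro continuous_intros Fc(1))
    show "(\<lambda>z. (F z, snd z)) ` (M \<times> {0..1}) \<subseteq> M \<times> {0..1}" using FS by blast
  qed
  show "(\<lambda>z. G (F z, snd z)) ` (M \<times> {0..1}) \<subseteq> M"
    using FS Gc(2) by blast
  show "G (F (p, 0), snd (p, 0)) = p" if "p \<in> M" for p
    using Fc(3) Gc(3) that by simp
  fix c p assume c: "c \<in> \<B>" "p \<in> dom c"
  have pM: "p \<in> M" using dom_subset[OF c(1)] c(2) by blast
  obtain N1 e1 where N1: "openin (top_of_set M) N1" "p \<in> N1" "0 < e1" "e1 \<le> 1"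
    "\<forall>q\<in>N1. \<forall>t\<in>{0..e1}. before c q (F (q, t)) \<and>
         (0 < t \<and> (\<exists>d\<in>cs. q \<in> dom d \<and> 0 < bump d q) \<longrightarrow> F (q, t) \<noteq> q)"
    using F' c by meson
  obtain N2 e2 where N2: "openin (top_of_set M) N2" "p \<in> N2" "0 < e2" "e2 \<le> 1"
    "\<forall>q\<in>N2. \<forall>t\<in>{0..e2}. before c q (G (q, t)) \<and>
         (0 < t \<and> (\<exists>d\<in>ds. q \<in> dom d \<and> 0 < bump d q) \<longrightarrow> G (q, t) \<noteq> q)"
    using G' c by meson
  have "F (p, 0) \<in> N2" using Fc(3)[OF pM] N2(2) by simp
  then obtain N3 e3 where N3: "openin (top_of_set M) N3" "p \<in> N3" "0 < e3" "e3 \<le> 1"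
    "\<And>q t. q \<in> N3 \<Longrightarrow> t \<in> {0..e3} \<Longrightarrow> F (q, t) \<in> N2"
    using parametrised_nbhd[OF Fc(1,2) N2(1) pM] by blast
  define e where "e = min e1 (min e2 e3)"
  have main: "before c q (G (F (q, t), t)) \<and>
      (0 < t \<and> (\<exists>d\<in>cs \<union> ds. q \<in> dom d \<and> 0 < bump d q) \<longrightarrow> G (F (q, t), t) \<noteq> q)"
    if q: "q \<in> N1 \<inter> N3" and t: "t \<in> {0..e}" for q t
  proof -
    have t': "t \<in> {0..e1}" "t \<in> {0..e2}" "t \<in> {0..e3}" using t by (auto simp: e_def)
    have b1: "before c q (F (q, t))" using N1(5) q t'(1) by blast
    have FN: "F (q, t) \<in> N2" using N3(5) q t'(3) by blast
    have b2: "before c (F (q, t)) (G (F (q, t), t))" using N2(5) FN t'(2) by blast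
    have "G (F (q, t), t) \<noteq> q" if tp: "0 < t" and d: "d \<in> cs \<union> ds" "0 < bump d q" "q \<in> dom d" for d
    proof (cases "F (q, t) = q")
      case False
      then have "ht c q < ht c (F (q, t))" using before_strict[OF c(1) b1] by simp
      then show ?thesis using b2 unfolding before_def by auto
    next
      case True
      then have "d \<notin> cs" using N1(5) q t'(1) tp d(2,3) by blast
      then have "d \<in> ds" using d by blast
      moreover have "q \<in> N2" using FN True by simp
      ultimately have "G (q, t) \<noteq> q" using N2(5) t'(2) tp d(2,3) by blast
      then show ?thesis using True by simp
    qed
    then show ?thesis using before_trans[OF b1 b2] by blast
  qed
  show "\<exists>N e. openin (top_of_set M) N \<and> p \<in> N \<and> 0 < e \<and> e \<le> 1 \<and>
       (\<forall>q\<in>N. \<forall>t\<in>{0..e}. before c q (G (F (q, t), snd (q, t))) \<and>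
         (0 < t \<and> (\<exists>d\<in>cs \<union> ds. q \<in> dom d \<and> 0 < bump d q) \<longrightarrow> G (F (q, t), snd (q, t)) \<noteq> q))"
  proof (intro exI conjI)
    show "openin (top_of_set M) (N1 \<inter> N3)" using N1 N3 by blast
    show "p \<in> N1 \<inter> N3" "0 < e" "e \<le> 1" using N1 N2 N3 by (auto simp: e_def)
  qed (use main in simp)
qed

lemma pushes_finite:
  assumes "finite cs" "cs \<subseteq> \<B>"
  shows "\<exists>F. pushes F cs"
  using assms
proof (induction rule: finite_induct)
  case empty
  have "pushes fst {}"
    unfolding pushes_def
  proof (intro conjI ballI)
    show "continuous_on (M \<times> {0..1::real}) fst" by (intro continuous_intros)
    fix c p assume c: "c \<in> \<B>" "p \<in> dom c"
    show "\<exists>N e. openin (top_of_set M) N \<and> p \<in> N \<and> 0 < e \<and> e \<le> (1::real) \<and>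
       (\<forall>q\<in>N. \<forall>t\<in>{0..e}. before c q (fst (q, t)) \<and>
         (0 < t \<and> (\<exists>d\<in>{}. q \<in> dom d \<and> 0 < bump d q) \<longrightarrow> fst (q, t) \<noteq> q))"
      by (rule exI[of _ "dom c"], rule exI[of _ 1]) (use c open_dom before_refl in auto)
  qed auto
  then show ?case by blast
next
  case (insert d cs)
  then obtain F where F: "pushes F cs" by auto
  have "pushes (\<lambda>z. shift d (snd (F z, snd z)) (fst (F z, snd z))) (cs \<union> {d})"
    by (rule pushes_compose[OF F pushes_shift]) (use insert in simp)
  then show ?case by auto
qed

text \<open>Compactness is used twice: finitely many bumps are positive somewhere over every point
  of \<open>K\<close>, so that every point moves; and finitely many neighbourhoods with a common
  time show the motion as forward inside a box of \<open>\<Q>\<close>.\<close>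

lemma push_exists:
  assumes K: "compact K" "K \<subseteq> M" and \<Q>: "\<Q> \<subseteq> \<B>" "\<And>p. p \<in> K \<Longrightarrow> \<exists>c\<in>\<Q>. p \<in> dom c \<and> crd c p = (0, \<lambda>_. 0)"
  obtains f where "continuous_on K f" "f ` K \<subseteq> M"
    "\<And>p. p \<in> K \<Longrightarrow> \<exists>c\<in>\<Q>. before c p (f p) \<and> f p \<noteq> p"
proof -
  obtain C where C: "\<And>p. p \<in> K \<Longrightarrow> C p \<in> \<Q> \<and> p \<in> dom (C p) \<and> crd (C p) p = (0, \<lambda>_. 0)"
    using \<Q>(2) by metis
  define N where "N p = {q \<in> dom (C p). 0 < bump (C p) q}" for p
  have "openin (top_of_set M) (N p) \<and> p \<in> N p" if "p \<in> K" for p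
  proof -
    have cB: "C p \<in> \<B>" using C[OF that] \<Q>(1) by blast
    have "openin (top_of_set (dom (C p))) (dom (C p) \<inter> bump (C p) -` {0<..})"
      by (rule continuous_openin_preimage_gen[OF continuous_bump[OF cB]]) simp
    then have "openin (top_of_set M) (dom (C p) \<inter> bump (C p) -` {0<..})"
      using openin_trans open_dom[OF cB] by blast
    moreover have "dom (C p) \<inter> bump (C p) -` {0<..} = N p" by (auto simp: N_def)
    moreover have "bump (C p) p = 1/2" using C[OF that] by (simp add: bump_def)
    ultimately show ?thesis using C[OF that] by (simp add: N_def)
  qed
  then obtain P where P: "finite P" "P \<subseteq> K" "K \<subseteq> (\<Union>p\<in>P. N p)"
    by (rule compact_finite_subcover_in[OF K, of N]) (assumption | rule that)+
  obtain F where F: "pushes F (C ` P)"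
    using pushes_finite[of "C ` P"] P C \<Q>(1) by blast
  define good where "good p N e \<longleftrightarrow> openin (top_of_set M) N \<and> p \<in> N \<and> 0 < e \<and> e \<le> 1 \<and>
       (\<forall>q\<in>N. \<forall>t\<in>{0..e}. before (C p) q (F (q, t)) \<and>
         (0 < t \<and> (\<exists>d\<in>C ` P. q \<in> dom d \<and> 0 < bump d q) \<longrightarrow> F (q, t) \<noteq> q))"
    for p N e
  have "\<exists>Ne. good p (fst Ne) (snd Ne)" if "p \<in> K" for p
  proof -
    have "C p \<in> \<B>" "p \<in> dom (C p)" using C[OF that] \<Q>(1) by blast+
    then show ?thesis using F unfolding pushes_def good_def by (simp del: split_paired_Ex add: split_paired_Ex)
  qed
  then obtain Ne where Ne: "\<And>p. p \<in> K \<Longrightarrow> good p (fst (Ne p)) (snd (Ne p))"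
    by metis
  have "openin (top_of_set M) (fst (Ne p)) \<and> p \<in> fst (Ne p)" if "p \<in> K" for p
    using Ne[OF that] by (simp add: good_def)
  then obtain R where R: "finite R" "R \<subseteq> K" "K \<subseteq> (\<Union>p\<in>R. fst (Ne p))"
    by (rule compact_finite_subcover_in[OF K, of "\<lambda>p. fst (Ne p)"]) (assumption | rule that)+
  \<comment> \<open>The element 1 keeps the minimum inside the time interval of the homotopy, also
    when \<open>R\<close> is empty.\<close>
  define e where "e = Min (insert 1 ((\<lambda>p. snd (Ne p)) ` R))"
  have e: "0 < e" "e \<le> 1" "\<And>p. p \<in> R \<Longrightarrow> e \<le> snd (Ne p)"
  proof -
    have "0 < x" if "x \<in> insert 1 ((\<lambda>p. snd (Ne p)) ` R)" for x
      using that Ne R(2) unfolding good_def by auto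
    then show "0 < e" unfolding e_def using R(1) by (subst Min_gr_iff) auto
    show "e \<le> 1" unfolding e_def using R(1) by (intro Min_le) auto
    show "e \<le> snd (Ne p)" if "p \<in> R" for p unfolding e_def using R(1) that by (intro Min_le) auto
  qed
  have Fc: "continuous_on (M \<times> {0..1}) F" "F ` (M \<times> {0..1}) \<subseteq> M"
    using F unfolding pushes_def by blast+
  show ?thesis
  proof (rule that[of "\<lambda>q. F (q, e)"])
    show "continuous_on K (\<lambda>q. F (q, e))"
      by (rule continuous_on_compose2[OF Fc(1)]) (use K e in \<open>auto intro!: continuous_intros\<close>)
    have "(q, e) \<in> M \<times> {0..1}" if "q \<in> K" for q using K(2) that e by auto
    then show "(\<lambda>q. F (q, e)) ` K \<subseteq> M" using Fc(2) by blast
    fix q assume q: "q \<in> K"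
    obtain p where p: "p \<in> R" "q \<in> fst (Ne p)" using R(3) q by blast
    have pK: "p \<in> K" using p R(2) by blast
    obtain p' where p': "p' \<in> P" "q \<in> N p'" using P(3) q by blast
    have "e \<in> {0..snd (Ne p)}" using e(1) e(3)[OF p(1)] by simp
    then have *: "before (C p) q (F (q, e)) \<and>
        (0 < e \<and> (\<exists>d\<in>C ` P. q \<in> dom d \<and> 0 < bump d q) \<longrightarrow> F (q, e) \<noteq> q)"
      using Ne[OF pK] p(2) unfolding good_def by blast
    have "C p' \<in> C ` P" "0 < bump (C p') q" "q \<in> dom (C p')" using p' by (auto simp: N_def)
    then have "F (q, e) \<noteq> q" using * e(1) by blast
    then show "\<exists>c\<in>\<Q>. before c q (F (q, e)) \<and> F (q, e) \<noteq> q" using * C[OF pK] by blast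
  qed
qed

lemma reverse_oriented: "oriented_family m M (flip ` \<B>)"
proof
  show "is_flowbox m M c" if "c \<in> flip ` \<B>" for c
    using that box is_flowbox_flip by blast
  show "(tr c p = tr c q) = (tr d p = tr d q)"
    if cd: "c \<in> flip ` \<B>" "d \<in> flip ` \<B>" "p \<in> dom c \<inter> dom d" "q \<in> dom c \<inter> dom d" for c d p q
  proof -
    obtain c' d' where "c' \<in> \<B>" "d' \<in> \<B>" "c = flip c'" "d = flip d'" using cd(1,2) by blast
    then show ?thesis using agree[of c' d' p q] cd(3,4) by simp
  qed
  show "\<exists>c\<in>flip ` \<B>. p \<in> dom c \<and> dom c \<subseteq> O' \<and> crd c p = (0, \<lambda>_. 0)"
    if prem: "p \<in> M" "openin (top_of_set M) O'" "p \<in> O'" for p O'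
  proof -
    obtain c where "c \<in> \<B>" "p \<in> dom c" "dom c \<subseteq> O'" "crd c p = (0, \<lambda>_. 0)"
      using small[OF prem] by blast
    then show ?thesis by (intro bexI[of _ "flip c"]) (auto simp: flip_def)
  qed
  show "coh c d p" if cd: "c \<in> flip ` \<B>" "d \<in> flip ` \<B>" "p \<in> dom c" "p \<in> dom d" for c d p
  proof -
    obtain c' d' where c': "c' \<in> \<B>" "d' \<in> \<B>" "c = flip c'" "d = flip d'" using cd(1,2) by blast
    have "coh c' d' p" using coherent[OF c'(1,2)] cd(3,4) c' by simp
    then obtain N where N: "openin (top_of_set M) N" "p \<in> N" "N \<subseteq> dom c' \<inter> dom d'"
      "\<And>q r. q \<in> N \<Longrightarrow> r \<in> N \<Longrightarrow> tr c' q = tr c' r \<Longrightarrow> ht c' q < ht c' r \<longleftrightarrow> ht d' q < ht d' r"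
      by (rule coh_nbhd) (rule that)
    have "ht c q < ht c r \<longleftrightarrow> ht d q < ht d r" if "q \<in> N" "r \<in> N" "tr c q = tr c r" for q r
      using N(4)[OF that(2,1)] that(3) c' by simp
    moreover have "N \<subseteq> dom c \<inter> dom d" using N(3) c' by simp
    ultimately show ?thesis unfolding coh_def using N(1,2) by blast
  qed
qed

end

section \<open>Long charts\<close>

lemma compact_lray_bounded:
  assumes "compact (K :: lray set)"
  obtains a where "b < a" "\<And>x. x \<in> K \<Longrightarrow> x < a"
proof -
  have "K \<subseteq> (\<Union>a\<in>UNIV. {..<a})" using lray_no_max by blast
  moreover have "\<And>a::lray. a \<in> UNIV \<Longrightarrow> open {..<a}" by simp
  ultimately obtain C where C: "finite C" "K \<subseteq> (\<Union>a\<in>C. {..<a})"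
    by (metis compactE_image[OF assms, of UNIV "\<lambda>a. {..<a}"])
  obtain m where m: "b < m" "\<And>x. x \<in> C \<Longrightarrow> x < m"
    by (rule countable_bounded_lray_above[of C b]) (use C(1) countable_finite in auto)
  have "x < m" if "x \<in> K" for x using C(2) m(2) that by force
  with m(1) show ?thesis by (rule that)
qed

text \<open>A form of Fodor's lemma. If it fails, every pair of an index and a level has a bound
  beyond which \<open>P\<close> is false; the countably many indices share a bound, and a limit
  level \<open>l\<close> closed under these bounds contradicts \<open>step\<close> at
  \<open>l\<close>, because the level supplied by \<open>step\<close> is passed by the
  sequence.\<close>

lemma press_down:
  fixes P :: "'i \<Rightarrow> lray \<Rightarrow> lray \<Rightarrow> bool"
  assumes I: "countable I"
    and step: "\<And>l. b < l \<Longrightarrow> \<exists>i\<in>I. \<exists>\<beta><l. \<forall>\<beta>'. \<beta> \<le> \<beta>' \<and> \<beta>' < l \<longrightarrow> P i \<beta>' l"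
  shows "\<exists>i\<in>I. \<exists>\<beta>\<ge>b. \<forall>\<gamma>. \<exists>\<alpha>>\<gamma>. \<beta> < \<alpha> \<and> P i \<beta> \<alpha>"
proof (rule ccontr)
  assume neg: "\<not> ?thesis"
  have "\<exists>\<gamma>. \<forall>\<alpha>>\<gamma>. \<beta> < \<alpha> \<longrightarrow> \<not> P i \<beta> \<alpha>" if "i \<in> I" "b \<le> \<beta>" for i \<beta>
    using neg that by blast
  then obtain \<gamma> where \<gamma>: "\<And>i \<beta> \<alpha>. i \<in> I \<Longrightarrow> b \<le> \<beta> \<Longrightarrow> \<gamma> i \<beta> < \<alpha> \<Longrightarrow> \<beta> < \<alpha> \<Longrightarrow> \<not> P i \<beta> \<alpha>"
    by metis
  have "\<exists>g. \<beta> < g \<and> (\<forall>i\<in>I. \<gamma> i \<beta> < g)" for \<beta>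
    by (rule countable_bounded_lray_above[of "(\<lambda>i. \<gamma> i \<beta>) ` I" \<beta>]) (use I in auto)
  then obtain g where g: "\<And>\<beta>. \<beta> < g \<beta>" "\<And>\<beta> i. i \<in> I \<Longrightarrow> \<gamma> i \<beta> < g \<beta>"
    by metis
  obtain t l where t: "strict_mono t" "t 0 = b" "\<And>k. g (t k) < t (Suc k)" "\<And>k. t k < l"
    "\<And>s. s < l \<Longrightarrow> \<exists>k. s < t k" "t \<longlonglongrightarrow> l"
    by (rule lray_limit_above[of g b, OF g(1)]) (rule that)
  have "b < l" using t(2) t(4)[of 0] by simp
  then obtain i \<beta> where i: "i \<in> I" "\<beta> < l" "\<And>\<beta>'. \<beta> \<le> \<beta>' \<Longrightarrow> \<beta>' < l \<Longrightarrow> P i \<beta>' l"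
    using step by blast
  obtain k where k: "\<beta> < t k" using t(5)[OF i(2)] by blast
  have "b \<le> t k" using strict_mono_less_eq[OF t(1), of 0 k] t(2) by simp
  moreover have "\<gamma> i (t k) < l"
    using g(2)[OF i(1)] t(3) t(4)[of "Suc k"] by (meson less_trans)
  ultimately have "\<not> P i (t k) l" using \<gamma>[OF i(1)] t(4) by blast
  moreover have "P i (t k) l" using i(3)[of "t k"] k t(4) by simp
  ultimately show False by blast
qed

text \<open>Above the lowest level the space is a product with the compact connected set
  \<open>S\<close>. The ball makes itself felt through the existence of an orientation and through
  \<open>rising\<close>.\<close>

locale glass_family = oriented_family m M \<B>
  for m and M :: "('x::{metric_space, second_countable_topology} \<times> lray) set" and \<B> +
  fixes S :: "'x set"
  assumes compact_S: "compact S" and connected_S: "connected S"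
    and upper: "lzero < t \<Longrightarrow> (x, t) \<in> M \<longleftrightarrow> x \<in> S"
begin

lemma openin_product:
  assumes "openin (top_of_set S) W" "open J" "J \<subseteq> {lzero<..}"
  shows "openin (top_of_set M) (W \<times> J)"
proof -
  obtain W' where W: "open W'" "W = S \<inter> W'" using assms(1) by (auto simp: openin_open)
  have "W \<times> J = M \<inter> (W' \<times> J)" using upper assms(3) W by auto
  then show ?thesis using W(1) assms(2) by (metis open_Times openin_open)
qed

lemma openin_slice:
  assumes "openin (top_of_set M) O'" "lzero < t"
  shows "openin (top_of_set S) {x \<in> S. (x, t) \<in> O'}"
proof -
  obtain T where T: "open T" "O' = M \<inter> T" using assms(1) by (auto simp: openin_open)
  have "open ((\<lambda>x. (x, t)) -` T)"
    by (rule open_vimage[OF T(1)]) (intro continuous_intros)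
  moreover have "{x \<in> S. (x, t) \<in> O'} = S \<inter> ((\<lambda>x. (x, t)) -` T)"
    using T(2) upper[OF assms(2)] by auto
  ultimately show ?thesis by (auto simp: openin_open)
qed

lemma product_nbhd:
  assumes O: "openin (top_of_set M) O'" "(x, l) \<in> O'" "lzero < l"
  obtains W a where "open W" "x \<in> W" "a < l" "lzero \<le> a" "(S \<inter> W) \<times> {a..l} \<subseteq> O'"
proof -
  obtain T where T: "open T" "O' = M \<inter> T" using O(1) by (auto simp: openin_open)
  have "(x, l) \<in> T" using O(2) T(2) by blast
  then obtain A J where AJ: "open A" "open J" "(x, l) \<in> A \<times> J" "A \<times> J \<subseteq> T"
    by (rule open_prod_elim[OF T(1)])
  obtain a where a: "a < l" "{a<..l} \<subseteq> J"
    using open_left[OF AJ(2), of l lzero] AJ(3) O(3) by auto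
  obtain a' where a': "max a lzero < a'" "a' < l" using dense[of "max a lzero" l] a O(3) by auto
  have "(S \<inter> A) \<times> {a'..l} \<subseteq> O'"
  proof
    fix p assume "p \<in> (S \<inter> A) \<times> {a'..l}"
    then obtain y t where p: "p = (y, t)" "y \<in> S" "y \<in> A" "a' \<le> t" "t \<le> l" by auto
    have "max a lzero < t" using a'(1) p(4) by (rule less_le_trans)
    then have t: "a < t" "lzero < t" by simp_all
    have "t \<in> J" using subsetD[OF a(2), of t] t(1) p(5) by simp
    moreover have "p \<in> M" using upper[OF t(2)] p(1,2) by simp
    ultimately have "t \<in> J" "p \<in> M" .
    then show "p \<in> O'" using AJ(4) T(2) p by blast
  qed
  with AJ(1,3) a' show ?thesis by (intro that[of A a']) auto
qed

text \<open>Pressing down: over a limit level, a chart around a point contains an open piece of the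
  sphere from a countable basis times a segment starting at a smaller level.\<close>

lemma long_charts:
  obtains \<W> \<beta> where "finite \<W>" "lzero < \<beta>" "S = \<Union>\<W>" "\<And>W. W \<in> \<W> \<Longrightarrow> openin (top_of_set S) W"
    "\<And>W \<alpha>. W \<in> \<W> \<Longrightarrow> \<exists>c\<in>\<B>. W \<times> {\<beta>..\<alpha>} \<subseteq> dom c"
proof -
  obtain B :: "'x set set" where B: "countable B" "topological_basis B"
    using ex_countable_basis by blast
  \<comment> \<open>A whole finite cover serves as one index. There are countably many finite
    subsets of the basis, and pressing down then yields a single \<open>\<beta>\<close> for all
    members of the cover.\<close>
  define I where "I = {F. finite F \<and> F \<subseteq> B}"
  define P where "P F \<beta> \<alpha> \<longleftrightarrow> S \<subseteq> \<Union>F \<and> (\<forall>W\<in>F. \<exists>c\<in>\<B>. (S \<inter> W) \<times> {\<beta>..\<alpha>} \<subseteq> dom c)" for F \<beta> \<alpha>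
  obtain b where b: "lzero < b" using lray_no_max by blast
  have "countable I" unfolding I_def by (rule countable_Collect_finite_subset[OF B(1)])
  then have "\<exists>F\<in>I. \<exists>\<beta>\<ge>b. \<forall>\<gamma>. \<exists>\<alpha>>\<gamma>. \<beta> < \<alpha> \<and> P F \<beta> \<alpha>"
  proof (rule press_down)
    fix l assume "b < l"
    then have l: "lzero < l" using b by simp
    have "\<exists>W a. W \<in> B \<and> x \<in> W \<and> a < l \<and> (\<exists>c\<in>\<B>. (S \<inter> W) \<times> {a..l} \<subseteq> dom c)" if x: "x \<in> S" for x
    proof -
      have xM: "(x, l) \<in> M" using upper[OF l] x by blast
      then obtain c where c: "c \<in> \<B>" "(x, l) \<in> dom c" using small[OF xM] by force
      obtain W a where W: "open W" "x \<in> W" "a < l" "(S \<inter> W) \<times> {a..l} \<subseteq> dom c"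
        by (rule product_nbhd[OF open_dom[OF c(1)] c(2) l]) (rule that)
      obtain W' where "W' \<in> B" "x \<in> W'" "W' \<subseteq> W"
        using topological_basisE[OF B(2) W(1,2)] by blast
      then show ?thesis using W c by blast
    qed
    then obtain W a where W: "\<And>x. x \<in> S \<Longrightarrow> W x \<in> B \<and> x \<in> W x \<and> a x < l \<and> (\<exists>c\<in>\<B>. (S \<inter> W x) \<times> {a x..l} \<subseteq> dom c)"
      by metis
    have "open (W x)" if "x \<in> S" for x using W[OF that] B(2) topological_basis_open by blast
    moreover have "S \<subseteq> (\<Union>x\<in>S. W x)" using W by blast
    ultimately obtain C where C: "C \<subseteq> S" "finite C" "S \<subseteq> (\<Union>x\<in>C. W x)"
      by (rule compactE_image[OF compact_S])
    define \<beta> where "\<beta> = Max (insert b (a ` C))"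
    have \<beta>: "b \<le> \<beta>" "\<And>x. x \<in> C \<Longrightarrow> a x \<le> \<beta>" "\<beta> < l"
    proof -
      show "b \<le> \<beta>" unfolding \<beta>_def using C(2) by (intro Max_ge) auto
      show "a x \<le> \<beta>" if "x \<in> C" for x unfolding \<beta>_def using C(2) that by (intro Max_ge) auto
      show "\<beta> < l" unfolding \<beta>_def using C W \<open>b < l\<close> by (subst Max_less_iff) auto
    qed
    have "P (W ` C) \<beta>' l" if "\<beta> \<le> \<beta>'" for \<beta>'
      unfolding P_def
    proof (intro conjI ballI)
      show "S \<subseteq> \<Union> (W ` C)" using C(3) .
      fix V assume "V \<in> W ` C"
      then obtain x where x: "x \<in> C" "V = W x" by blast
      then obtain c where c: "c \<in> \<B>" "(S \<inter> W x) \<times> {a x..l} \<subseteq> dom c" using W C(1) by blast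
      have "{\<beta>'..l} \<subseteq> {a x..l}" using \<beta>(2)[OF x(1)] that by auto
      then show "\<exists>c\<in>\<B>. (S \<inter> V) \<times> {\<beta>'..l} \<subseteq> dom c" using c x(2) by blast
    qed
    moreover have "W ` C \<in> I" unfolding I_def using C W by auto
    ultimately show "\<exists>i\<in>I. \<exists>\<beta><l. \<forall>\<beta>'. \<beta> \<le> \<beta>' \<and> \<beta>' < l \<longrightarrow> P i \<beta>' l"
      using \<beta>(3) by blast
  qed
  then obtain F \<beta> where F: "F \<in> I" "b \<le> \<beta>" "\<And>\<gamma>. \<exists>\<alpha>>\<gamma>. P F \<beta> \<alpha>" by blast
  show ?thesis
  proof (rule that[of "(\<lambda>W. S \<inter> W) ` F" \<beta>])
    show "finite ((\<lambda>W. S \<inter> W) ` F)" using F(1) unfolding I_def by blast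
    show "lzero < \<beta>" using b F(2) by simp
    have "S \<subseteq> \<Union>F" using F(3)[of lzero] unfolding P_def by blast
    then show "S = \<Union> ((\<lambda>W. S \<inter> W) ` F)" by auto
    show "openin (top_of_set S) W" if "W \<in> (\<lambda>W. S \<inter> W) ` F" for W
    proof -
      obtain W' where W': "W' \<in> F" "W = S \<inter> W'" using \<open>W \<in> (\<lambda>W. S \<inter> W) ` F\<close> by blast
      have "W' \<in> B" using F(1) W'(1) unfolding I_def by blast
      then have "open W'" by (rule topological_basis_open[OF B(2)])
      then show ?thesis unfolding W'(2) by (rule openin_open_Int)
    qed
    show "\<exists>c\<in>\<B>. W \<times> {\<beta>..\<alpha>} \<subseteq> dom c" if W: "W \<in> (\<lambda>W. S \<inter> W) ` F" for W \<alpha>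
    proof -
      \<comment> \<open>Pressing down gives boxes for unboundedly many levels; a box for a higher
        level serves all lower ones.\<close>
      obtain \<alpha>' where "\<alpha> < \<alpha>'" "P F \<beta> \<alpha>'" using F(3) by blast
      then obtain c where "c \<in> \<B>" "W \<times> {\<beta>..\<alpha>'} \<subseteq> dom c" using W unfolding P_def by blast
      moreover have "{\<beta>..\<alpha>} \<subseteq> {\<beta>..\<alpha>'}" using \<open>\<alpha> < \<alpha>'\<close> by auto
      ultimately show ?thesis by blast
    qed
  qed
qed

text \<open>Beyond \<open>\<delta>\<close> the line over \<open>x\<close> lies in a leaf. Put in
  terms of plaques alone, the notion says nothing about the direction and is the same for the
  reversed boxes.\<close>

definition vert :: "'x \<Rightarrow> lray \<Rightarrow> bool" where
  "vert x \<delta> \<longleftrightarrow> x \<in> S \<and> (\<forall>c\<in>\<B>. \<forall>t t'. \<delta> < t \<and> t \<le> t' \<and> {x} \<times> {t..t'} \<subseteq> dom c \<longrightarrow> tr c (x, t) = tr c (x, t'))"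

lemma vert_mono: "vert x \<delta> \<Longrightarrow> \<delta> \<le> \<delta>' \<Longrightarrow> vert x \<delta>'"
  unfolding vert_def by (meson order_le_less_trans)

lemma reverse_glass: "glass_family m M (flip ` \<B>) S"
  using reverse_oriented compact_S connected_S upper
  by (simp add: glass_family_def glass_family_axioms_def)

end

section \<open>Leaves in a long tube\<close>

text \<open>One member of the cover from \<open>long_charts\<close>. The box may depend on
  \<open>\<alpha>\<close>; no single box needs to contain the whole tube.\<close>

locale tube = glass_family m M \<B> S
  for m and M :: "('x::{metric_space, second_countable_topology} \<times> lray) set" and \<B> S +
  fixes W \<beta>
  assumes open_W: "openin (top_of_set S) W" and beta: "lzero < \<beta>"
    and charts: "\<exists>c\<in>\<B>. W \<times> {\<beta>..\<alpha>} \<subseteq> dom c"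
begin

definition \<Omega> where "\<Omega> = W \<times> {\<beta><..}"

lemma W_sub: "W \<subseteq> S" using open_W openin_imp_subset by blast

lemma open_Omega: "openin (top_of_set M) \<Omega>"
  unfolding \<Omega>_def by (rule openin_product[OF open_W]) (use beta in auto)

definition conn where "conn c p q \<longleftrightarrow> c \<in> \<B> \<and> before c p q \<and> arc c p q \<subseteq> \<Omega>"

text \<open>One arc inside the tube is enough: arcs joined end to end fit into one long box and form
  an arc there, see \<open>reach_trans\<close>.\<close>

definition reach where "reach p q \<longleftrightarrow> (\<exists>c. conn c p q)"

section \<open>The order along the leaves of a tube\<close>

lemma continuous_arc_param:
  assumes "c \<in> \<B>" "before c p q"
  shows "continuous_on {ht c p..ht c q} (\<lambda>s. pt c (s, tr c p))"
proof (rule continuous_on_compose2[OF cont_pt[OF assms(1)]])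
  show "continuous_on {ht c p..ht c q} (\<lambda>s. (s, tr c p))" by (intro continuous_intros)
  show "(\<lambda>s. (s, tr c p)) ` {ht c p..ht c q} \<subseteq> fcube m" using before_fcube[OF assms] by blast
qed

lemma arc_param: "arc c p q = (\<lambda>s. pt c (s, tr c p)) ` {ht c p..ht c q}"
  unfolding arc_def by blast

lemma compact_arc: "c \<in> \<B> \<Longrightarrow> before c p q \<Longrightarrow> compact (arc c p q)"
  unfolding arc_param by (intro compact_continuous_image continuous_arc_param) auto

lemma arc_bounded:
  assumes "conn c p q"
  obtains a where "b < a" "arc c p q \<subseteq> W \<times> {\<beta><..<a}"
proof -
  have c: "c \<in> \<B>" "before c p q" "arc c p q \<subseteq> \<Omega>" using assms by (auto simp: conn_def)
  have "compact (snd ` arc c p q)"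
    by (intro compact_continuous_image compact_arc c continuous_intros)
  then obtain a where a: "b < a" "\<And>x. x \<in> snd ` arc c p q \<Longrightarrow> x < a"
    by (rule compact_lray_bounded[where b = b]) (rule that)
  have "arc c p q \<subseteq> W \<times> {\<beta><..<a}"
  proof
    fix r assume r: "r \<in> arc c p q"
    then have "snd r < a" using a(2) by blast
    with r c(3) show "r \<in> W \<times> {\<beta><..<a}" unfolding \<Omega>_def by (cases r) auto
  qed
  with a(1) show ?thesis by (rule that)
qed

text \<open>A compact arc stays below some level \<open>a\<close>, so every box containing the tube
  up to \<open>a\<close> contains the arc. The free bound \<open>b\<close> allows several such
  requirements to be met by one box.\<close>

lemma conn_transfer:
  assumes "conn c p q"
  obtains a where "b < a" "\<And>d \<alpha>. d \<in> \<B> \<Longrightarrow> a \<le> \<alpha> \<Longrightarrow> W \<times> {\<beta>..\<alpha>} \<subseteq> dom d \<Longrightarrow> conn d p q \<and> arc d p q = arc c p q"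
proof -
  obtain a where a: "b < a" "arc c p q \<subseteq> W \<times> {\<beta><..<a}" by (rule arc_bounded[OF assms, where b = b])
  have c: "c \<in> \<B>" "before c p q" "arc c p q \<subseteq> \<Omega>" using assms by (auto simp: conn_def)
  have "conn d p q \<and> arc d p q = arc c p q" if d: "d \<in> \<B>" "a \<le> \<alpha>" "W \<times> {\<beta>..\<alpha>} \<subseteq> dom d" for d \<alpha>
  proof -
    have "{\<beta><..<a} \<subseteq> {\<beta>..\<alpha>}" using d(2) by auto
    then have "arc c p q \<subseteq> dom d" using a(2) d(3) by blast
    then show ?thesis using arc_transfer[OF c(1) d(1) c(2)] c(3) d(1) by (simp add: conn_def)
  qed
  with a(1) show ?thesis by (rule that)
qed

lemma reach_chart:
  assumes "reach p q"
  obtains a where "b < a" "\<And>d \<alpha>. d \<in> \<B> \<Longrightarrow> a \<le> \<alpha> \<Longrightarrow> W \<times> {\<beta>..\<alpha>} \<subseteq> dom d \<Longrightarrow> conn d p q"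
proof -
  obtain c where "conn c p q" using assms reach_def by blast
  then show ?thesis using conn_transfer[of c p q b] that by metis
qed

lemma reach_chart2:
  assumes "reach p q" "reach p' q'"
  obtains d \<alpha> where "b < \<alpha>" "W \<times> {\<beta>..\<alpha>} \<subseteq> dom d" "conn d p q" "conn d p' q'"
proof -
  obtain a1 where a1: "b < a1" "\<And>d \<alpha>. d \<in> \<B> \<Longrightarrow> a1 \<le> \<alpha> \<Longrightarrow> W \<times> {\<beta>..\<alpha>} \<subseteq> dom d \<Longrightarrow> conn d p q"
    by (rule reach_chart[OF assms(1), where b = b]) (rule that)
  obtain a2 where a2: "a1 < a2" "\<And>d \<alpha>. d \<in> \<B> \<Longrightarrow> a2 \<le> \<alpha> \<Longrightarrow> W \<times> {\<beta>..\<alpha>} \<subseteq> dom d \<Longrightarrow> conn d p' q'"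
    by (rule reach_chart[OF assms(2), where b = a1]) (rule that)
  obtain d where d: "d \<in> \<B>" "W \<times> {\<beta>..a2} \<subseteq> dom d" using charts by blast
  show ?thesis
    by (rule that[OF less_trans[OF a1(1) a2(1)] d(2) a1(2)[OF d(1) less_imp_le[OF a2(1)] d(2)] a2(2)[OF d(1) order_refl d(2)]])
qed

lemma conn_sub:
  assumes "conn c p q" "r \<in> arc c p q" "r' \<in> arc c p q" "ht c r \<le> ht c r'"
  shows "conn c r r'"
proof -
  have c: "c \<in> \<B>" "before c p q" "arc c p q \<subseteq> \<Omega>" using assms by (auto simp: conn_def)
  have r: "before c p r" "before c r q" "before c p r'" "before c r' q"
    using assms arc_iff[OF c(1,2)] by blast+
  have b: "before c r r'" using r assms(4) by (simp add: before_def)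
  have "arc c r r' \<subseteq> arc c p q"
    using arc_iff[OF c(1) b] arc_iff[OF c(1,2)] before_trans r by blast
  then show ?thesis using b c by (auto simp: conn_def)
qed

lemma conn_ends: "conn c p q \<Longrightarrow> p \<in> arc c p q \<and> q \<in> arc c p q"
  unfolding conn_def using arc_iff before_refl unfolding before_def by blast

lemma reach_Omega: "reach p q \<Longrightarrow> p \<in> \<Omega> \<and> q \<in> \<Omega>"
  unfolding reach_def using conn_ends conn_def by blast

text \<open>This makes arcs independent of the box in which they are drawn: they are the order
  intervals of \<open>reach\<close>.\<close>

lemma reach_between:
  assumes "conn c p q"
  shows "r \<in> arc c p q \<longleftrightarrow> reach p r \<and> reach r q"
proof
  assume r: "r \<in> arc c p q"
  have "before c p r" "before c r q" using r arc_iff assms unfolding conn_def by blast+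
  then show "reach p r \<and> reach r q"
    using conn_sub[OF assms _ r] conn_sub[OF assms r] conn_ends[OF assms] unfolding reach_def before_def by blast
next
  assume r: "reach p r \<and> reach r q"
  obtain a where a: "lzero < a" "\<And>d \<alpha>. d \<in> \<B> \<Longrightarrow> a \<le> \<alpha> \<Longrightarrow> W \<times> {\<beta>..\<alpha>} \<subseteq> dom d \<Longrightarrow> conn d p q \<and> arc d p q = arc c p q"
    by (rule conn_transfer[OF assms, where b = lzero]) (rule that)
  obtain d \<alpha> where d: "a < \<alpha>" "W \<times> {\<beta>..\<alpha>} \<subseteq> dom d" "conn d p r" "conn d r q"
    by (rule reach_chart2[OF conjunct1[OF r] conjunct2[OF r], where b = a])
  have dB: "d \<in> \<B>" "before d p r" "before d r q" using d unfolding conn_def by blast+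
  have dd: "conn d p q" "arc d p q = arc c p q" using a(2)[OF dB(1) less_imp_le[OF d(1)] d(2)] by blast+
  then have "r \<in> arc d p q" using arc_iff[OF dB(1)] dB dd unfolding conn_def by blast
  then show "r \<in> arc c p q" using dd by simp
qed

lemma reach_refl:
  assumes "p \<in> \<Omega>"
  shows "reach p p"
proof -
  obtain x t where p: "p = (x, t)" "x \<in> W" "\<beta> < t" using assms by (auto simp: \<Omega>_def)
  obtain c where c: "c \<in> \<B>" "W \<times> {\<beta>..t} \<subseteq> dom c" using charts by blast
  have pd: "p \<in> dom c" using c(2) p by auto
  then have b: "before c p p" by (rule before_refl)
  have "arc c p p \<subseteq> {p}" using arc_param[of c p p] before_pt[OF c(1) b] by auto
  then have "conn c p p" using b c(1) assms by (auto simp: conn_def)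
  then show ?thesis unfolding reach_def by blast
qed

text \<open>In a common box both arcs lie on one plaque, and the heights between the ends are split
  at \<open>q\<close>.\<close>

lemma reach_trans:
  assumes "reach p q" "reach q r"
  shows "reach p r"
proof -
  obtain d \<alpha> where d: "lzero < \<alpha>" "W \<times> {\<beta>..\<alpha>} \<subseteq> dom d" "conn d p q" "conn d q r"
    by (rule reach_chart2[OF assms, where b = lzero])
  have b: "d \<in> \<B>" "before d p q" "before d q r" using d unfolding conn_def by blast+
  have pr: "before d p r" using before_trans b by blast
  have "arc d p r \<subseteq> arc d p q \<union> arc d q r"
  proof
    fix s assume "s \<in> arc d p r"
    then have s: "before d p s" "before d s r" using arc_iff[OF b(1) pr] by blast+
    show "s \<in> arc d p q \<union> arc d q r"
    proof (cases "ht d s \<le> ht d q")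
      case True
      then have "before d s q" using s b(2) by (simp add: before_def)
      then show ?thesis using arc_iff[OF b(1,2)] s by blast
    next
      case False
      then have "before d q s" using s b(3) by (simp add: before_def)
      then show ?thesis using arc_iff[OF b(1,3)] s by blast
    qed
  qed
  then have "conn d p r" using d pr b(1) unfolding conn_def by blast
  then show ?thesis unfolding reach_def by blast
qed

lemma reach_linear:
  assumes "reach p q" "reach p r"
  shows "reach q r \<or> reach r q"
proof -
  obtain d \<alpha> where d: "lzero < \<alpha>" "W \<times> {\<beta>..\<alpha>} \<subseteq> dom d" "conn d p q" "conn d p r"
    by (rule reach_chart2[OF assms, where b = lzero])
  have b: "d \<in> \<B>" "before d p q" "before d p r" using d unfolding conn_def by blast+
  show ?thesis
  proof (cases "ht d q \<le> ht d r")
    case True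
    then have "before d q r" using b by (simp add: before_def)
    then have "q \<in> arc d p r" using arc_iff[OF b(1,3)] b by blast
    then show ?thesis using reach_between[OF d(4)] by blast
  next
    case False
    then have "before d r q" using b by (simp add: before_def)
    then have "r \<in> arc d p q" using arc_iff[OF b(1,2)] b by blast
    then show ?thesis using reach_between[OF d(3)] by blast
  qed
qed

lemma reach_antisym:
  assumes "reach p q" "reach q p"
  shows "p = q"
proof -
  obtain d \<alpha> where "lzero < \<alpha>" "W \<times> {\<beta>..\<alpha>} \<subseteq> dom d" "conn d p q" "conn d q p"
    by (rule reach_chart2[OF assms, where b = lzero])
  then have "d \<in> \<B>" "before d p q" "before d q p" unfolding conn_def by blast+
  then show ?thesis using crd_eqD[of d p q] by (simp add: before_def)
qed

section \<open>Leaves that climb through all levels\<close>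

definition long where "long p \<longleftrightarrow> (\<forall>\<gamma>. \<exists>q. reach p q \<and> \<gamma> < snd q)"

text \<open>A leaf may turn back and meet a level several times; the first meeting depends on the
  level in a controlled way.\<close>

definition first_hit where "first_hit p t q \<longleftrightarrow> reach p q \<and> snd q = t \<and>
   (\<forall>r. reach p r \<and> reach r q \<and> r \<noteq> q \<longrightarrow> snd r < t)"

text \<open>The parameters at which the level is at least \<open>t\<close> form a compact set. At
  its minimum the level is exactly \<open>t\<close>, by connectedness of the part of the arc before
  it.\<close>

lemma arc_level:
  assumes "conn c p q" "snd p \<le> t" "t \<le> snd q"
  obtains r where "r \<in> arc c p q" "snd r = t" "\<And>s. s \<in> arc c p q \<Longrightarrow> ht c s < ht c r \<Longrightarrow> snd s < t"
proof -
  have c: "c \<in> \<B>" "before c p q" using assms(1) by (auto simp: conn_def)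
  define f where "f s = pt c (s, tr c p)" for s
  define I where "I = {ht c p..ht c q}"
  have cf: "continuous_on I f" unfolding f_def I_def by (rule continuous_arc_param[OF c])
  have ch: "continuous_on I (\<lambda>s. snd (f s))" by (rule continuous_on_snd[OF cf])
  have "f (ht c p) = p" "f (ht c q) = q"
    unfolding f_def by (rule before_pt[OF c])+
  moreover have "ht c p \<in> I" "ht c q \<in> I"
    using c(2) by (auto simp: I_def before_def)
  ultimately have ends: "f (ht c p) = p" "f (ht c q) = q" "ht c p \<in> I" "ht c q \<in> I"
    by simp_all
  have hf: "ht c (f s) = s" "f s \<in> arc c p q" if "s \<in> I" for s
    using crd_pt[OF c(1) before_fcube[OF c, of s]] that unfolding f_def I_def arc_param by auto
  have fh: "s \<in> arc c p q \<Longrightarrow> ht c s \<in> I \<and> f (ht c s) = s" for s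
    unfolding arc_param using hf unfolding f_def[symmetric] I_def[symmetric] by auto
  define Z where "Z = {s \<in> I. t \<le> snd (f s)}"
  have "closedin (top_of_set I) (I \<inter> (\<lambda>s. snd (f s)) -` {t..})"
    by (rule continuous_closedin_preimage[OF ch]) simp
  moreover have "I \<inter> (\<lambda>s. snd (f s)) -` {t..} = Z" by (auto simp: Z_def)
  ultimately have "compact Z"
    using closedin_compact[of I Z] by (simp add: I_def)
  moreover have "Z \<noteq> {}" using ends assms(3) unfolding Z_def by auto
  ultimately obtain s0 where s0: "s0 \<in> Z" "\<And>s. s \<in> Z \<Longrightarrow> s0 \<le> s"
    by (metis compact_attains_inf)
  have s0I: "s0 \<in> I" "t \<le> snd (f s0)" using s0(1) by (auto simp: Z_def)
  have sub: "{ht c p..s0} \<subseteq> I" using s0I(1) by (auto simp: I_def)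
  have "connected ((\<lambda>s. snd (f s)) ` {ht c p..s0})"
    by (intro connected_continuous_image continuous_on_subset[OF ch sub]) simp
  moreover have "snd p \<in> (\<lambda>s. snd (f s)) ` {ht c p..s0}"
    using ends(1) s0I(1) by (intro image_eqI[of _ _ "ht c p"]) (auto simp: I_def)
  moreover have "snd (f s0) \<in> (\<lambda>s. snd (f s)) ` {ht c p..s0}"
    using s0I(1) by (intro imageI) (auto simp: I_def)
  ultimately have "t \<in> (\<lambda>s. snd (f s)) ` {ht c p..s0}"
    using assms(2) s0I(2) by (rule connectedD_interval)
  then obtain s1 where s1: "s1 \<in> {ht c p..s0}" "snd (f s1) = t" by blast
  then have "s1 \<in> Z" using sub by (auto simp: Z_def)
  then have "s1 = s0" using s0(2) s1(1) by force
  show ?thesis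
  proof (rule that[of "f s0"])
    show "f s0 \<in> arc c p q" by (rule hf(2)[OF s0I(1)])
    show "snd (f s0) = t" using s1(2) \<open>s1 = s0\<close> by simp
    fix s assume s: "s \<in> arc c p q" "ht c s < ht c (f s0)"
    then have "ht c s \<notin> Z" using s0(2)[of "ht c s"] hf(1)[OF s0I(1)] by auto
    then show "snd s < t" using fh[OF s(1)] by (auto simp: Z_def)
  qed
qed

lemma first_hit_exists:
  assumes "long p" "snd p \<le> t"
  shows "\<exists>q. first_hit p t q"
proof -
  obtain q' where q': "reach p q'" "t < snd q'" using assms(1) long_def by blast
  then obtain c where c: "conn c p q'" using reach_def by blast
  obtain r where r: "r \<in> arc c p q'" "snd r = t" "\<And>s. s \<in> arc c p q' \<Longrightarrow> ht c s < ht c r \<Longrightarrow> snd s < t"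
    by (rule arc_level[OF c assms(2) less_imp_le[OF q'(2)]]) (rule that)
  have "snd s < t" if s: "reach p s" "reach s r" "s \<noteq> r" for s
  proof -
    have rr: "reach p r" "reach r q'" using r(1) reach_between[OF c] by blast+
    have sa: "s \<in> arc c p q'" using reach_between[OF c] s(1) reach_trans[OF s(2) rr(2)] by blast
    have "ht c s < ht c r"
    proof (rule ccontr)
      assume "\<not> ht c s < ht c r"
      then have "reach r s" using conn_sub[OF c r(1) sa] unfolding reach_def by auto
      then show False using reach_antisym s by blast
    qed
    then show ?thesis using r(3)[OF sa] by blast
  qed
  moreover have "reach p r" using r(1) reach_between[OF c] by blast
  ultimately have "first_hit p t r" using r(2) unfolding first_hit_def by blast
  then show ?thesis by blast
qed

lemma first_hit_reach:
  assumes "first_hit p t q" "reach p r" "t \<le> snd r"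
  shows "reach q r"
proof (rule ccontr)
  assume n: "\<not> reach q r"
  then have "reach r q" using reach_linear assms first_hit_def by blast
  moreover have "r \<noteq> q" using n reach_refl reach_Omega[OF assms(2)] by blast
  ultimately have "snd r < t" using assms first_hit_def by blast
  with assms(3) show False by simp
qed

text \<open>The first hits of increasing levels advance on one arc that ends in \<open>r\<close>, so
  their heights converge. The limit is at level \<open>l\<close> and not after \<open>r\<close>,
  hence it is \<open>r\<close>, the first point at that level. From above this can fail: a leaf that
  touches level \<open>l\<close> and turns back hits the higher levels elsewhere.\<close>

lemma first_hit_left_continuous:
  assumes h: "\<And>k::nat. first_hit p (t k) (q k)" and l: "first_hit p l r"
    and t: "strict_mono t" "\<And>k. t k < l" "t \<longlonglongrightarrow> l"
  shows "q \<longlonglongrightarrow> r"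
proof -
  obtain c where c: "conn c p r" using l unfolding first_hit_def reach_def by blast
  have cB: "c \<in> \<B>" "before c p r" using c by (auto simp: conn_def)
  have pr: "reach p r" "snd r = l" using l unfolding first_hit_def by blast+
  have q: "reach p (q k)" "snd (q k) = t k" for k using h unfolding first_hit_def by blast+
  have qr: "reach (q k) r" for k
    using first_hit_reach[OF h pr(1)] t(2) pr(2) by (simp add: less_imp_le)
  have qarc: "q k \<in> arc c p r" for k using reach_between[OF c] q qr by blast
  define s where "s k = ht c (q k)" for k
  have sI: "s k \<in> {ht c p..ht c r}" "q k = pt c (s k, tr c p)" for k
  proof -
    have b: "before c p (q k)" "before c (q k) r" using qarc arc_iff[OF cB] by blast+
    then show "s k \<in> {ht c p..ht c r}" by (simp add: s_def before_def)
    have "crd c (q k) = (s k, tr c p)" using b by (simp add: before_def s_def prod_eq_iff)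
    then show "q k = pt c (s k, tr c p)" using pt_crd[OF cB(1), of "q k"] b by (simp add: before_def)
  qed
  have "incseq s"
  proof (rule incseq_SucI, rule ccontr)
    fix k assume "\<not> s k \<le> s (Suc k)"
    then have "reach (q (Suc k)) (q k)"
      using conn_sub[OF c qarc qarc, of "Suc k" k] unfolding reach_def s_def by auto
    moreover have "reach (q k) (q (Suc k))"
      by (rule first_hit_reach[OF h q(1)]) (use q t(1) in \<open>simp add: strict_mono_def less_imp_le\<close>)
    ultimately have "q k = q (Suc k)" by (rule reach_antisym[rotated])
    then have "t k = t (Suc k)" using q(2) by metis
    then show False using strict_monoD[OF t(1), of k "Suc k"] by simp
  qed
  moreover have "\<forall>k. s k \<le> ht c r" using sI(1) by simp
  ultimately obtain u where u: "s \<longlonglongrightarrow> u" "\<forall>k. s k \<le> u"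
    by (rule incseq_convergent)
  have uI: "u \<in> {ht c p..ht c r}"
  proof -
    have "u \<le> ht c r" by (rule LIMSEQ_le_const2[OF u(1)]) (use sI(1) in auto)
    moreover have "ht c p \<le> s 0" using sI(1)[of 0] by simp
    ultimately show ?thesis using u(2)[rule_format, of 0] by simp
  qed
  define r' where "r' = pt c (u, tr c p)"
  have lim: "q \<longlonglongrightarrow> r'"
    unfolding sI(2)[abs_def] r'_def
    by (rule continuous_on_tendsto_compose[OF continuous_arc_param[OF cB] u(1) uI])
      (use sI(1) in auto)
  then have "(\<lambda>k. snd (q k)) \<longlonglongrightarrow> snd r'" by (rule tendsto_snd)
  then have "t \<longlonglongrightarrow> snd r'" using q(2) by simp
  then have lev: "snd r' = l" using t(3) LIMSEQ_unique by blast
  have "r' \<in> arc c p r" unfolding r'_def arc_param using uI by blast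
  then have "reach p r'" "reach r' r" using reach_between[OF c] by blast+
  then have "r' = r" using l lev unfolding first_hit_def by fastforce
  with lim show ?thesis by simp
qed

section \<open>Vertical leaves\<close>

text \<open>A leaf climbing arbitrarily high first hits the levels in points whose projection to the
  sphere is left continuous, hence eventually constant, as for every left continuous map from
  the long ray into a metric space.\<close>

lemma long_eventually_constant:
  assumes p: "p \<in> \<Omega>" "long p"
  obtains x \<delta> where "snd p \<le> \<delta>" "\<beta> \<le> \<delta>" "\<And>t. \<delta> < t \<Longrightarrow> first_hit p t (x, t)"
proof -
  define Q where "Q t = (SOME q. first_hit p t q)" for t
  define X where "X t = fst (Q t)" for t
  have X: "first_hit p t (X t, t)" if "snd p \<le> t" for t
  proof -
    have f: "first_hit p t (Q t)"
      unfolding Q_def by (rule someI_ex[OF first_hit_exists[OF p(2) that]])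
    then have "snd (Q t) = t" unfolding first_hit_def by blast
    then have "Q t = (X t, t)" by (simp add: X_def prod_eq_iff)
    with f show ?thesis by simp
  qed
  \<comment> \<open>Otherwise there are, beyond every level, two levels whose positions are
    \<open>e\<close> apart. Two sequences of such levels, interlaced with one increasing sequence,
    tend to the same limit level, where left continuity brings the positions together.\<close>
  have cauchy: "\<exists>\<delta>\<ge>snd p. \<forall>s>\<delta>. \<forall>s'>\<delta>. dist (X s) (X s') < e" if e: "e > 0" for e
  proof (rule ccontr)
    assume neg: "\<not> ?thesis"
    have "\<exists>ss. fst ss > \<delta> \<and> snd ss > \<delta> \<and> dist (X (fst ss)) (X (snd ss)) \<ge> e" if \<delta>: "snd p \<le> \<delta>" for \<delta>
    proof -
      obtain s s' where "s > \<delta>" "s' > \<delta>" "\<not> dist (X s) (X s') < e" using neg \<delta> by blast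
      then show ?thesis by (intro exI[of _ "(s, s')"]) simp
    qed
    then obtain ss where ss: "\<And>\<delta>. snd p \<le> \<delta> \<Longrightarrow> fst (ss \<delta>) > \<delta> \<and> snd (ss \<delta>) > \<delta> \<and>
        dist (X (fst (ss \<delta>))) (X (snd (ss \<delta>))) \<ge> e"
      by metis
    obtain top where top: "\<And>x. x < (top x :: lray)" using lray_no_max by metis
    \<comment> \<open>Below the level of \<open>p\<close> no pair is available, and any larger level
      serves as a default.\<close>
    define g where "g \<delta> = (if snd p \<le> \<delta> then max (fst (ss \<delta>)) (snd (ss \<delta>)) else top \<delta>)" for \<delta>
    have "\<delta> < g \<delta>" for \<delta> using ss[of \<delta>] top[of \<delta>] by (auto simp: g_def max_def)
    then obtain t l where t: "strict_mono t" "t 0 = snd p" "\<And>k. g (t k) < t (Suc k)" "\<And>k. t k < l"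
      "\<And>s. s < l \<Longrightarrow> \<exists>k. s < t k" "t \<longlonglongrightarrow> l"
      by (rule lray_limit_above[of g "snd p"]) (rule that)
    have tp: "snd p \<le> t k" for k using strict_mono_less_eq[OF t(1), of 0 k] t(2) by simp
    define u where "u k = fst (ss (t k))" for k
    define v where "v k = snd (ss (t k))" for k
    have between: "t k < u k" "u k < t (Suc k)" "t k < v k" "v k < t (Suc k)" for k
      using ss[OF tp[of k]] t(3)[of k] tp[of k] by (auto simp: u_def v_def g_def)
    have lim: "(\<lambda>k. X (w k)) \<longlonglongrightarrow> X l" if w: "\<And>k. t k < w k" "\<And>k. w k < t (Suc k)" for w
    proof -
      have sm: "strict_mono w" unfolding strict_mono_Suc_iff using w by (meson less_trans)
      have wl: "w k < l" for k using w(2)[of k] t(4)[of "Suc k"] by (rule less_trans)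
      have "w \<longlonglongrightarrow> l"
      proof (rule order_tendstoI)
        fix a assume "a < l"
        then obtain k where k: "a < t k" using t(5) by blast
        have "a < w n" if "n \<ge> k" for n
          using k strict_mono_less_eq[OF t(1), of k n] w(1)[of n] that by (meson less_le_trans less_trans)
        then show "eventually (\<lambda>n. a < w n) sequentially" by (auto simp: eventually_sequentially)
      next
        fix a assume "l < a"
        then have "w n < a" for n using wl[of n] by (rule less_trans[rotated])
        then show "eventually (\<lambda>n. w n < a) sequentially" by simp
      qed
      moreover have "first_hit p (w k) (X (w k), w k)" for k
        by (rule X) (use tp[of k] w(1)[of k] in simp)
      moreover have "first_hit p l (X l, l)"
        by (rule X) (use tp[of 0] t(4)[of 0] in simp)
      ultimately have "(\<lambda>k. (X (w k), w k)) \<longlonglongrightarrow> (X l, l)"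
        using first_hit_left_continuous[of p w "\<lambda>k. (X (w k), w k)" l "(X l, l)"] sm wl by blast
      then have "(\<lambda>k. fst (X (w k), w k)) \<longlonglongrightarrow> fst (X l, l)" by (rule tendsto_fst)
      then show ?thesis by simp
    qed
    have "(\<lambda>k. dist (X (u k)) (X (v k))) \<longlonglongrightarrow> dist (X l) (X l)"
      by (intro tendsto_dist lim between)
    then have "eventually (\<lambda>k. dist (X (u k)) (X (v k)) < e) sequentially"
      by (rule order_tendstoD) (use e in simp)
    then obtain k where "dist (X (u k)) (X (v k)) < e" by (auto simp: eventually_sequentially)
    moreover have "dist (X (u k)) (X (v k)) \<ge> e" using ss[OF tp[of k]] by (simp add: u_def v_def)
    ultimately show False by simp
  qed
  have "\<exists>\<delta>\<ge>snd p. \<forall>s>\<delta>. \<forall>s'>\<delta>. dist (X s) (X s') < 1 / real (Suc n)" for n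
    by (rule cauchy) simp
  then obtain \<delta>n where \<delta>n: "\<And>n. snd p \<le> \<delta>n n"
    "\<And>n s s'. \<delta>n n < s \<Longrightarrow> \<delta>n n < s' \<Longrightarrow> dist (X s) (X s') < 1 / real (Suc n)"
    by metis
  \<comment> \<open>Beyond a common bound of the countably many thresholds, distances are smaller
    than every 1/(n+1), that is, zero.\<close>
  obtain \<delta> where \<delta>: "max \<beta> (snd p) < \<delta>" "\<And>n. \<delta>n n < \<delta>"
    by (rule countable_bounded_lray_above[of "range \<delta>n" "max \<beta> (snd p)"]) (auto intro: that)
  have const: "X t = X \<delta>" if "\<delta> < t" for t
  proof (rule ccontr)
    assume "X t \<noteq> X \<delta>"
    then have "0 < dist (X t) (X \<delta>)" by simp
    then obtain n where "1 / real (Suc n) < dist (X t) (X \<delta>)" using nat_approx_posE by blast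
    moreover have "dist (X t) (X \<delta>) < 1 / real (Suc n)"
      by (rule \<delta>n(2)[OF less_trans[OF \<delta>(2) that] \<delta>(2)])
    ultimately show False by simp
  qed
  show ?thesis
  proof (rule that[of \<delta> "X \<delta>"])
    have \<delta>': "\<beta> < \<delta>" "snd p < \<delta>" using \<delta>(1) by simp_all
    then show "snd p \<le> \<delta>" "\<beta> \<le> \<delta>" by order+
    fix t assume t: "\<delta> < t"
    with \<delta>'(2) have "first_hit p t (X t, t)" by (intro X) order
    then show "first_hit p t (X \<delta>, t)" using const[OF t] by simp
  qed
qed

text \<open>The long boxes of the tube decide the question for all boxes, by
  \<open>agree\<close>.\<close>

lemma vertI:
  assumes x: "x \<in> W" and \<delta>: "\<beta> \<le> \<delta>"
    and eq: "\<And>c t t'. \<lbrakk>c \<in> \<B>; W \<times> {\<beta>..t'} \<subseteq> dom c; \<delta> < t; t \<le> t'\<rbrakk> \<Longrightarrow> tr c (x, t) = tr c (x, t')"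
  shows "vert x \<delta>"
  unfolding vert_def
proof (intro conjI ballI allI impI)
  show "x \<in> S" using x W_sub by blast
  fix d t t' assume d: "d \<in> \<B>" and t: "\<delta> < t \<and> t \<le> t' \<and> {x} \<times> {t..t'} \<subseteq> dom d"
  obtain c where c: "c \<in> \<B>" "W \<times> {\<beta>..t'} \<subseteq> dom c" using charts by blast
  have "(x, t) \<in> dom c \<inter> dom d" "(x, t') \<in> dom c \<inter> dom d"
    using c(2) x \<delta> t by auto
  from agree[OF c(1) d this] eq[OF c] t show "tr d (x, t) = tr d (x, t')" by simp
qed

lemma vertD:
  assumes "vert x \<delta>" "x \<in> W" "\<beta> \<le> \<delta>" "c \<in> \<B>" "W \<times> {\<beta>..a} \<subseteq> dom c" "\<delta> < t" "t \<le> t'" "t' \<le> a"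
  shows "tr c (x, t) = tr c (x, t')"
proof -
  have "{x} \<times> {t..t'} \<subseteq> W \<times> {\<beta>..a}" using assms by auto
  then have "{x} \<times> {t..t'} \<subseteq> dom c" using assms(5) by blast
  then show ?thesis using assms(1,4,6,7) unfolding vert_def by blast
qed

lemma chart_dom:
  assumes "W \<times> {\<beta>..a} \<subseteq> D" "x \<in> W" "\<beta> \<le> s" "s \<le> a"
  shows "(x, s) \<in> D"
  using assms by (intro subsetD[OF assms(1)]) simp

lemma conn_tr: "conn c p q \<Longrightarrow> tr c p = tr c q"
  unfolding conn_def before_def by blast

lemma reach_tr:
  assumes "reach p q" "c \<in> \<B>" "p \<in> dom c" "q \<in> dom c" "W \<times> {\<beta>..a} \<subseteq> dom c" "snd p \<le> a" "snd q \<le> a"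
  shows "tr c p = tr c q"
proof -
  obtain d where d: "d \<in> \<B>" "conn d p q" using assms(1) unfolding reach_def conn_def by blast
  then have "p \<in> dom d" "q \<in> dom d" unfolding conn_def before_def by blast+
  then show ?thesis using agree[OF d(1) assms(2), of p q] assms(3,4) conn_tr[OF d(2)] by blast
qed

lemma vertical_ht:
  assumes c: "c \<in> \<B>" "W \<times> {\<beta>..a} \<subseteq> dom c" and x: "x \<in> W" and t: "\<beta> \<le> t" "t \<le> t'" "t' \<le> a"
    and h: "ht c (x, t) \<le> h \<and> h \<le> ht c (x, t') \<or> ht c (x, t') \<le> h \<and> h \<le> ht c (x, t)"
  obtains s where "s \<in> {t..t'}" "ht c (x, s) = h"
proof -
  have pc: "continuous_on {t..t'} (\<lambda>s. (x, s))" by (intro continuous_intros)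
  have sub: "(\<lambda>s. (x, s)) ` {t..t'} \<subseteq> dom c"
  proof
    fix z assume "z \<in> (\<lambda>s. (x, s)) ` {t..t'}"
    then obtain s where s: "z = (x, s)" "t \<le> s" "s \<le> t'" by auto
    have "\<beta> \<le> s" "s \<le> a" using s(2,3) t by order+
    then show "z \<in> dom c" unfolding s(1) by (rule chart_dom[OF c(2) x])
  qed
  have "continuous_on {t..t'} (\<lambda>s. crd c (x, s))"
    by (rule continuous_on_compose2[OF cont_crd[OF c(1)] pc sub])
  then have "connected ((\<lambda>s. ht c (x, s)) ` {t..t'})"
    by (intro connected_continuous_image continuous_on_fst connected_lray_segment)
  moreover have "ht c (x, t) \<in> (\<lambda>s. ht c (x, s)) ` {t..t'}" "ht c (x, t') \<in> (\<lambda>s. ht c (x, s)) ` {t..t'}"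
    using t by auto
  ultimately have "h \<in> (\<lambda>s. ht c (x, s)) ` {t..t'}"
    using h connectedD_interval by blast
  then show ?thesis using that by blast
qed

text \<open>The eventual positions of the first hits form a line over \<open>x\<close> that runs
  along a plaque. Any other high point \<open>z\<close> of the leaf lies between two points of this
  line; the heights on the line take all intermediate values, among them that of \<open>z\<close>,
  and equal height on one plaque means equality.\<close>

lemma long_vertical:
  assumes p: "p \<in> \<Omega>" "long p"
  obtains x \<delta> where "x \<in> W" "vert x \<delta>" "\<And>z. reach p z \<Longrightarrow> \<delta> < snd z \<Longrightarrow> fst z = x"
proof -
  obtain x \<delta> where \<delta>: "snd p \<le> \<delta>" "\<beta> \<le> \<delta>" "\<And>t. \<delta> < t \<Longrightarrow> first_hit p t (x, t)"
    by (rule long_eventually_constant[OF p]) (rule that)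
  have r: "reach p (x, t)" if "\<delta> < t" for t using \<delta>(3)[OF that] by (simp add: first_hit_def)
  have xW: "x \<in> W"
  proof -
    obtain t where "\<delta> < t" using lray_no_max by blast
    then have "(x, t) \<in> \<Omega>" using r reach_Omega by blast
    then show ?thesis by (simp add: \<Omega>_def)
  qed
  have rr: "reach (x, t) (x, t')" if "\<delta> < t" "t \<le> t'" for t t'
    by (rule first_hit_reach[OF \<delta>(3)[OF that(1)] r]) (use that in auto)
  have tr: "tr c (x, t) = tr c (x, t')"
    if "c \<in> \<B>" "W \<times> {\<beta>..a} \<subseteq> dom c" "\<delta> < t" "t \<le> t'" "t' \<le> a" for c t t' a
  proof (rule reach_tr[OF rr[OF that(3,4)] that(1) _ _ that(2)])
    have b: "\<beta> \<le> t" "t \<le> a" "\<beta> \<le> t'" using that(3-5) \<delta>(2) by order+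
    show "(x, t) \<in> dom c" "(x, t') \<in> dom c"
      using chart_dom[OF that(2) xW] b that(5) by blast+
    show "snd (x, t) \<le> a" "snd (x, t') \<le> a" using b that(5) by simp_all
  qed
  have "vert x \<delta>"
    by (rule vertI[OF xW \<delta>(2)]) (rule tr, assumption+, rule order_refl)
  moreover have "fst z = x" if z: "reach p z" "\<delta> < snd z" for z
  proof -
    obtain t1 where t1: "\<delta> < t1" "t1 < snd z" using dense z(2) by blast
    obtain c where c: "conn c p z" using z(1) reach_def by blast
    \<comment> \<open>A level above the whole arc from \<open>p\<close> to \<open>z\<close>, so that
      the point of the line at this level is not passed before \<open>z\<close> and must come after
      it.\<close>
    obtain t2 where t2: "t1 < t2" "arc c p z \<subseteq> W \<times> {\<beta><..<t2}" by (rule arc_bounded[OF c, where b = t1])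
    have \<delta>2: "\<delta> < t2" using t1 t2 by (meson less_trans)
    have z1: "reach (x, t1) z"
      by (rule first_hit_reach[OF \<delta>(3)[OF t1(1)] z(1)]) (use t1 in simp)
    have "(x, t2) \<notin> arc c p z" using t2(2) by auto
    then have "\<not> reach (x, t2) z" using reach_between[OF c] r[OF \<delta>2] by blast
    then have z2: "reach z (x, t2)" using reach_linear[OF z(1) r[OF \<delta>2]] by blast
    obtain d \<alpha> where d: "t2 < \<alpha>" "W \<times> {\<beta>..\<alpha>} \<subseteq> dom d" "conn d (x, t1) z" "conn d z (x, t2)"
      by (rule reach_chart2[OF z1 z2, where b = t2])
    have dB: "d \<in> \<B>" "before d (x, t1) z" "before d z (x, t2)" using d unfolding conn_def by blast+
    obtain s where s: "s \<in> {t1..t2}" "ht d (x, s) = ht d z"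
      by (rule vertical_ht[OF dB(1) d(2) xW, of t1 t2 "ht d z"])
        (use dB t1 t2 \<delta>(2) d(1) in \<open>(order | simp add: before_def)+\<close>)
    have s': "t1 \<le> s" "s \<le> t2" using s(1) by simp_all
    have "\<beta> \<le> s" "s \<le> \<alpha>" using s' d(1) t1(1) \<delta>(2) by order+
    then have sd: "(x, s) \<in> dom d" by (rule chart_dom[OF d(2) xW])
    have "tr d (x, t1) = tr d (x, s)"
      by (rule tr[OF dB(1) d(2) t1(1) s'(1)]) (use s'(2) d(1) in order)
    then have "(x, s) = z"
      using crd_eqD[OF dB(1) sd, of z] s(2) dB(2) by (simp add: before_def)
    then show ?thesis by auto
  qed
  ultimately show ?thesis using that xW by blast
qed

text \<open>A tube lemma for motion inside a box. The parameter is an offset of height and not a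
  height, so that all neighbouring points travel along pieces of the same length.\<close>

lemma param_nbhd:
  assumes c: "c \<in> \<B>" and p: "p \<in> dom c" and K: "compact K" and Y: "openin (top_of_set M) Y"
    and ok: "\<And>s. s \<in> K \<Longrightarrow> (ht c p + s, tr c p) \<in> fcube m \<and> pt c (ht c p + s, tr c p) \<in> Y"
  obtains N where "openin (top_of_set M) N" "p \<in> N" "N \<subseteq> dom c"
    "\<And>q s. q \<in> N \<Longrightarrow> s \<in> K \<Longrightarrow> (ht c q + s, tr c q) \<in> fcube m \<and> pt c (ht c q + s, tr c q) \<in> Y"
proof -
  obtain T where T: "open T" "Y = M \<inter> T" using Y by (auto simp: openin_open)
  have "openin (top_of_set (fcube m)) (fcube m \<inter> pt c -` T)"
    by (rule continuous_openin_preimage_gen[OF cont_pt[OF c] T(1)])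
  then obtain D where D: "open D" "fcube m \<inter> pt c -` T = fcube m \<inter> D" by (auto simp: openin_open)
  \<comment> \<open>The second factor keeps the shifted height inside the cube; the transversal
    coordinate does not change and stays in the cell by itself.\<close>
  define D2 where "D2 = D \<inter> ({-1<..<1} \<times> UNIV)"
  have "open D2" unfolding D2_def using D(1) by (intro open_Int open_Times) auto
  define Wd where "Wd = (\<lambda>z. (fst (fst z) + snd z, snd (fst z))) -` D2"
  have "open Wd" unfolding Wd_def
    by (rule open_vimage[OF \<open>open D2\<close>]) (intro continuous_intros)
  have sub: "{crd c p} \<times> K \<subseteq> Wd"
  proof
    fix z assume "z \<in> {crd c p} \<times> K"
    then obtain s where s: "s \<in> K" "z = (crd c p, s)" by blast
    have f: "(ht c p + s, tr c p) \<in> fcube m" "pt c (ht c p + s, tr c p) \<in> T"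
      using ok[OF s(1)] unfolding T(2) by blast+
    then have "(ht c p + s, tr c p) \<in> fcube m \<inter> pt c -` T" by simp
    then have "(ht c p + s, tr c p) \<in> D" unfolding D(2) by blast
    moreover have "ht c p + s \<in> {-1<..<1}" using f(1) by (simp add: fcube_def)
    ultimately show "z \<in> Wd" by (simp add: Wd_def D2_def s(2))
  qed
  have "\<exists>X0. crd c p \<in> X0 \<and> open X0 \<and> X0 \<times> K \<subseteq> Wd"
    by (rule Elementary_Topology.tube_lemma[OF K \<open>open Wd\<close> sub])
  then obtain X0 where X0: "crd c p \<in> X0" "open X0" "X0 \<times> K \<subseteq> Wd" by blast
  define N where "N = dom c \<inter> crd c -` X0"
  have "openin (top_of_set (dom c)) N"
    unfolding N_def by (rule continuous_openin_preimage_gen[OF cont_crd[OF c] X0(2)])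
  then have 1: "openin (top_of_set M) N" using openin_trans open_dom[OF c] by blast
  have 2: "(ht c q + s, tr c q) \<in> fcube m \<and> pt c (ht c q + s, tr c q) \<in> Y" if q: "q \<in> N" "s \<in> K" for q s
  proof -
    have "(crd c q, s) \<in> Wd" using q X0(3) unfolding N_def by blast
    then have d: "(ht c q + s, tr c q) \<in> D" "ht c q + s \<in> {-1<..<1}" by (simp_all add: Wd_def D2_def)
    have "tr c q \<in> cell m" using crd_in[OF c, of q] q(1) by (auto simp: N_def fcube_def mem_Times_iff)
    then have f: "(ht c q + s, tr c q) \<in> fcube m" using d(2) by (simp add: fcube_def)
    then have "pt c (ht c q + s, tr c q) \<in> T" using d(1) D(2) by blast
    moreover have "pt c (ht c q + s, tr c q) \<in> M" using pt_in[OF c f] dom_subset[OF c] by blast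
    ultimately show ?thesis using f T(2) by blast
  qed
  show ?thesis by (rule that[OF 1 _ _ 2]) (use p X0(1) in \<open>auto simp: N_def\<close>)
qed

text \<open>Continuous dependence on the initial point: the same height difference in the same box
  takes nearby points to points near \<open>q\<close>, and by compactness the arcs stay inside the
  tube.\<close>

lemma reach_nbhd:
  assumes "reach p q" and O: "openin (top_of_set M) O'" "q \<in> O'"
  obtains N where "openin (top_of_set M) N" "p \<in> N" "\<And>p'. p' \<in> N \<Longrightarrow> \<exists>q'\<in>O'. reach p' q'"
proof -
  obtain c where c: "conn c p q" using assms(1) reach_def by blast
  then have cB: "c \<in> \<B>" "before c p q" "arc c p q \<subseteq> \<Omega>" by (auto simp: conn_def)
  have pd: "p \<in> dom c" using cB(2) by (simp add: before_def)
  define a where "a = ht c q - ht c p"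
  have a0: "0 \<le> a" using cB(2) by (simp add: a_def before_def)
  obtain N1 where N1: "openin (top_of_set M) N1" "p \<in> N1" "N1 \<subseteq> dom c"
    "\<And>r s. r \<in> N1 \<Longrightarrow> s \<in> {0..a} \<Longrightarrow> (ht c r + s, tr c r) \<in> fcube m \<and> pt c (ht c r + s, tr c r) \<in> \<Omega>"
  proof (rule param_nbhd[OF cB(1) pd, of "{0..a}" \<Omega>])
    show "compact {0..a}" "openin (top_of_set M) \<Omega>" using open_Omega by auto
    fix s assume "s \<in> {0..a}"
    then have s: "ht c p + s \<in> {ht c p..ht c q}" by (auto simp: a_def)
    then show "(ht c p + s, tr c p) \<in> fcube m \<and> pt c (ht c p + s, tr c p) \<in> \<Omega>"
      using before_fcube[OF cB(1,2) s] cB(3) unfolding arc_param by blast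
  qed (rule that)
  obtain N2 where N2: "openin (top_of_set M) N2" "p \<in> N2" "N2 \<subseteq> dom c"
    "\<And>r s. r \<in> N2 \<Longrightarrow> s \<in> {a} \<Longrightarrow> (ht c r + s, tr c r) \<in> fcube m \<and> pt c (ht c r + s, tr c r) \<in> O'"
  proof (rule param_nbhd[OF cB(1) pd, of "{a}" O'])
    show "compact {a}" "openin (top_of_set M) O'" using O by auto
    fix s assume "s \<in> {a}"
    then have s: "ht c p + s = ht c q" by (simp add: a_def)
    show "(ht c p + s, tr c p) \<in> fcube m \<and> pt c (ht c p + s, tr c p) \<in> O'"
      unfolding s using before_pt(2)[OF cB(1,2)] before_fcube[OF cB(1,2), of "ht c q"] cB(2) O(2)
      by (simp add: before_def)
  qed (rule that)
  have "\<exists>q'\<in>O'. reach p' q'" if p': "p' \<in> N1 \<inter> N2" for p'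
  proof -
    define q' where "q' = pt c (ht c p' + a, tr c p')"
    have f: "(ht c p' + a, tr c p') \<in> fcube m" "q' \<in> O'" using N2(4)[of p' a] p' by (auto simp: q'_def)
    have cr: "q' \<in> dom c" "crd c q' = (ht c p' + a, tr c p')"
      unfolding q'_def using pt_in[OF cB(1) f(1)] crd_pt[OF cB(1) f(1)] by blast+
    have b: "before c p' q'" using cr a0 p' N1(3) by (auto simp: before_def)
    have "arc c p' q' \<subseteq> \<Omega>"
    proof
      fix r assume "r \<in> arc c p' q'"
      then obtain s where s: "ht c p' \<le> s" "s \<le> ht c p' + a" "r = pt c (s, tr c p')"
        unfolding arc_param using cr(2) by auto
      then show "r \<in> \<Omega>" using N1(4)[of p' "s - ht c p'"] p' by simp
    qed
    then have "reach p' q'" unfolding reach_def conn_def using cB(1) b by blast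
    then show ?thesis using f(2) by blast
  qed
  moreover have "openin (top_of_set M) (N1 \<inter> N2)" "p \<in> N1 \<inter> N2" using N1 N2 by auto
  ultimately show ?thesis using that by blast
qed

text \<open>The vertical segment and the arc lie on one plaque and the segment takes all heights of
  the arc, so the arc is part of the segment.\<close>

lemma vertical_conn:
  assumes x: "vert x \<delta>" "x \<in> W" "\<beta> \<le> \<delta>" and t: "\<delta> < t" "t \<le> t'" "t' \<le> a"
    and c: "c \<in> \<B>" "W \<times> {\<beta>..a} \<subseteq> dom c" and h: "ht c (x, t) \<le> ht c (x, t')"
  shows "conn c (x, t) (x, t')" "arc c (x, t) (x, t') \<subseteq> {x} \<times> {t..t'}"
proof -
  have \<beta>t: "\<beta> < t" using x(3) t(1) by (rule le_less_trans)
  have d: "(x, s) \<in> dom c" if "s \<in> {t..t'}" for s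
  proof -
    have "t \<le> s" "s \<le> t'" using that by simp_all
    then have "\<beta> \<le> s" "s \<le> a" using \<beta>t t by order+
    then show ?thesis by (rule chart_dom[OF c(2) x(2)])
  qed
  have tr: "tr c (x, t) = tr c (x, s)" if "s \<in> {t..t'}" for s
    by (rule vertD[OF x c t(1)]) (use that t in auto)
  have b: "before c (x, t) (x, t')" using d tr h t by (simp add: before_def)
  show sub: "arc c (x, t) (x, t') \<subseteq> {x} \<times> {t..t'}"
  proof
    fix r assume "r \<in> arc c (x, t) (x, t')"
    then have r: "before c (x, t) r" "before c r (x, t')" using arc_iff[OF c(1) b] by blast+
    obtain s where s: "s \<in> {t..t'}" "ht c (x, s) = ht c r"
      by (rule vertical_ht[OF c x(2) less_imp_le[OF \<beta>t] t(2,3), of "ht c r"])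
        (use r in \<open>auto simp: before_def\<close>)
    have "(x, s) = r"
      using crd_eqD[OF c(1) d[OF s(1)], of r] s(2) tr[OF s(1)] r(1) by (simp add: before_def)
    then show "r \<in> {x} \<times> {t..t'}" using s(1) by auto
  qed
  have "{x} \<times> {t..t'} \<subseteq> \<Omega>" using x(2) \<beta>t by (auto simp: \<Omega>_def)
  then show "conn c (x, t) (x, t')" using sub b c(1) by (auto simp: conn_def)
qed

text \<open>If \<open>t1\<close> were higher and \<open>t2\<close> lower than \<open>t\<close> in
  the height of a box, some level between \<open>t1\<close> and \<open>t2\<close> would have the
  height of \<open>t\<close> on the same plaque. The direction therefore does not depend on the
  level of comparison.\<close>

lemma vertical_up:
  assumes x: "vert x \<delta>" "x \<in> W" "\<beta> \<le> \<delta>" and t: "\<delta> < t" "t < t1" "t < t2" and r: "reach (x, t) (x, t1)"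
  shows "reach (x, t) (x, t2)"
proof -
  define a where "a = max t1 t2"
  obtain b where b: "a < b" "\<And>d \<alpha>. d \<in> \<B> \<Longrightarrow> b \<le> \<alpha> \<Longrightarrow> W \<times> {\<beta>..\<alpha>} \<subseteq> dom d \<Longrightarrow> conn d (x, t) (x, t1)"
    by (rule reach_chart[OF r, where b = a]) (rule that)
  obtain c where c: "c \<in> \<B>" "W \<times> {\<beta>..b} \<subseteq> dom c" using charts by blast
  have cc: "conn c (x, t) (x, t1)" by (rule b(2)[OF c(1) order_refl c(2)])
  have ab: "t1 \<le> b" "t2 \<le> b" "max t1 t2 \<le> b" using b(1) by (auto simp: a_def)
  have mm: "min t1 t2 \<le> max t1 t2" by (rule order_trans[OF min.cobounded1 max.cobounded1])
  have \<beta>t: "\<beta> < t" using x(3) t(1) by (rule le_less_trans)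
  have h1: "ht c (x, t) \<le> ht c (x, t1)" using cc by (simp add: conn_def before_def)
  have "ht c (x, t) \<le> ht c (x, t2)"
  proof (rule ccontr)
    assume "\<not> ?thesis"
    then have h2: "ht c (x, t2) \<le> ht c (x, t)" by simp
    obtain s where s: "s \<in> {min t1 t2..max t1 t2}" "ht c (x, s) = ht c (x, t)"
      by (rule vertical_ht[OF c x(2), of "min t1 t2" "max t1 t2" "ht c (x, t)"])
        (use h1 h2 ab mm \<beta>t t in \<open>auto simp: min_def max_def\<close>)
    have "t < min t1 t2" using t by simp
    moreover have "min t1 t2 \<le> s" "s \<le> max t1 t2" using s(1) by simp_all
    ultimately have ts: "t < s" "s \<le> b" using ab(3) by order+
    have "tr c (x, t) = tr c (x, s)"
      by (rule vertD[OF x c t(1)]) (use ts in order)+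
    moreover have "(x, t) \<in> dom c" "(x, s) \<in> dom c"
      by (rule chart_dom[OF c(2) x(2)]; use \<beta>t ts in order)+
    ultimately have "(x, s) = (x, t)" using crd_eqD[OF c(1)] s(2) by metis
    then show False using ts by simp
  qed
  then have "conn c (x, t) (x, t2)"
    by (intro vertical_conn(1)[OF x t(1) _ ab(2) c]) (use t in simp)
  then show ?thesis unfolding reach_def by blast
qed

text \<open>For a common threshold the condition is an equality between continuous functions of the
  point.\<close>

lemma vert_closed:
  assumes v: "\<And>k::nat. vert (y k) \<delta>" and lim: "y \<longlonglongrightarrow> x" and x: "x \<in> W" and \<delta>: "\<beta> \<le> \<delta>"
  shows "vert x \<delta>"
proof (rule vertI[OF x \<delta>])
  fix c t t' assume c: "c \<in> \<B>" "W \<times> {\<beta>..t'} \<subseteq> dom c" and t: "\<delta> < t" "t \<le> t'"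
  obtain A where A: "open A" "W = S \<inter> A" using open_W by (auto simp: openin_open)
  have yS: "y k \<in> S" for k using v unfolding vert_def by blast
  have "eventually (\<lambda>k. y k \<in> A) sequentially"
    using lim A x by (auto simp: tendsto_def)
  then have ev: "eventually (\<lambda>k. y k \<in> W) sequentially"
    by eventually_elim (use A yS in simp)
  have lims: "(\<lambda>k. tr c (y k, s)) \<longlonglongrightarrow> tr c (x, s)" if s: "\<delta> < s" "s \<le> t'" for s
  proof -
    have d: "(z, s) \<in> dom c" if "z \<in> W" for z using c(2) that s \<delta> by (auto simp: subset_iff)
    have "(\<lambda>k. (y k, s)) \<longlonglongrightarrow> (x, s)" by (intro tendsto_Pair lim tendsto_const)
    moreover have "eventually (\<lambda>k. (y k, s) \<in> dom c) sequentially"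
      using ev by eventually_elim (use d in blast)
    ultimately have "(\<lambda>k. crd c (y k, s)) \<longlonglongrightarrow> crd c (x, s)"
      by (intro continuous_on_tendsto_compose[OF cont_crd[OF c(1)]] d x)
    then show ?thesis by (rule tendsto_snd)
  qed
  have "eventually (\<lambda>k. tr c (y k, t) = tr c (y k, t')) sequentially"
    using ev by eventually_elim (rule vertD[OF v _ \<delta> c t(1,2) order_refl])
  then have "(\<lambda>k. tr c (y k, t')) \<longlonglongrightarrow> tr c (x, t)"
    using lims[OF t(1,2)] tendsto_cong by fastforce
  moreover have "(\<lambda>k. tr c (y k, t')) \<longlonglongrightarrow> tr c (x, t')"
    by (rule lims) (use t in auto)
  ultimately show "tr c (x, t) = tr c (x, t')" by (rule LIMSEQ_unique)
qed

text \<open>The thresholds along a convergent sequence have a common bound, so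
  \<open>vert_closed\<close> applies although the thresholds vary.\<close>

lemma vert_closure:
  assumes x: "x \<in> W" "x \<in> closure V" and V: "\<And>v. v \<in> V \<Longrightarrow> \<exists>\<delta>. vert v \<delta>"
  shows "\<exists>\<delta>. vert x \<delta>"
proof -
  obtain y where y: "\<And>k. y k \<in> V" "y \<longlonglongrightarrow> x" using x(2) closure_sequential by metis
  have "\<forall>k. \<exists>\<delta>. vert (y k) \<delta>" using V y(1) by blast
  from choice[OF this] obtain d where d: "\<And>k. vert (y k) (d k)" by blast
  obtain \<delta> where \<delta>: "\<beta> < \<delta>" "\<And>k. d k < \<delta>"
    by (rule countable_bounded_lray_above[of "range d" \<beta>]) (auto intro: that)
  have "vert x \<delta>"
    by (rule vert_closed[OF vert_mono[OF d less_imp_le[OF \<delta>(2)]] y(2) x(1) less_imp_le[OF \<delta>(1)]])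
  then show ?thesis by blast
qed

end

section \<open>Ascending and descending vertical lines\<close>

lemma countable_dense_subset:
  fixes Q :: "'x::second_countable_topology set"
  obtains D where "countable D" "D \<subseteq> Q" "\<And>A. open A \<Longrightarrow> A \<inter> Q \<noteq> {} \<Longrightarrow> A \<inter> D \<noteq> {}"
proof -
  obtain B :: "'x set set" where B: "countable B" "topological_basis B"
    using ex_countable_basis by blast
  define f where "f b = (SOME y. y \<in> b \<inter> Q)" for b
  have f: "f b \<in> b \<inter> Q" if "b \<inter> Q \<noteq> {}" for b
  proof -
    have "\<exists>y. y \<in> b \<inter> Q" using that by blast
    then show ?thesis unfolding f_def by (rule someI_ex)
  qed
  define D where "D = f ` {b \<in> B. b \<inter> Q \<noteq> {}}"
  show ?thesis
  proof (rule that[of D])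
    show "countable D" unfolding D_def using B(1) by (intro countable_image) auto
    show "D \<subseteq> Q" unfolding D_def using f by blast
    fix A :: "'x set" assume A: "open A" "A \<inter> Q \<noteq> {}"
    then obtain y where y: "y \<in> A" "y \<in> Q" by blast
    obtain b where b: "b \<in> B" "y \<in> b" "b \<subseteq> A" using topological_basisE[OF B(2) A(1) y(1)] by blast
    then have "b \<inter> Q \<noteq> {}" using y(2) by blast
    then have "f b \<in> A \<inter> D" using f[of b] b unfolding D_def by blast
    then show "A \<inter> D \<noteq> {}" by blast
  qed
qed

context glass_family
begin

text \<open>The relation \<open>reach\<close> with the tube as an argument, so that different tubes,
  and both directions, can be compared.\<close>

definition rch where "rch W \<beta> p q \<longleftrightarrow> (\<exists>c\<in>\<B>. before c p q \<and> arc c p q \<subseteq> W \<times> {\<beta><..})"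

lemma openin_above: "openin (top_of_set M) {p \<in> M. a < snd p}"
proof -
  have "{p \<in> M. a < snd p} = M \<inter> UNIV \<times> {a<..}" by auto
  moreover have "open ((UNIV :: 'x set) \<times> {a<..})" by (intro open_Times) auto
  ultimately show ?thesis by (metis openin_open_Int)
qed

lemma openin_below: "openin (top_of_set M) {p \<in> M. snd p < a}"
proof -
  have "{p \<in> M. snd p < a} = M \<inter> UNIV \<times> {..<a}" by auto
  moreover have "open ((UNIV :: 'x set) \<times> {..<a})" by (intro open_Times) auto
  ultimately show ?thesis by (metis openin_open_Int)
qed

lemma before_flip: "before (flip c) p q \<longleftrightarrow> before c q p"
  by (auto simp: before_def)

lemma arc_flip:
  assumes "c \<in> \<B>" "before c p q"
  shows "arc (flip c) q p = arc c p q"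
proof -
  interpret R: glass_family m M "flip ` \<B>" S by (rule reverse_glass)
  show ?thesis
    using R.arc_iff[of "flip c" q p] arc_iff[OF assms] assms before_flip by blast
qed

lemma rch_flip: "glass_family.rch (flip ` \<B>) W \<beta> p q \<longleftrightarrow> rch W \<beta> q p"
proof -
  interpret R: glass_family m M "flip ` \<B>" S by (rule reverse_glass)
  show ?thesis
  proof
    assume "R.rch W \<beta> p q"
    then obtain c where c: "c \<in> \<B>" "before (flip c) p q" "arc (flip c) p q \<subseteq> W \<times> {\<beta><..}"
      unfolding R.rch_def by blast
    then have "before c q p" using before_flip by blast
    then show "rch W \<beta> q p" unfolding rch_def using c arc_flip[of c q p] by blast
  next
    assume "rch W \<beta> q p"
    then obtain c where c: "c \<in> \<B>" "before c q p" "arc c q p \<subseteq> W \<times> {\<beta><..}"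
      unfolding rch_def by blast
    then have "before (flip c) p q" using before_flip by blast
    then show "R.rch W \<beta> p q" unfolding R.rch_def using c arc_flip[of c q p] by blast
  qed
qed

lemma vert_flip: "glass_family.vert (flip ` \<B>) S x \<delta> \<longleftrightarrow> vert x \<delta>"
proof -
  interpret R: glass_family m M "flip ` \<B>" S by (rule reverse_glass)
  show ?thesis unfolding R.vert_def vert_def by simp
qed

end

context tube
begin

lemma reach_rch: "reach p q \<longleftrightarrow> rch W \<beta> p q"
  unfolding reach_def rch_def conn_def \<Omega>_def by blast

lemma reverse_tube: "tube m M (flip ` \<B>) S W \<beta>"
  unfolding tube_def tube_axioms_def
  using reverse_glass open_W beta charts by (metis flip_simps(1) imageI)

text \<open>Two levels of a vertical line have different heights on their common plaque. The
  descending case is the ascending one for the tube with reversed boxes.\<close>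

lemma vertical_rch:
  assumes x: "vert x \<delta>" "x \<in> W" "\<beta> \<le> \<delta>" and t: "\<delta> < t" "t < t'"
    and c: "c \<in> \<B>" "W \<times> {\<beta>..t'} \<subseteq> dom c"
  shows "ht c (x, t) < ht c (x, t') \<Longrightarrow> rch W \<beta> (x, t) (x, t')"
    "ht c (x, t') < ht c (x, t) \<Longrightarrow> rch W \<beta> (x, t') (x, t)"
    "ht c (x, t) \<noteq> ht c (x, t')"
proof -
  show "rch W \<beta> (x, t) (x, t')" if "ht c (x, t) < ht c (x, t')"
    using vertical_conn(1)[OF x t(1) less_imp_le[OF t(2)] order_refl c] that
    unfolding reach_rch[symmetric] reach_def by auto
  interpret R: tube m M "flip ` \<B>" S W \<beta> by (rule reverse_tube)
  show "rch W \<beta> (x, t') (x, t)" if "ht c (x, t') < ht c (x, t)"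
  proof -
    have "R.vert x \<delta>" using x(1) by (simp add: vert_flip)
    then have "R.conn (flip c) (x, t) (x, t')"
      by (rule R.vertical_conn(1)[OF _ x(2,3) t(1) less_imp_le[OF t(2)] order_refl])
        (use c that in auto)
    then have "R.rch W \<beta> (x, t) (x, t')" unfolding R.reach_rch[symmetric] R.reach_def by blast
    then show ?thesis by (simp add: rch_flip)
  qed
  show "ht c (x, t) \<noteq> ht c (x, t')"
  proof
    assume h: "ht c (x, t) = ht c (x, t')"
    have bt: "\<beta> \<le> t" "\<beta> \<le> t'" "t \<le> t'" using x(3) t by order+
    have "(x, t) \<in> dom c" "(x, t') \<in> dom c"
      by (rule chart_dom[OF c(2) x(2)]; use bt in order)+
    moreover have "tr c (x, t) = tr c (x, t')"
      by (rule vertD[OF x c t(1) bt(3) order_refl])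
    ultimately have "(x, t) = (x, t')" using crd_eqD[OF c(1)] h by blast
    then show False using t(2) by simp
  qed
qed

lemma rch_vertical_ht:
  assumes x: "vert x \<delta>" "x \<in> W" "\<beta> \<le> \<delta>" and t: "\<delta> < t" "t < t'"
    and c: "c \<in> \<B>" "W \<times> {\<beta>..t'} \<subseteq> dom c" and r: "rch W \<beta> (x, t) (x, t')"
  shows "ht c (x, t) < ht c (x, t')"
proof (rule ccontr)
  assume "\<not> ?thesis"
  then have "ht c (x, t') < ht c (x, t)" using vertical_rch(3)[OF x t c] by simp
  then have "rch W \<beta> (x, t') (x, t)" by (rule vertical_rch(2)[OF x t c])
  then have "(x, t) = (x, t')" using r reach_antisym unfolding reach_rch by blast
  then show False using t(2) by simp
qed

text \<open>Otherwise the point at level \<open>s'\<close> would come between those at levels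
  \<open>t\<close> and \<open>s\<close>, on an arc that does not rise above
  \<open>s\<close>.\<close>

lemma vertical_up_later:
  assumes x: "vert x \<delta>" "x \<in> W" "\<beta> \<le> \<delta>" and t: "\<delta> < t" "t < s" "s < s'" and r: "reach (x, t) (x, s)"
  shows "reach (x, s) (x, s')"
proof (rule ccontr)
  assume n: "\<not> reach (x, s) (x, s')"
  have ts: "t < s'" using t by order
  have r': "reach (x, t) (x, s')" by (rule vertical_up[OF x t(1,2) ts r])
  then have r2: "reach (x, s') (x, s)" using n reach_linear[OF r] by blast
  obtain c where c: "c \<in> \<B>" "W \<times> {\<beta>..s} \<subseteq> dom c" using charts by blast
  have "ht c (x, t) < ht c (x, s)"
    by (rule rch_vertical_ht[OF x t(1,2) c]) (use r reach_rch in blast)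
  then have v: "conn c (x, t) (x, s)" "arc c (x, t) (x, s) \<subseteq> {x} \<times> {t..s}"
    using vertical_conn[OF x t(1) less_imp_le[OF t(2)] order_refl c] by simp_all
  have "(x, s') \<in> arc c (x, t) (x, s)" using reach_between[OF v(1)] r' r2 by blast
  then have "s' \<le> s" using v(2) by auto
  with t(3) show False by simp
qed

text \<open>Leaves starting near \<open>x\<close> climb to any given level, but the neighbourhood
  may shrink as the level grows. A countable basis gives one neighbourhood \<open>Q\<close> over
  which all leaves climb through all levels, and these become vertical. Their final positions are
  dense in a neighbourhood of \<open>x\<close>, which is enough by
  \<open>vert_closure\<close>.\<close>

lemma vert_open_up:
  assumes x: "vert x \<delta>" "x \<in> W" "\<beta> \<le> \<delta>" and t: "\<delta> < t" "t < t1" and up: "reach (x, t) (x, t1)"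
  obtains N where "openin (top_of_set S) N" "x \<in> N" "\<And>y. y \<in> N \<Longrightarrow> \<exists>\<delta>. vert y \<delta>"
proof -
  obtain \<delta>0 where t0: "t < \<delta>0" using lray_no_max by blast
  have l0: "lzero < \<delta>0" "\<beta> < \<delta>0" using beta x(3) t(1) t0 by order+
  have up0: "reach (x, t) (x, s)" if "t < s" for s by (rule vertical_up[OF x t that up])
  have up1: "reach (x, \<delta>0) (x, s)" if "\<delta>0 < s" for s
    by (rule vertical_up_later[OF x t(1) t0 that up0[OF t0]])
  obtain B :: "'x set set" where B: "countable B" "topological_basis B"
    using ex_countable_basis by blast
  define good where "good b \<alpha> \<longleftrightarrow> (\<forall>y\<in>S \<inter> b. \<exists>q. reach (y, \<delta>0) q \<and> \<alpha> < snd q)" for b \<alpha>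
  have ex: "\<exists>b\<in>B. x \<in> b \<and> good b \<alpha>" for \<alpha>
  proof -
    obtain s where s: "\<alpha> < s" "\<delta>0 < s"
      by (rule countable_bounded_lray_above[of "{\<delta>0}" \<alpha>]) auto
    have sM: "(x, s) \<in> M" using reach_Omega[OF up1[OF s(2)]] open_Omega openin_imp_subset by blast
    obtain N where N: "openin (top_of_set M) N" "(x, \<delta>0) \<in> N"
      "\<And>p'. p' \<in> N \<Longrightarrow> \<exists>q'\<in>{p \<in> M. \<alpha> < snd p}. reach p' q'"
      by (rule reach_nbhd[OF up1[OF s(2)] openin_above[of \<alpha>]]) (use sM s(1) that in auto)
    obtain A where A: "open A" "{y \<in> S. (y, \<delta>0) \<in> N} = S \<inter> A"
      using openin_slice[OF N(1) l0(1)] by (auto simp: openin_open)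
    have "x \<in> A" using A(2) N(2) x(2) W_sub by blast
    then obtain b where b: "b \<in> B" "x \<in> b" "b \<subseteq> A" using topological_basisE[OF B(2) A(1)] by blast
    have "good b \<alpha>"
      unfolding good_def
    proof
      fix y assume "y \<in> S \<inter> b"
      then have "(y, \<delta>0) \<in> N" using A(2) b(3) by blast
      then show "\<exists>q. reach (y, \<delta>0) q \<and> \<alpha> < snd q" using N(3) by blast
    qed
    with b show ?thesis by blast
  qed
  \<comment> \<open>If each basic neighbourhood of \<open>x\<close> failed at some level, a common
    bound of these countably many levels would contradict \<open>ex\<close>.\<close>
  obtain b where b: "b \<in> B" "x \<in> b" "\<And>\<alpha>. good b \<alpha>"
  proof (rule ccontr)
    assume "\<not> thesis"
    then have "\<forall>b. \<exists>\<alpha>. b \<in> B \<longrightarrow> x \<in> b \<longrightarrow> \<not> good b \<alpha>" using that by blast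
    from choice[OF this] obtain f where f: "\<And>b. b \<in> B \<Longrightarrow> x \<in> b \<Longrightarrow> \<not> good b (f b)" by blast
    obtain \<alpha> where \<alpha>: "\<And>b. b \<in> B \<Longrightarrow> f b < \<alpha>"
    proof -
      obtain m where "\<And>x. x \<in> f ` B \<Longrightarrow> x < m"
        by (rule countable_bounded_lray_above[of "f ` B" lzero]) (use B(1) in auto)
      then show thesis using \<open>\<And>\<alpha>. (\<And>b. b \<in> B \<Longrightarrow> f b < \<alpha>) \<Longrightarrow> thesis\<close> by blast
    qed
    obtain b where b: "b \<in> B" "x \<in> b" "good b \<alpha>" using ex by blast
    have "good b (f b)" unfolding good_def
    proof
      fix y assume "y \<in> S \<inter> b"
      then obtain q where "reach (y, \<delta>0) q" "\<alpha> < snd q" using b(3) unfolding good_def by blast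
      then show "\<exists>q. reach (y, \<delta>0) q \<and> f b < snd q" using \<alpha>[OF b(1)] less_trans by blast
    qed
    then show False using f[OF b(1,2)] by blast
  qed
  define Q where "Q = S \<inter> b"
  have openQ: "openin (top_of_set S) Q"
    unfolding Q_def using topological_basis_open[OF B(2) b(1)] by (rule openin_open_Int)
  have long: "long (y, \<delta>0)" "(y, \<delta>0) \<in> \<Omega>" if "y \<in> Q" for y
  proof -
    show "long (y, \<delta>0)" unfolding long_def using b(3) that unfolding good_def Q_def by blast
    have "\<exists>q. reach (y, \<delta>0) q \<and> lzero < snd q" using b(3)[of lzero] that unfolding good_def Q_def by simp
    then obtain q where "reach (y, \<delta>0) q" by blast
    then show "(y, \<delta>0) \<in> \<Omega>" using reach_Omega by blast
  qed
  obtain D where D: "countable D" "D \<subseteq> Q" "\<And>A. open A \<Longrightarrow> A \<inter> Q \<noteq> {} \<Longrightarrow> A \<inter> D \<noteq> {}"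
    by (rule countable_dense_subset[of Q]) (rule that)
  have "\<exists>xd. vert (fst xd) (snd xd) \<and> (\<forall>z. reach (y, \<delta>0) z \<longrightarrow> snd xd < snd z \<longrightarrow> fst z = fst xd)"
    if yQ: "y \<in> Q" for y
  proof -
    obtain x' d where "vert x' d" "\<And>z. reach (y, \<delta>0) z \<Longrightarrow> d < snd z \<Longrightarrow> fst z = x'"
      using long_vertical[OF long(2)[OF yQ] long(1)[OF yQ]] by metis
    then show ?thesis by (intro exI[of _ "(x', d)"]) simp
  qed
  then obtain xd where xd: "\<And>y. y \<in> Q \<Longrightarrow> vert (fst (xd y)) (snd (xd y))"
    "\<And>y z. y \<in> Q \<Longrightarrow> reach (y, \<delta>0) z \<Longrightarrow> snd (xd y) < snd z \<Longrightarrow> fst z = fst (xd y)"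
    by metis
  \<comment> \<open>Beyond this level the leaves that start over the dense set \<open>D\<close> have
    reached their final positions. Over all of \<open>Q\<close> there might be no common
    threshold.\<close>
  obtain \<delta>1 where \<delta>1: "\<delta>0 < \<delta>1" "\<And>y. y \<in> D \<Longrightarrow> snd (xd y) < \<delta>1"
    by (rule countable_bounded_lray_above[of "(\<lambda>y. snd (xd y)) ` D" \<delta>0]) (use D(1) that in auto)
  obtain a where a: "\<delta>1 < a" using lray_no_max by blast
  have ta: "t < a" "lzero < a" using t0 \<delta>1(1) a l0 by order+
  obtain c where c: "c \<in> \<B>" "W \<times> {\<beta>..a} \<subseteq> dom c" using charts by blast
  have ht: "ht c (x, t) < ht c (x, a)"
    by (rule rch_vertical_ht[OF x t(1) ta(1) c]) (use up0[OF ta(1)] reach_rch in blast)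
  then have v: "conn c (x, t) (x, a)" "arc c (x, t) (x, a) \<subseteq> {x} \<times> {t..a}"
    using vertical_conn[OF x t(1) less_imp_le[OF ta(1)] order_refl c] by simp_all
  have vb: "before c (x, t) (x, a)" using v(1) by (simp add: conn_def)
  \<comment> \<open>The height gained from level \<open>t\<close> to level \<open>a\<close> over
    \<open>x\<close>. Going back by \<open>w\<close> from points near \<open>(x, a)\<close> leads
    below level \<open>\<delta>0\<close> without leaving the part of the tube over
    \<open>Q\<close>.\<close>
  define w where "w = ht c (x, a) - ht c (x, t)"
  have w0: "0 \<le> w" using ht by (simp add: w_def)
  have trx: "tr c (x, a) = tr c (x, t)" using vb by (simp add: before_def)
  define Y where "Y = (W \<inter> Q) \<times> {\<beta><..}"
  have openY: "openin (top_of_set M) Y"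
    unfolding Y_def by (intro openin_product openin_Int open_W openQ) (use beta in auto)
  have xad: "(x, a) \<in> dom c" using vb by (simp add: before_def)
  obtain N1 where N1: "openin (top_of_set M) N1" "(x, a) \<in> N1" "N1 \<subseteq> dom c"
    "\<And>q s. q \<in> N1 \<Longrightarrow> s \<in> {- w..0} \<Longrightarrow> (ht c q + s, tr c q) \<in> fcube m \<and> pt c (ht c q + s, tr c q) \<in> Y"
  proof (rule param_nbhd[OF c(1) xad, of "{- w..0}" Y])
    show "compact {- w..0}" by simp
    fix s assume "s \<in> {- w..0}"
    then have s: "ht c (x, a) + s \<in> {ht c (x, t)..ht c (x, a)}" by (auto simp: w_def)
    have "pt c (ht c (x, a) + s, tr c (x, t)) \<in> arc c (x, t) (x, a)"
      unfolding arc_param using s by blast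
    then have inx: "pt c (ht c (x, a) + s, tr c (x, t)) \<in> {x} \<times> {t..a}" using v(2) by blast
    have "{x} \<times> {t..a} \<subseteq> Y"
    proof
      fix z assume "z \<in> {x} \<times> {t..a}"
      then obtain s where z: "z = (x, s)" "t \<le> s" by auto
      have "\<beta> < s" using z(2) t(1) x(3) by order
      then show "z \<in> Y" using z(1) x(2) W_sub b(2) by (auto simp: Y_def Q_def)
    qed
    from subsetD[OF this inx] show "(ht c (x, a) + s, tr c (x, a)) \<in> fcube m \<and> pt c (ht c (x, a) + s, tr c (x, a)) \<in> Y"
      unfolding trx using before_fcube[OF c(1) vb s] by blast
  qed (rule openY, rule that)
  obtain N2 where N2: "openin (top_of_set M) N2" "(x, a) \<in> N2"
    "\<And>q s. q \<in> N2 \<Longrightarrow> s \<in> {- w} \<Longrightarrow> (ht c q + s, tr c q) \<in> fcube m \<and> pt c (ht c q + s, tr c q) \<in> {p \<in> M. snd p < \<delta>0}"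
  proof (rule param_nbhd[OF c(1) xad, of "{- w}" "{p \<in> M. snd p < \<delta>0}"])
    show "compact {- w}" by simp
    fix s assume "s \<in> {- w}"
    then have s: "ht c (x, a) + s = ht c (x, t)" by (simp add: w_def)
    have "(x, t) \<in> M" using reach_Omega[OF up] open_Omega openin_imp_subset by blast
    then show "(ht c (x, a) + s, tr c (x, a)) \<in> fcube m \<and> pt c (ht c (x, a) + s, tr c (x, a)) \<in> {p \<in> M. snd p < \<delta>0}"
      unfolding trx s using before_pt(1)[OF c(1) vb] before_fcube[OF c(1) vb, of "ht c (x, t)"] ht t0 by simp
  qed (rule openin_below, rule that)
  define N3 where "N3 = N1 \<inter> N2 \<inter> {p \<in> M. \<delta>1 < snd p}"
  have N3: "openin (top_of_set M) N3" unfolding N3_def by (intro openin_Int N1 N2 openin_above)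
  \<comment> \<open>Followed backwards from \<open>(y, a)\<close>, the leaf meets level
    \<open>\<delta>0\<close> at a point \<open>r\<close> over \<open>Q\<close>. Leaves starting over
    points of \<open>D\<close> near \<open>r\<close> pass near \<open>(y, a)\<close> and above
    \<open>\<delta>1\<close>, that is, on their final vertical line; so \<open>y\<close> is a limit
    of vertical positions.\<close>
  have main: "y \<in> W \<and> y \<in> closure {v. \<exists>\<delta>. vert v \<delta>}" if y: "y \<in> S" "(y, a) \<in> N3" for y
  proof -
    define z where "z = (y, a)"
    define p' where "p' = pt c (ht c z - w, tr c z)"
    have z: "z \<in> N1" "z \<in> N2" "z \<in> dom c" using y(2) N1(3) by (auto simp: z_def N3_def)
    have f: "(ht c z - w, tr c z) \<in> fcube m" "snd p' < \<delta>0"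
      using N2(3)[OF z(2), of "- w"] by (simp_all add: p'_def)
    have cr: "p' \<in> dom c" "crd c p' = (ht c z - w, tr c z)"
      unfolding p'_def using pt_in[OF c(1) f(1)] crd_pt[OF c(1) f(1)] by blast+
    have bz: "before c p' z" using cr z(3) w0 by (simp add: before_def)
    have arcY: "arc c p' z \<subseteq> Y"
    proof
      fix r assume "r \<in> arc c p' z"
      then obtain s where "ht c z - w \<le> s" "s \<le> ht c z" "r = pt c (s, tr c z)"
        unfolding arc_param using cr(2) by auto
      then show "r \<in> Y" using N1(4)[OF z(1), of "s - ht c z"] by simp
    qed
    then have cz: "conn c p' z" using bz c(1) by (auto simp: conn_def \<Omega>_def Y_def)
    have "z \<in> arc c p' z" using conn_ends[OF cz] by blast
    then have yW: "y \<in> W" using arcY by (auto simp: z_def Y_def)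
    have za: "\<delta>0 \<le> snd z" unfolding z_def using \<delta>1(1) a by simp
    obtain r where r: "r \<in> arc c p' z" "snd r = \<delta>0"
      by (rule arc_level[OF cz less_imp_le[OF f(2)] za]) (rule that)
    have rz: "reach r z" using reach_between[OF cz] r(1) by blast
    have rQ: "fst r \<in> Q" "r = (fst r, \<delta>0)" using arcY r by (auto simp: Y_def)
    have "A \<inter> {v. \<exists>\<delta>. vert v \<delta>} \<noteq> {}" if A: "open A" "y \<in> A" for A
    proof -
      define P where "P = {p \<in> M. \<delta>1 < snd p} \<inter> (M \<inter> A \<times> UNIV)"
      have "openin (top_of_set M) P"
        unfolding P_def by (intro openin_Int openin_above openin_open_Int open_Times A open_UNIV)
      moreover have "z \<in> P" using y(2) A(2) by (auto simp: P_def N3_def z_def)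
      ultimately obtain Nr where Nr: "openin (top_of_set M) Nr" "r \<in> Nr" "\<And>p'. p' \<in> Nr \<Longrightarrow> \<exists>q'\<in>P. reach p' q'"
        by (rule reach_nbhd[OF rz]) (rule that)
      obtain A' where A': "open A'" "{y \<in> S. (y, \<delta>0) \<in> Nr} = S \<inter> A'"
        using openin_slice[OF Nr(1) l0(1)] by (auto simp: openin_open)
      have QS: "Q \<subseteq> S" by (simp add: Q_def)
      have "(fst r, \<delta>0) \<in> Nr" using Nr(2) rQ(2) by simp
      then have "fst r \<in> A' \<inter> Q" using A'(2) rQ(1) QS by blast
      then obtain d where d: "d \<in> A'" "d \<in> D" using D(3)[OF A'(1)] by blast
      have dQ: "d \<in> Q" using d(2) D(2) by blast
      then have "(d, \<delta>0) \<in> Nr" using A'(2) d(1) QS by blast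
      then obtain z' where z': "z' \<in> P" "reach (d, \<delta>0) z'" using Nr(3) by blast
      have "snd (xd d) < snd z'" using \<delta>1(2)[OF d(2)] z'(1) unfolding P_def by auto
      then have "fst z' = fst (xd d)" by (rule xd(2)[OF dQ z'(2)])
      moreover have "fst z' \<in> A" using z'(1) unfolding P_def by auto
      ultimately show ?thesis using xd(1)[OF dQ] by auto
    qed
    then have "y \<in> closure {v. \<exists>\<delta>. vert v \<delta>}"
      unfolding closure_iff_nhds_not_empty by blast
    with yW show ?thesis by blast
  qed
  show ?thesis
  proof (rule that[of "{y \<in> S. (y, a) \<in> N3}"])
    show "openin (top_of_set S) {y \<in> S. (y, a) \<in> N3}" by (rule openin_slice[OF N3 ta(2)])
    have "(x, a) \<in> M" using dom_subset[OF c(1)] xad by blast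
    then show "x \<in> {y \<in> S. (y, a) \<in> N3}" using N1(2) N2(2) a x(2) W_sub by (auto simp: N3_def)
    show "\<exists>\<delta>. vert y \<delta>" if "y \<in> {y \<in> S. (y, a) \<in> N3}" for y
      using main[of y] that vert_closure[of y "{v. \<exists>\<delta>. vert v \<delta>}"] by blast
  qed
qed

text \<open>A descending line becomes ascending in the reversed tube, where \<open>vert\<close> has
  the same meaning.\<close>

lemma vert_open:
  assumes "vert x \<delta>" "x \<in> W"
  obtains N where "openin (top_of_set S) N" "x \<in> N" "\<And>y. y \<in> N \<Longrightarrow> \<exists>\<delta>. vert y \<delta>"
proof -
  define d where "d = max \<delta> \<beta>"
  have d: "vert x d" "\<beta> \<le> d" using vert_mono[OF assms(1)] by (auto simp: d_def)
  obtain t t1 where t: "d < t" "t < t1" using lray_no_max by metis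
  obtain c where c: "c \<in> \<B>" "W \<times> {\<beta>..t1} \<subseteq> dom c" using charts by blast
  show ?thesis
  proof (cases "ht c (x, t) < ht c (x, t1)")
    case True
    then have "reach (x, t) (x, t1)" unfolding reach_rch by (rule vertical_rch(1)[OF d(1) assms(2) d(2) t c])
    then show ?thesis by (rule vert_open_up[OF d(1) assms(2) d(2) t]) (rule that)
  next
    case False
    then have "ht c (x, t1) < ht c (x, t)" using vertical_rch(3)[OF d(1) assms(2) d(2) t c] by simp
    then have r: "rch W \<beta> (x, t1) (x, t)" by (rule vertical_rch(2)[OF d(1) assms(2) d(2) t c])
    interpret R: tube m M "flip ` \<B>" S W \<beta> by (rule reverse_tube)
    have v: "R.vert x d" using d(1) by (simp add: vert_flip)
    have "R.reach (x, t) (x, t1)" unfolding R.reach_rch using r by (simp add: rch_flip)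
    then obtain N where N: "openin (top_of_set S) N" "x \<in> N" "\<And>y. y \<in> N \<Longrightarrow> \<exists>\<delta>. R.vert y \<delta>"
      by (rule R.vert_open_up[OF v assms(2) d(2) t]) (rule that)
    show ?thesis by (rule that[OF N(1,2)]) (use N(3) in \<open>simp add: vert_flip\<close>)
  qed
qed

end

section \<open>From rising segments to vertical lines and the contradiction\<close>

context glass_family
begin

text \<open>Subfamilies are allowed because the leaf segment has to lie in a box that respects a
  prescribed finer covering.\<close>

definition rising :: bool where
  "rising \<longleftrightarrow> (\<forall>\<alpha> \<Q>. lzero < \<alpha> \<longrightarrow> \<Q> \<subseteq> \<B> \<longrightarrow> (\<forall>p\<in>M. \<exists>c\<in>\<Q>. p \<in> dom c \<and> crd c p = (0, \<lambda>_. 0)) \<longrightarrow>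
     (\<exists>x\<in>S. \<exists>t>\<alpha>. \<exists>c\<in>\<Q>. before c (x, \<alpha>) (x, t)))"

lemma rising_tube:
  assumes rising and S: "S = \<Union>\<W>" and W: "\<And>W. W \<in> \<W> \<Longrightarrow> openin (top_of_set S) W"
    and \<beta>: "lzero < \<beta>" "\<beta> < \<alpha>"
  obtains W x t where "W \<in> \<W>" "x \<in> W" "\<alpha> < t" "rch W \<beta> (x, \<alpha>) (x, t)"
proof -
  \<comment> \<open>Boxes of the first kind avoid level \<open>\<alpha>\<close>, where the rising
    segment starts; it therefore lies in a box of the second kind, inside a single tube.\<close>
  define \<Q> where "\<Q> = {c \<in> \<B>. dom c \<subseteq> {p \<in> M. snd p < \<alpha>} \<or> (\<exists>W\<in>\<W>. dom c \<subseteq> W \<times> {\<beta><..})}"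
  have "\<exists>c\<in>\<Q>. p \<in> dom c \<and> crd c p = (0, \<lambda>_. 0)" if p: "p \<in> M" for p
  proof (cases "snd p < \<alpha>")
    case True
    then have "p \<in> {p \<in> M. snd p < \<alpha>}" using p by simp
    from small[OF p openin_below this] show ?thesis unfolding \<Q>_def by blast
  next
    case False
    then have "\<beta> < snd p" using \<beta>(2) by simp
    then have "lzero < snd p" using \<beta>(1) by simp
    then have "fst p \<in> S" using upper[of "snd p" "fst p"] p by simp
    then obtain W' where W': "W' \<in> \<W>" "fst p \<in> W'" using S by blast
    have o: "openin (top_of_set M) (W' \<times> {\<beta><..})"
      by (rule openin_product[OF W[OF W'(1)]]) (use \<beta>(1) in auto)
    have "p \<in> W' \<times> {\<beta><..}" using W'(2) \<open>\<beta> < snd p\<close> by (simp add: mem_Times_iff)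
    from small[OF p o this] show ?thesis using W'(1) unfolding \<Q>_def by blast
  qed
  moreover have "\<Q> \<subseteq> \<B>" "lzero < \<alpha>" using \<beta> unfolding \<Q>_def by auto
  ultimately obtain x t c where x: "\<alpha> < t" "c \<in> \<Q>" "before c (x, \<alpha>) (x, t)"
    using \<open>rising\<close> unfolding rising_def by blast
  have c: "c \<in> \<B>" "(x, \<alpha>) \<in> dom c" using x unfolding \<Q>_def before_def by blast+
  have "\<not> dom c \<subseteq> {p \<in> M. snd p < \<alpha>}"
  proof
    assume "dom c \<subseteq> {p \<in> M. snd p < \<alpha>}"
    then have "(x, \<alpha>) \<in> {p \<in> M. snd p < \<alpha>}" using c(2) by blast
    then show False by simp
  qed
  then obtain W' where W': "W' \<in> \<W>" "dom c \<subseteq> W' \<times> {\<beta><..}" using x(2) unfolding \<Q>_def by blast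
  have "arc c (x, \<alpha>) (x, t) \<subseteq> dom c"
    using arc_iff[OF c(1) x(3)] unfolding before_def by blast
  then have "rch W' \<beta> (x, \<alpha>) (x, t)" unfolding rch_def using c(1) x(3) W'(2) by blast
  moreover have "x \<in> W'" using c(2) W'(2) by blast
  ultimately show ?thesis using that W'(1) x(1) by blast
qed

text \<open>By the pigeonhole principle, some point lies on a leaf climbing through all levels.\<close>

lemma rising_vert:
  assumes r: rising and \<W>: "finite \<W>" "S = \<Union>\<W>" "\<And>W. W \<in> \<W> \<Longrightarrow> openin (top_of_set S) W"
    and \<beta>: "lzero < \<beta>" and ch: "\<And>W \<alpha>. W \<in> \<W> \<Longrightarrow> \<exists>c\<in>\<B>. W \<times> {\<beta>..\<alpha>} \<subseteq> dom c"
  shows "\<exists>x \<delta>. vert x \<delta>"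
proof -
  have tube: "tube m M \<B> S W \<beta>" if "W \<in> \<W>" for W
    using \<W>(3)[OF that] \<beta> ch[OF that] by unfold_locales
  obtain B :: "'x set set" where B: "countable B" "topological_basis B"
    using ex_countable_basis by blast
  define P where "P i \<beta>' \<alpha> \<longleftrightarrow> S \<inter> snd i \<noteq> {} \<and> (\<forall>y\<in>S \<inter> snd i. \<exists>q. rch (fst i) \<beta> (y, \<beta>') q \<and> \<alpha> < snd q)"
    for i \<beta>' \<alpha>
  have "countable (\<W> \<times> B)" by (intro countable_SIGMA countable_finite[OF \<W>(1)] B(1))
  then have "\<exists>i\<in>\<W> \<times> B. \<exists>b\<ge>\<beta>. \<forall>\<gamma>. \<exists>\<alpha>>\<gamma>. b < \<alpha> \<and> P i b \<alpha>"
  proof (rule press_down)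
    fix l assume l: "\<beta> < l"
    obtain W x t where W: "W \<in> \<W>" "x \<in> W" "l < t" "rch W \<beta> (x, l) (x, t)"
      by (rule rising_tube[OF r \<W>(2,3) \<beta> l]) (assumption | rule that)+
    interpret T: tube m M \<B> S W \<beta> by (rule tube[OF W(1)])
    have re: "T.reach (x, l) (x, t)" using W(4) T.reach_rch by blast
    have "(x, t) \<in> M" using T.reach_Omega[OF re] T.open_Omega openin_imp_subset by blast
    then have "(x, t) \<in> {p \<in> M. l < snd p}" using W(3) by simp
    then obtain N where N: "openin (top_of_set M) N" "(x, l) \<in> N"
      "\<And>p'. p' \<in> N \<Longrightarrow> \<exists>q'\<in>{p \<in> M. l < snd p}. T.reach p' q'"
      by (rule T.reach_nbhd[OF re openin_above]) (rule that)
    have "lzero < l" using \<beta> l by simp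
    then obtain A a where A: "open A" "x \<in> A" "a < l" "(S \<inter> A) \<times> {a..l} \<subseteq> N"
      by (rule product_nbhd[OF N(1,2)]) (rule that)
    obtain b where b: "b \<in> B" "x \<in> b" "b \<subseteq> A" using topological_basisE[OF B(2) A(1,2)] by blast
    \<comment> \<open>The rising segment at level \<open>l\<close> persists for nearby starting
      points, including those at slightly lower levels; this is the hypothesis needed to press
      down.\<close>
    have "P (W, b) \<beta>' l" if \<beta>': "a \<le> \<beta>'" "\<beta>' < l" for \<beta>'
    proof -
      have "\<exists>q. rch W \<beta> (y, \<beta>') q \<and> l < snd q" if "y \<in> S \<inter> b" for y
      proof -
        have "(y, \<beta>') \<in> (S \<inter> A) \<times> {a..l}" using that \<beta>' b(3) by auto
        then have "(y, \<beta>') \<in> N" using A(4) by blast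
        then show ?thesis using N(3) T.reach_rch by blast
      qed
      moreover have "x \<in> S \<inter> b" using b(2) W(2) T.W_sub by blast
      ultimately show ?thesis unfolding P_def fst_conv snd_conv by blast
    qed
    then show "\<exists>i\<in>\<W> \<times> B. \<exists>\<beta><l. \<forall>\<beta>'. \<beta> \<le> \<beta>' \<and> \<beta>' < l \<longrightarrow> P i \<beta>' l"
      using W(1) b(1) A(3) by blast
  qed
  then obtain i b' where i: "i \<in> \<W> \<times> B" "\<And>\<gamma>. \<exists>\<alpha>>\<gamma>. P i b' \<alpha>" by blast
  obtain W b where ib: "i = (W, b)" by (cases i)
  have W: "W \<in> \<W>" and P: "\<And>\<gamma>. \<exists>\<alpha>>\<gamma>. P (W, b) b' \<alpha>" using i unfolding ib by blast+
  interpret T: tube m M \<B> S W \<beta> by (rule tube[OF W])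
  have "S \<inter> b \<noteq> {}" using P[of lzero] unfolding P_def by auto
  then obtain y where y: "y \<in> S \<inter> b" by blast
  have ex: "\<exists>q. T.reach (y, b') q \<and> \<gamma> < snd q" for \<gamma>
  proof -
    obtain \<alpha> where \<alpha>: "\<gamma> < \<alpha>" "P (W, b) b' \<alpha>" using P by blast
    then obtain q where "rch W \<beta> (y, b') q" "\<alpha> < snd q" using y unfolding P_def fst_conv snd_conv by blast
    then show ?thesis using \<alpha>(1) T.reach_rch by (meson less_trans)
  qed
  then have "T.long (y, b')" unfolding T.long_def by blast
  moreover have "(y, b') \<in> T.\<Omega>" using ex[of lzero] T.reach_Omega by blast
  ultimately obtain x \<delta> where "vert x \<delta>" using T.long_vertical by metis
  then show ?thesis by blast
qed

text \<open>The points of the sphere with an eventually vertical line form a nonempty clopen set, hence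
  the whole sphere. Those with an ascending and those with a descending line partition it into
  two nonempty open sets.\<close>

lemma rising_falling_False:
  assumes r: rising and f: "glass_family.rising M (flip ` \<B>) S"
  shows False
proof -
  obtain \<W> \<beta> where \<W>: "finite \<W>" "lzero < \<beta>" "S = \<Union>\<W>" "\<And>W. W \<in> \<W> \<Longrightarrow> openin (top_of_set S) W"
    and ch: "\<And>W \<alpha>. W \<in> \<W> \<Longrightarrow> \<exists>c\<in>\<B>. W \<times> {\<beta>..\<alpha>} \<subseteq> dom c"
    by (rule long_charts) (rule that)
  have tube: "tube m M \<B> S W \<beta>" if "W \<in> \<W>" for W
    using \<W>(4)[OF that] \<W>(2) ch[OF that] by unfold_locales
  define V where "V = {x. \<exists>\<delta>. vert x \<delta>}"
  have VS: "V \<subseteq> S" unfolding V_def vert_def by blast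
  have "openin (top_of_set S) V"
  proof (subst openin_subopen, intro ballI)
    fix x assume x: "x \<in> V"
    then obtain W where W: "W \<in> \<W>" "x \<in> W" using VS \<W>(3) by blast
    interpret T: tube m M \<B> S W \<beta> by (rule tube[OF W(1)])
    obtain \<delta> where "vert x \<delta>" using x V_def by blast
    then obtain N where N: "openin (top_of_set S) N" "x \<in> N" "\<And>y. y \<in> N \<Longrightarrow> \<exists>\<delta>. vert y \<delta>"
      by (rule T.vert_open[OF _ W(2)]) (rule that)
    then show "\<exists>T. openin (top_of_set S) T \<and> x \<in> T \<and> T \<subseteq> V" unfolding V_def by blast
  qed
  moreover have "closedin (top_of_set S) V"
  proof -
    have "S \<inter> closure V \<subseteq> V"
    proof
      fix x assume x: "x \<in> S \<inter> closure V"
      then obtain W where W: "W \<in> \<W>" "x \<in> W" using \<W>(3) by blast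
      interpret T: tube m M \<B> S W \<beta> by (rule tube[OF W(1)])
      have "\<exists>\<delta>. vert x \<delta>" by (rule T.vert_closure[OF W(2), of V]) (use x in \<open>auto simp: V_def\<close>)
      then show "x \<in> V" unfolding V_def by blast
    qed
    then have "V = S \<inter> closure V" using VS closure_subset by blast
    then show ?thesis by (metis closed_closure closedin_closed_Int)
  qed
  moreover have "V \<noteq> {}"
    using rising_vert[OF r \<W>(1,3,4,2) ch] unfolding V_def by blast
  ultimately have V: "V = S"
    using connected_S unfolding connected_clopen by blast
  \<comment> \<open>The thresholds of a countable dense set have a common bound, and by
    \<open>vert_closed\<close> this bound serves all of \<open>S\<close>.\<close>
  obtain D where D: "countable D" "D \<subseteq> S" "\<And>A. open A \<Longrightarrow> A \<inter> S \<noteq> {} \<Longrightarrow> A \<inter> D \<noteq> {}"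
    by (rule countable_dense_subset[of S]) (rule that)
  have "\<forall>x. \<exists>\<delta>. x \<in> S \<longrightarrow> vert x \<delta>" using V unfolding V_def by blast
  from choice[OF this] obtain dl where dl: "\<And>x. x \<in> S \<Longrightarrow> vert x (dl x)" by blast
  obtain \<delta> where \<delta>: "\<beta> < \<delta>" "\<And>x. x \<in> dl ` D \<Longrightarrow> x < \<delta>"
    by (rule countable_bounded_lray_above[of "dl ` D" \<beta>]) (use D(1) in simp, rule that)
  have \<beta>\<delta>: "\<beta> \<le> \<delta>" using \<delta>(1) by simp
  have vert: "vert x \<delta>" if x: "x \<in> S" for x
  proof -
    obtain W where W: "W \<in> \<W>" "x \<in> W" using \<W>(3) x by blast
    interpret T: tube m M \<B> S W \<beta> by (rule tube[OF W(1)])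
    have "x \<in> closure D" unfolding closure_iff_nhds_not_empty using D(3) x by blast
    then obtain y where y: "\<And>k. y k \<in> D" "y \<longlonglongrightarrow> x" using closure_sequential by metis
    have "vert (y k) \<delta>" for k
    proof (rule vert_mono)
      show "vert (y k) (dl (y k))" using dl D(2) y(1) by blast
      show "dl (y k) \<le> \<delta>" using \<delta>(2)[of "dl (y k)"] y(1) by (simp add: less_imp_le)
    qed
    then show ?thesis by (rule T.vert_closed[OF _ y(2) W(2) \<beta>\<delta>])
  qed
  \<comment> \<open>Two fixed levels beyond the common threshold suffice: a vertical line is
    ascending or descending according to the order of its points at these levels.\<close>
  obtain t t1 where t: "\<delta> < t" "t < t1" using lray_no_max by metis
  define Up where "Up = {x. \<exists>W\<in>\<W>. x \<in> W \<and> rch W \<beta> (x, t) (x, t1)}"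
  define Dn where "Dn = {x. \<exists>W\<in>\<W>. x \<in> W \<and> rch W \<beta> (x, t1) (x, t)}"
  define Cf where "Cf W = (SOME c. c \<in> \<B> \<and> W \<times> {\<beta>..t1} \<subseteq> dom c)" for W
  have Cf: "Cf W \<in> \<B>" "W \<times> {\<beta>..t1} \<subseteq> dom (Cf W)" if "W \<in> \<W>" for W
  proof -
    have "\<exists>c. c \<in> \<B> \<and> W \<times> {\<beta>..t1} \<subseteq> dom c" using ch[OF that] by blast
    then have "Cf W \<in> \<B> \<and> W \<times> {\<beta>..t1} \<subseteq> dom (Cf W)" unfolding Cf_def by (rule someI_ex)
    then show "Cf W \<in> \<B>" "W \<times> {\<beta>..t1} \<subseteq> dom (Cf W)" by blast+
  qed
  have WS: "W \<subseteq> S" if "W \<in> \<W>" for W using \<W>(3) that by blast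
  have iff: "rch W \<beta> (x, t) (x, t1) \<longleftrightarrow> ht (Cf W) (x, t) < ht (Cf W) (x, t1)"
    "rch W \<beta> (x, t1) (x, t) \<longleftrightarrow> ht (Cf W) (x, t1) < ht (Cf W) (x, t)"
    "ht (Cf W) (x, t) \<noteq> ht (Cf W) (x, t1)"
    if W: "W \<in> \<W>" "x \<in> W" for W x
  proof -
    interpret T: tube m M \<B> S W \<beta> by (rule tube[OF W(1)])
    have v: "vert x \<delta>" using vert WS W by blast
    note vr = T.vertical_rch[OF v W(2) \<beta>\<delta> t Cf[OF W(1)]]
    have "\<not> (rch W \<beta> (x, t) (x, t1) \<and> rch W \<beta> (x, t1) (x, t))"
      using T.reach_antisym t(2) unfolding T.reach_rch[symmetric] by blast
    then show "rch W \<beta> (x, t) (x, t1) \<longleftrightarrow> ht (Cf W) (x, t) < ht (Cf W) (x, t1)"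
      "rch W \<beta> (x, t1) (x, t) \<longleftrightarrow> ht (Cf W) (x, t1) < ht (Cf W) (x, t)"
      using vr by (meson linorder_neqE)+
    show "ht (Cf W) (x, t) \<noteq> ht (Cf W) (x, t1)" by (rule vr(3))
  qed
  have bt: "\<beta> \<le> t" "t \<le> t1" "\<beta> \<le> t1" using t \<beta>\<delta> by order+
  have cont: "continuous_on W (\<lambda>x. ht (Cf W) (x, s))" if W: "W \<in> \<W>" and s: "\<beta> \<le> s" "s \<le> t1" for W s
  proof -
    have pc: "continuous_on W (\<lambda>x. (x, s))" by (intro continuous_intros)
    have "(\<lambda>x. (x, s)) ` W \<subseteq> dom (Cf W)" using Cf(2)[OF W] s by auto
    from continuous_on_compose2[OF cont_crd[OF Cf(1)[OF W]] pc this]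
    show ?thesis by (rule continuous_on_fst)
  qed
  have openlt: "openin (top_of_set S) {x \<in> W. f x < g x}"
    if "W \<in> \<W>" "continuous_on W f" "continuous_on W g" for W and f g :: "'x \<Rightarrow> real"
  proof -
    have "openin (top_of_set W) (W \<inter> (\<lambda>x. g x - f x) -` {0<..})"
      by (rule continuous_openin_preimage_gen) (intro continuous_on_diff that, simp)
    moreover have "W \<inter> (\<lambda>x. g x - f x) -` {0<..} = {x \<in> W. f x < g x}" by auto
    ultimately show ?thesis using openin_trans \<W>(4)[OF that(1)] by metis
  qed
  have "Up = (\<Union>W\<in>\<W>. {x \<in> W. ht (Cf W) (x, t) < ht (Cf W) (x, t1)})"
    unfolding Up_def using iff(1) by blast
  moreover have "openin (top_of_set S) (\<Union>W\<in>\<W>. {x \<in> W. ht (Cf W) (x, t) < ht (Cf W) (x, t1)})"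
    by (rule openin_Union) (use openlt cont bt in auto)
  ultimately have opUp: "openin (top_of_set S) Up" by simp
  have "Dn = (\<Union>W\<in>\<W>. {x \<in> W. ht (Cf W) (x, t1) < ht (Cf W) (x, t)})"
    unfolding Dn_def using iff(2) by blast
  moreover have "openin (top_of_set S) (\<Union>W\<in>\<W>. {x \<in> W. ht (Cf W) (x, t1) < ht (Cf W) (x, t)})"
    by (rule openin_Union) (use openlt cont bt in auto)
  ultimately have opDn: "openin (top_of_set S) Dn" by simp
  have cover: "S \<subseteq> Up \<union> Dn"
  proof
    fix x assume "x \<in> S"
    then obtain W where W: "W \<in> \<W>" "x \<in> W" using \<W>(3) by blast
    then have "ht (Cf W) (x, t) < ht (Cf W) (x, t1) \<or> ht (Cf W) (x, t1) < ht (Cf W) (x, t)"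
      using iff(3)[OF W] by linarith
    then show "x \<in> Up \<union> Dn" unfolding Up_def Dn_def using iff(1,2)[OF W] W by blast
  qed
  \<comment> \<open>The two directions could still come from different tubes over \<open>x\<close>.
    The vertical arc of the first is carried into the box of the second by
    \<open>arc_transfer\<close>, with the same direction.\<close>
  have disj: "Up \<inter> Dn = {}"
  proof (rule ccontr)
    assume "Up \<inter> Dn \<noteq> {}"
    then obtain x W W' where W: "W \<in> \<W>" "x \<in> W" "rch W \<beta> (x, t) (x, t1)"
      and W': "W' \<in> \<W>" "x \<in> W'" "rch W' \<beta> (x, t1) (x, t)"
      unfolding Up_def Dn_def by blast
    interpret T: tube m M \<B> S W \<beta> by (rule tube[OF W(1)])
    have v: "vert x \<delta>" using vert WS W by blast
    have h: "ht (Cf W) (x, t) \<le> ht (Cf W) (x, t1)" using iff(1)[OF W(1,2)] W(3) by simp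
    note vc = T.vertical_conn[OF v W(2) \<beta>\<delta> t(1) bt(2) order_refl Cf[OF W(1)] h]
    have "{x} \<times> {t..t1} \<subseteq> W' \<times> {\<beta>..t1}" using W'(2) bt(1) by auto
    then have "arc (Cf W) (x, t) (x, t1) \<subseteq> dom (Cf W')" using vc(2) Cf(2)[OF W'(1)] by blast
    moreover have "before (Cf W) (x, t) (x, t1)" using vc(1) by (simp add: T.conn_def)
    ultimately have "before (Cf W') (x, t) (x, t1)"
      using arc_transfer(1)[OF Cf(1)[OF W(1)] Cf(1)[OF W'(1)]] by blast
    moreover have "ht (Cf W') (x, t1) < ht (Cf W') (x, t)" using iff(2)[OF W'(1,2)] W'(3) by blast
    ultimately show False by (simp add: before_def)
  qed
  have \<beta>t: "\<beta> < t" using t(1) \<delta>(1) by simp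
  have "Up \<noteq> {}"
  proof -
    obtain W x s where W: "W \<in> \<W>" "x \<in> W" "t < s" "rch W \<beta> (x, t) (x, s)"
      by (rule rising_tube[OF r \<W>(3,4,2) \<beta>t]) (assumption | rule that)+
    interpret T: tube m M \<B> S W \<beta> by (rule tube[OF W(1)])
    have v: "vert x \<delta>" using vert WS W by blast
    \<comment> \<open>The level \<open>s\<close> is whatever the fixed point produced;
      \<open>vertical_up\<close> replaces it by \<open>t1\<close>.\<close>
    have "T.reach (x, t) (x, t1)"
      by (rule T.vertical_up[OF v W(2) \<beta>\<delta> t(1) W(3) t(2)]) (use W(4) T.reach_rch in blast)
    then show ?thesis unfolding Up_def T.reach_rch using W by blast
  qed
  moreover have "Dn \<noteq> {}"
  proof -
    interpret R: glass_family m M "flip ` \<B>" S by (rule reverse_glass)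
    obtain W x s where W: "W \<in> \<W>" "x \<in> W" "t < s" "R.rch W \<beta> (x, t) (x, s)"
      by (rule R.rising_tube[OF f \<W>(3,4,2) \<beta>t]) (assumption | rule that)+
    interpret T: tube m M \<B> S W \<beta> by (rule tube[OF W(1)])
    interpret RT: tube m M "flip ` \<B>" S W \<beta> by (rule T.reverse_tube)
    have v: "R.vert x \<delta>" using vert WS W vert_flip by blast
    have "RT.reach (x, t) (x, t1)"
      by (rule RT.vertical_up[OF v W(2) \<beta>\<delta> t(1) W(3) t(2)]) (use W(4) RT.reach_rch in blast)
    then have "rch W \<beta> (x, t1) (x, t)" unfolding RT.reach_rch rch_flip .
    then show ?thesis unfolding Dn_def using W by blast
  qed
  ultimately show False
    using connected_openin[of S] connected_S opUp opDn cover disj by blast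
qed

end

section \<open>Balls and spheres\<close>

definition espace :: "nat \<Rightarrow> (nat \<Rightarrow> real) set" where
  "espace k = {x. \<forall>i\<ge>k. x i = 0}"

abbreviation nrm :: "nat \<Rightarrow> (nat \<Rightarrow> real) \<Rightarrow> real" where
  "nrm n z \<equiv> L2_set z {..<n}"

definition eball :: "nat \<Rightarrow> real \<Rightarrow> (nat \<Rightarrow> real) set" where
  "eball n R = {z \<in> espace n. nrm n z \<le> R}"

definition esphere :: "nat \<Rightarrow> (nat \<Rightarrow> real) set" where
  "esphere n = {z \<in> espace n. nrm n z = 1}"

lemma continuous_coord: "continuous_on A (\<lambda>x::nat \<Rightarrow> real. x i)"
  by (rule continuous_on_subset[OF continuous_on_product_coordinates]) simp

lemma continuous_nrm:
  assumes "continuous_on A f"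
  shows "continuous_on A (\<lambda>x. nrm n (f x))"
  unfolding L2_set_def
  by (intro continuous_intros continuous_on_product_then_coordinatewise[OF assms])

lemma closed_espace: "closed (espace k)"
  unfolding espace_def
  by (intro closed_Collect_all closed_Collect_imp closed_Collect_eq continuous_coord) auto

lemma nrm_coord_le: "i < n \<Longrightarrow> \<bar>z i\<bar> \<le> nrm n z"
proof -
  assume i: "i < n"
  have "(z i)\<^sup>2 \<le> (\<Sum>j<n. (z j)\<^sup>2)"
    by (rule member_le_sum) (use i in auto)
  then have "sqrt ((z i)\<^sup>2) \<le> nrm n z" unfolding L2_set_def by (rule real_sqrt_le_mono)
  then show ?thesis by simp
qed

lemma eball_coord_le: "z \<in> eball n R \<Longrightarrow> \<bar>z i\<bar> \<le> \<bar>R\<bar>"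
  using nrm_coord_le[of i n z] by (cases "i < n") (auto simp: eball_def espace_def)

lemma compact_eball: "compact (eball n R)"
proof -
  have "closed (eball n R)"
  proof -
    have "eball n R = espace n \<inter> {z. nrm n z \<le> R}" by (auto simp: eball_def)
    then show ?thesis
      by (simp add: closed_Int closed_espace closed_Collect_le continuous_nrm continuous_on_id)
  qed
  moreover have "eball n R \<subseteq> {y. \<forall>i. y i \<in> {- \<bar>R\<bar>..\<bar>R\<bar>}}"
    using eball_coord_le by (auto simp: abs_le_iff minus_le_iff) 
  ultimately show ?thesis
    using compact_Int_closed[OF compact_fun_box[of "\<bar>R\<bar>"], of "eball n R"] by (simp add: Int_absorb1)
qed

lemma nrm_scale: "nrm n (\<lambda>i. c * z i) = \<bar>c\<bar> * nrm n z"
proof -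
  have "nrm n (\<lambda>i. c * z i) = nrm n (\<lambda>i. \<bar>c\<bar> * z i)"
    by (simp add: L2_set_def power_mult_distrib)
  also have "\<dots> = \<bar>c\<bar> * nrm n z" by (rule L2_set_right_distrib[symmetric]) simp
  finally show ?thesis .
qed

lemma segment_closed_eball: "segment_closed (eball n R)"
  unfolding segment_closed_def
proof (intro ballI)
  fix x y s assume x: "x \<in> eball n R" and y: "y \<in> eball n R" and s: "s \<in> {0..1::real}"
  have "nrm n (\<lambda>i. (1 - s) * x i + s * y i) \<le> nrm n (\<lambda>i. (1 - s) * x i) + nrm n (\<lambda>i. s * y i)"
    by (rule L2_set_triangle_ineq)
  also have "\<dots> = (1 - s) * nrm n x + s * nrm n y" using s by (simp add: nrm_scale)
  also have "\<dots> \<le> (1 - s) * R + s * R"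
    using x y s by (intro add_mono mult_left_mono) (auto simp: eball_def)
  finally have "nrm n (\<lambda>i. (1 - s) * x i + s * y i) \<le> R" by (simp add: algebra_simps)
  moreover have "(\<lambda>i. (1 - s) * x i + s * y i) \<in> espace n"
    using x y by (auto simp: eball_def espace_def)
  ultimately show "(\<lambda>i. (1 - s) * x i + s * y i) \<in> eball n R" by (simp add: eball_def)
qed

lemma Euclidean_space_top_of_set: "Euclidean_space k = top_of_set (espace k)"
  by (simp add: Euclidean_space_def euclidean_product_topology espace_def)

lemma nsphere_top_of_set:
  assumes "n \<ge> 1"
  shows "nsphere (n - 1) = top_of_set (esphere n)"
proof -
  have n: "Suc (n - 1) = n" "{..n - 1} = {..<n}" using assms by auto
  have "nsphere (n - 1) = subtopology (Euclidean_space n) {x. (\<Sum>i<n. (x i)\<^sup>2) = 1}"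
    unfolding nsphere_def n ..
  also have "\<dots> = top_of_set (espace n \<inter> {x. (\<Sum>i<n. (x i)\<^sup>2) = 1})"
    by (simp add: Euclidean_space_top_of_set subtopology_subtopology)
  also have "espace n \<inter> {x. (\<Sum>i<n. (x i)\<^sup>2) = 1} = esphere n"
    by (auto simp: esphere_def L2_set_def)
  finally show ?thesis .
qed

lemma nball_top_of_set: "nball n = top_of_set (eball n 1)"
proof -
  have "espace n \<inter> {x. (\<Sum>i<n. (x i)\<^sup>2) \<le> 1} = eball n 1"
    by (auto simp: eball_def L2_set_def)
  then show ?thesis
    by (simp add: nball_def Euclidean_space_top_of_set subtopology_subtopology)
qed

lemma nrm_pos:
  assumes "z \<in> espace n" "z \<noteq> (\<lambda>_. 0)"
  shows "0 < nrm n z"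
proof -
  have "nrm n z \<noteq> 0"
  proof
    assume "nrm n z = 0"
    then have "z i = 0" for i
      using assms(1) by (cases "i < n") (auto simp: L2_set_eq_0_iff espace_def)
    with assms(2) show False by auto
  qed
  then show ?thesis using L2_set_nonneg[of z "{..<n}"] by linarith
qed

lemma continuous_normalise:
  assumes c: "continuous_on A f" and nz: "\<And>x. x \<in> A \<Longrightarrow> f x \<in> espace n \<and> f x \<noteq> (\<lambda>_. 0)"
  shows "continuous_on A (\<lambda>x i. f x i / nrm n (f x))"
  by (intro continuous_on_coordinatewise_then_product continuous_on_divide continuous_nrm[OF c]
      continuous_on_product_then_coordinatewise[OF c])
    (use nz nrm_pos in fastforce)

lemma normalise_in:
  assumes "z \<in> espace n" "z \<noteq> (\<lambda>_. 0)"
  shows "(\<lambda>i. z i / nrm n z) \<in> esphere n"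
proof -
  have p: "0 < nrm n z" by (rule nrm_pos[OF assms])
  have "nrm n (\<lambda>i. (1 / nrm n z) * z i) = 1" unfolding nrm_scale using p by simp
  then show ?thesis using assms(1) by (simp add: esphere_def espace_def)
qed

text \<open>Without a fixed point the sphere could be contracted. At radius \<open>R\<close> the
  subtracted multiple \<open>u\<close> of \<open>F\<close> grows from 0 to 1; then, with
  \<open>u\<close> equal to 1, the radius shrinks to 0. The difference never vanishes: for
  \<open>u < 1\<close> because values of \<open>F\<close> have norm at most \<open>R\<close>, for
  \<open>u = 1\<close> by assumption. Normalised, it leads from the identity to a constant.\<close>

lemma brouwer_eball:
  assumes n: "n \<ge> 1" and R: "R > 0" and F: "continuous_on (eball n R) F" "F ` eball n R \<subseteq> eball n R"
  shows "\<exists>z\<in>eball n R. F z = z"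
proof (rule ccontr)
  assume no: "\<not> ?thesis"
  define u v :: "real \<Rightarrow> real" where "u s = min 1 (2 * s)" and "v s = min 1 (2 - 2 * s)" for s
  define w where "w z = (\<lambda>i. v (fst z) * R * snd z i)" for z :: "real \<times> (nat \<Rightarrow> real)"
  define d where "d z = (\<lambda>i. w z i - u (fst z) * F (w z) i)" for z
  define h where "h z = (\<lambda>i. d z i / nrm n (d z))" for z
  define A where "A = {0..1::real} \<times> esphere n"
  have uv: "0 \<le> u s" "u s \<le> 1" "0 \<le> v s" "v s \<le> 1" "u s = 1 \<or> v s = 1" if "s \<in> {0..1}" for s
    using that by (auto simp: u_def v_def min_def)
  have wA: "w z \<in> eball n R" "nrm n (w z) = v (fst z) * R" if "z \<in> A" for z
  proof -
    have z: "fst z \<in> {0..1}" "nrm n (snd z) = 1" "snd z \<in> espace n"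
      using that by (auto simp: A_def esphere_def mem_Times_iff)
    show "nrm n (w z) = v (fst z) * R"
      unfolding w_def nrm_scale using z uv[OF z(1)] R by simp
    then show "w z \<in> eball n R"
      using z uv[OF z(1)] R by (auto simp: eball_def w_def espace_def mult_left_le_one_le)
  qed
  have FA: "F (w z) \<in> eball n R" if "z \<in> A" for z using wA(1)[OF that] F(2) by blast
  have dA: "d z \<in> espace n" "d z \<noteq> (\<lambda>_. 0)" if z: "z \<in> A" for z
  proof -
    show "d z \<in> espace n" using wA(1)[OF z] FA[OF z] by (simp add: d_def eball_def espace_def)
    show "d z \<noteq> (\<lambda>_. 0)"
    proof
      assume "d z = (\<lambda>_. 0)"
      then have eq: "w z i = u (fst z) * F (w z) i" for i unfolding d_def by (metis eq_iff_diff_eq_0)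
      have s: "fst z \<in> {0..1}" using z by (auto simp: A_def)
      have "u (fst z) = 1"
      proof (rule ccontr)
        assume u1: "u (fst z) \<noteq> 1"
        then have "v (fst z) = 1" "u (fst z) < 1" using uv[OF s] by auto
        then have "R = nrm n (\<lambda>i. u (fst z) * F (w z) i)" using wA(2)[OF z] eq by (simp flip: eq)
        also have "\<dots> = u (fst z) * nrm n (F (w z))" using uv[OF s] by (simp add: nrm_scale)
        also have "\<dots> \<le> u (fst z) * R" using FA[OF z] uv[OF s] by (intro mult_left_mono) (auto simp: eball_def)
        finally show False using \<open>u (fst z) < 1\<close> R by simp
      qed
      then have "F (w z) = w z" using eq by auto
      then show False using no wA(1)[OF z] by blast
    qed
  qed
  have cw: "continuous_on A w"
    unfolding w_def v_def
    by (intro continuous_on_coordinatewise_then_product continuous_intros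
        continuous_on_product_then_coordinatewise[OF continuous_on_snd[OF continuous_on_id]])
  have cFw: "continuous_on A (\<lambda>z. F (w z))"
    by (rule continuous_on_compose2[OF F(1) cw]) (use wA(1) in blast)
  have cd: "continuous_on A d"
    unfolding d_def u_def
    by (intro continuous_on_coordinatewise_then_product continuous_intros
        continuous_on_product_then_coordinatewise[OF cw] continuous_on_product_then_coordinatewise[OF cFw])
  have ch: "continuous_on A h"
    unfolding h_def by (rule continuous_normalise[OF cd]) (use dA in blast)
  have hA: "h z \<in> esphere n" if "z \<in> A" for z
    unfolding h_def by (rule normalise_in[OF dA[OF that]])
  have "continuous_map (prod_topology (top_of_set {0..1}) (top_of_set (esphere n))) (top_of_set (esphere n)) h"
  proof -
    have "prod_topology (top_of_set {0..1::real}) (top_of_set (esphere n)) = top_of_set A"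
      unfolding A_def by (simp add: prod_topology_subtopology_eu)
    then show ?thesis using ch hA by (simp add: continuous_map_in_subtopology image_subset_iff)
  qed
  then have "homotopic_with (\<lambda>x. True) (top_of_set (esphere n)) (top_of_set (esphere n)) (\<lambda>x. h (0, x)) (\<lambda>x. h (1, x))"
    unfolding homotopic_with_def by blast
  then have "homotopic_with (\<lambda>x. True) (top_of_set (esphere n)) (top_of_set (esphere n)) id (\<lambda>x. h (1, (\<lambda>_. 0)))"
  proof (rule homotopic_with_eq)
    fix x assume "x \<in> topspace (top_of_set (esphere n))"
    then have x: "x \<in> esphere n" by simp
    have "d (0, x) = (\<lambda>i. R * x i)" by (simp add: d_def w_def u_def v_def)
    moreover have "nrm n (\<lambda>i. R * x i) = R" using x R by (simp add: nrm_scale esphere_def)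
    ultimately show "id x = h (0, x)" using R by (simp add: h_def)
    have "w (1, x) = w (1, (\<lambda>_. 0))" by (simp add: w_def v_def)
    then have "d (1, x) = d (1, (\<lambda>_. 0))" by (simp add: d_def)
    then show "h (1, (\<lambda>_. 0)) = h (1, x)" by (simp add: h_def)
  qed simp
  then have "contractible_space (top_of_set (esphere n))"
    unfolding contractible_space_def by blast
  then have "contractible_space (nsphere (n - 1))" unfolding nsphere_top_of_set[OF n] .
  then show False using non_contractible_space_nsphere by blast
qed

lemma compact_esphere: "compact (esphere n)"
proof -
  have "esphere n = eball n 1 \<inter> {z. nrm n z = 1}" by (auto simp: esphere_def eball_def)
  moreover have "closed {z. nrm n z = 1}"
    by (intro closed_Collect_eq continuous_nrm continuous_on_id continuous_on_const)
  ultimately show ?thesis by (simp add: compact_Int_closed compact_eball)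
qed

text \<open>Non-antipodal points are joined by the normalised segment; antipodal ones need a third
  point, and this is where the dimension enters.\<close>

lemma connected_esphere:
  assumes n: "n \<ge> 2"
  shows "connected (esphere n)"
proof -
  have arcs: "\<exists>C. connected C \<and> C \<subseteq> esphere n \<and> x \<in> C \<and> y \<in> C"
    if x: "x \<in> esphere n" and y: "y \<in> esphere n" and ne: "\<exists>i. y i \<noteq> - x i" for x y
  proof -
    define f where "f s = (\<lambda>i. (1 - s) * x i + s * y i)" for s :: real
    have xy: "x \<in> espace n" "nrm n x = 1" "y \<in> espace n" "nrm n y = 1"
      using x y by (auto simp: esphere_def)
    have f: "f s \<in> espace n" "f s \<noteq> (\<lambda>_. 0)" if s: "s \<in> {0..1}" for s
    proof -
      show "f s \<in> espace n" using xy by (simp add: f_def espace_def)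
      show "f s \<noteq> (\<lambda>_. 0)"
      proof
        assume "f s = (\<lambda>_. 0)"
        then have e: "(1 - s) * x i = - (s * y i)" for i unfolding f_def by (metis add_eq_0_iff2)
        have "nrm n (\<lambda>i. (1 - s) * x i) = nrm n (\<lambda>i. (- s) * y i)" by (simp add: e)
        \<comment> \<open>The two sides have norms 1 - s and s, so a vanishing combination can only
          occur in the middle, and there only for antipodal points.\<close>
        then have "s = 1/2" using s xy unfolding nrm_scale by simp
        obtain i where "y i \<noteq> - x i" using ne by blast
        have "1 - s = s" using \<open>s = 1/2\<close> by simp
        have "s * x i = - (s * y i)" using e[of i] unfolding \<open>1 - s = s\<close> .
        then have "s * (x i + y i) = 0" by (simp add: distrib_left)
        then have "y i = - x i" using \<open>s = 1/2\<close> by simp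
        with \<open>y i \<noteq> - x i\<close> show False by simp
      qed
    qed
    have "continuous_on {0..1} f"
      unfolding f_def by (intro continuous_on_coordinatewise_then_product continuous_intros)
    then have "continuous_on {0..1} (\<lambda>s i. f s i / nrm n (f s))"
      by (rule continuous_normalise) (use f in blast)
    then have "connected ((\<lambda>s i. f s i / nrm n (f s)) ` {0..1})"
      by (rule connected_continuous_image) simp
    moreover have "(\<lambda>s i. f s i / nrm n (f s)) ` {0..1} \<subseteq> esphere n"
      using normalise_in[OF f] by blast
    moreover have xe: "x = (\<lambda>i. f 0 i / nrm n (f 0))" and ye: "y = (\<lambda>i. f 1 i / nrm n (f 1))"
      using xy by (simp_all add: f_def)
    have "x \<in> (\<lambda>s i. f s i / nrm n (f s)) ` {0..1}"
      by (rule image_eqI[where x = 0], rule xe, simp)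
    moreover have "y \<in> (\<lambda>s i. f s i / nrm n (f s)) ` {0..1}"
      by (rule image_eqI[where x = 1], rule ye, simp)
    ultimately show ?thesis by blast
  qed
  have arcs2: "\<exists>C. connected C \<and> C \<subseteq> esphere n \<and> x \<in> C \<and> y \<in> C" if x: "x \<in> esphere n" and y: "y \<in> esphere n" for x y
  proof (cases "\<exists>i. y i \<noteq> - x i")
    case True
    then show ?thesis by (rule arcs[OF x y])
  next
    case False
    then have yx: "y = (\<lambda>i. - x i)" by auto
    define e where "e k = (\<lambda>i. if i = k then 1 else 0 :: real)" for k :: nat
    have e: "e k \<in> esphere n" if "k < n" for k
    proof -
      have "(\<Sum>i<n. (e k i)\<^sup>2) = (\<Sum>i<n. if i = k then 1 else 0)" by (intro sum.cong) (auto simp: e_def)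
      also have "\<dots> = 1" using that by simp
      finally show ?thesis using that by (auto simp: esphere_def espace_def L2_set_def e_def)
    qed
    \<comment> \<open>The first two unit vectors are neither equal nor opposite, so they cannot both
      lie in the pair formed by \<open>x\<close> and its antipode.\<close>
    have "\<exists>z\<in>esphere n. z \<noteq> x \<and> z \<noteq> y"
    proof (rule ccontr)
      assume "\<not> ?thesis"
      then have "e 0 = x \<or> e 0 = y" "e 1 = x \<or> e 1 = y" using e[of 0] e[of 1] n by auto
      moreover have "e 0 0 \<noteq> e 1 0" "e 0 0 \<noteq> - e 1 0" by (simp_all add: e_def)
      ultimately show False using yx by auto
    qed
    then obtain z where z: "z \<in> esphere n" "z \<noteq> x" "z \<noteq> y" by blast
    have "\<exists>i. z i \<noteq> - x i" using z(3) yx by auto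
    then obtain C where C: "connected C" "C \<subseteq> esphere n" "x \<in> C" "z \<in> C" using arcs[OF x z(1)] by blast
    have "\<exists>i. y i \<noteq> - z i" using z(2) yx by auto
    then obtain C' where C': "connected C'" "C' \<subseteq> esphere n" "z \<in> C'" "y \<in> C'" using arcs[OF z(1) y] by blast
    have "connected (C \<union> C')" using C C' by (intro connected_Un) auto
    then show ?thesis using C C' by blast
  qed
  show ?thesis
    unfolding connected_clopen
  proof (intro allI impI)
    fix T assume T: "openin (top_of_set (esphere n)) T \<and> closedin (top_of_set (esphere n)) T"
    show "T = {} \<or> T = esphere n"
    proof (rule ccontr)
      assume c: "\<not> ?thesis"
      have sub: "T \<subseteq> esphere n" using T openin_imp_subset by blast
      then obtain x y where xy: "x \<in> T" "y \<in> esphere n" "y \<notin> T" using c by blast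
      then obtain C where C: "connected C" "C \<subseteq> esphere n" "x \<in> C" "y \<in> C"
        using arcs2[OF subsetD[OF sub xy(1)] xy(2)] by blast
      have "openin (top_of_set C) (C \<inter> T)" "closedin (top_of_set C) (C \<inter> T)"
      proof -
        obtain U where "open U" "T = esphere n \<inter> U" using T by (auto simp: openin_open)
        then have "C \<inter> T = C \<inter> U" using C(2) by blast
        then show "openin (top_of_set C) (C \<inter> T)" using \<open>open U\<close> by (simp add: openin_open_Int)
        obtain U where "closed U" "T = esphere n \<inter> U" using T by (auto simp: closedin_closed)
        then have "C \<inter> T = C \<inter> U" using C(2) by blast
        then show "closedin (top_of_set C) (C \<inter> T)" using \<open>closed U\<close> by (simp add: closedin_closed_Int)
      qed
      then have "C \<inter> T = {} \<or> C \<inter> T = C" using C(1)[unfolded connected_clopen] by blast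
      then show False using C xy by blast
    qed
  qed
qed

section \<open>A model of the long glass\<close>

text \<open>The ball is the bottom level, and only its boundary sphere is extended upwards, so no
  quotient is needed.\<close>

definition glass :: "nat \<Rightarrow> ((nat \<Rightarrow> real) \<times> lray) set" where
  "glass n = eball n 1 \<times> {lzero} \<union> esphere n \<times> UNIV"

lemma esphere_subset: "esphere n \<subseteq> eball n 1"
  by (auto simp: esphere_def eball_def)

lemma topspace_long_ray: "topspace long_ray = long_ray_points"
  by (simp add: long_ray_def)

text \<open>It is enough to look at rays, and these correspond under \<open>Abs_lray\<close>. With
  \<open>continuous_Rep_lray\<close> this identifies the two topologies.\<close>

lemma continuous_Abs_lray: "continuous_map long_ray euclidean Abs_lray"
  unfolding continuous_map_def topspace_long_ray
proof (intro conjI allI impI)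
  fix U :: "lray set" assume "openin euclidean U"
  then have "open U" by (simp only: open_openin)
  then have "generate_topology (range lessThan \<union> range greaterThan) U"
    by (simp only: open_lray_def)
  then show "openin long_ray {x \<in> long_ray_points. Abs_lray x \<in> U}"
  proof (induction rule: generate_topology.induct)
    case UNIV
    then show ?case using openin_topspace[of long_ray] by (simp add: topspace_long_ray)
  next
    case (Int a b)
    have "{x \<in> long_ray_points. Abs_lray x \<in> a \<inter> b}
        = {x \<in> long_ray_points. Abs_lray x \<in> a} \<inter> {x \<in> long_ray_points. Abs_lray x \<in> b}" by blast
    then show ?case using openin_Int[OF Int.IH] by simp
  next
    case (UN K)
    have "{x \<in> long_ray_points. Abs_lray x \<in> \<Union>K} = (\<Union>k\<in>K. {x \<in> long_ray_points. Abs_lray x \<in> k})" by blast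
    moreover have "openin long_ray (\<Union>k\<in>K. {x \<in> long_ray_points. Abs_lray x \<in> k})"
      by (rule openin_Union) (use UN in blast)
    ultimately show ?case by simp
  next
    case (Basis s)
    have iff: "Abs_lray x < a \<longleftrightarrow> long_ray_less x (Rep_lray a)" "a < Abs_lray x \<longleftrightarrow> long_ray_less (Rep_lray a) x"
      if "x \<in> long_ray_points" for x a
      using that by (simp_all add: less_lray_def Abs_lray_inverse)
    have gen: "openin long_ray X" if "X \<in> insert long_ray_points ((\<lambda>a. {x \<in> long_ray_points. long_ray_less a x}) ` long_ray_points
        \<union> (\<lambda>a. {x \<in> long_ray_points. long_ray_less x a}) ` long_ray_points)" for X
      unfolding long_ray_def order_topology_on_def using that by (rule topology_generated_by_Basis)
    from Basis obtain a where "s = {..<a} \<or> s = {a<..}" by blast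
    then show ?case
    proof
      assume s: "s = {..<a}"
      have "{x \<in> long_ray_points. Abs_lray x \<in> s} = {x \<in> long_ray_points. long_ray_less x (Rep_lray a)}"
        unfolding s using iff by blast
      then show ?thesis using gen Rep_lray[of a] by simp
    next
      assume s: "s = {a<..}"
      have "{x \<in> long_ray_points. Abs_lray x \<in> s} = {x \<in> long_ray_points. long_ray_less (Rep_lray a) x}"
        unfolding s using iff by blast
      then show ?thesis using gen Rep_lray[of a] by simp
    qed
  qed
qed simp

lemma continuous_Rep_lray: "continuous_map euclidean long_ray Rep_lray"
  unfolding long_ray_def order_topology_on_def
proof (subst continuous_on_generated_topo_iff, intro conjI allI impI)
  fix U assume "U \<in> insert long_ray_points ((\<lambda>a. {x \<in> long_ray_points. long_ray_less a x}) ` long_ray_points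
        \<union> (\<lambda>a. {x \<in> long_ray_points. long_ray_less x a}) ` long_ray_points)"
  then consider "U = long_ray_points"
    | a where "a \<in> long_ray_points" "U = {x \<in> long_ray_points. long_ray_less a x}"
    | a where "a \<in> long_ray_points" "U = {x \<in> long_ray_points. long_ray_less x a}" by blast
  then show "openin euclidean (Rep_lray -` U \<inter> topspace euclidean)"
  proof cases
    case 1
    then have "Rep_lray -` U = UNIV" using Rep_lray by blast
    then show ?thesis by simp
  next
    case 2
    then have "Rep_lray -` U = {Abs_lray a<..}"
      using Rep_lray by (auto simp: less_lray_def Abs_lray_inverse)
    then show ?thesis by simp
  next
    case 3
    then have "Rep_lray -` U = {..<Abs_lray a}"
      using Rep_lray by (auto simp: less_lray_def Abs_lray_inverse)
    then show ?thesis by simp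
  qed
next
  show "Rep_lray ` topspace euclidean
      \<subseteq> \<Union> (insert long_ray_points ((\<lambda>a. {x \<in> long_ray_points. long_ray_less a x}) ` long_ray_points
        \<union> (\<lambda>a. {x \<in> long_ray_points. long_ray_less x a}) ` long_ray_points))"
    using Rep_lray by blast
qed

text \<open>At the lowest level the representative in the ball is taken; over the boundary sphere
  the other one is glued to it.\<close>

definition glass_point :: "(nat \<Rightarrow> real) \<times> lray \<Rightarrow> glass_point" where
  "glass_point p = (if snd p = lzero then Inl (fst p) else Inr (fst p, Rep_lray (snd p)))"

definition to_glass :: "glass_point \<Rightarrow> (nat \<Rightarrow> real) \<times> lray" where
  "to_glass z = (case z of Inl x \<Rightarrow> (x, lzero) | Inr (x, r) \<Rightarrow> (x, Abs_lray r))"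

definition glass_class :: "nat \<Rightarrow> (nat \<Rightarrow> real) \<times> lray \<Rightarrow> glass_point set" where
  "glass_class n p = glass_glue n `` {glass_point p}"

context
  fixes n :: nat
  assumes n1: "n \<ge> 1"
begin

lemma topspace_pieces: "topspace (glass_pieces n) = eball n 1 <+> (esphere n \<times> long_ray_points)"
  by (simp add: glass_pieces_def nball_top_of_set nsphere_top_of_set[OF n1, simplified] topspace_long_ray)

text \<open>The gluing relation is the kernel of \<open>to_glass\<close>, so the quotient is the
  image of that map.\<close>

lemma glue_iff:
  assumes "z \<in> topspace (glass_pieces n)" "z' \<in> topspace (glass_pieces n)"
  shows "(z, z') \<in> glass_glue n \<longleftrightarrow> to_glass z = to_glass z'"
proof -
  have S: "topspace (nsphere (n - 1)) = esphere n" using nsphere_top_of_set[OF n1] by simp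
  have A: "Abs_lray r = lzero \<longleftrightarrow> r = long_ray_zero" "lzero = Abs_lray r \<longleftrightarrow> r = long_ray_zero"
    if "r \<in> long_ray_points" for r
    using that long_ray_zero_in by (auto simp: lzero_def Abs_lray_inject)
  have A2: "Abs_lray r = Abs_lray r' \<longleftrightarrow> r = r'" if "r \<in> long_ray_points" "r' \<in> long_ray_points" for r r'
    using that by (simp add: Abs_lray_inject)
  show ?thesis
    using assms unfolding topspace_pieces glass_glue_def S to_glass_def
    by (auto simp: A A2 Plus_def Id_on_iff topspace_pieces)
qed

lemma to_glass_point: "p \<in> glass n \<Longrightarrow> to_glass (glass_point p) = p"
  by (cases p) (simp add: glass_point_def to_glass_def Rep_lray_inverse)

lemma glass_point_in: "p \<in> glass n \<Longrightarrow> glass_point p \<in> topspace (glass_pieces n)"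
  unfolding topspace_pieces glass_def glass_point_def using subsetD[OF esphere_subset[of n]] Rep_lray by auto

lemma to_glass_in: "z \<in> topspace (glass_pieces n) \<Longrightarrow> to_glass z \<in> glass n"
  unfolding topspace_pieces glass_def to_glass_def by auto

lemma glue_class_eq:
  assumes "z \<in> topspace (glass_pieces n)" "z' \<in> topspace (glass_pieces n)"
  shows "glass_glue n `` {z} = glass_glue n `` {z'} \<longleftrightarrow> to_glass z = to_glass z'"
  using eq_equiv_class_iff[OF equiv_glass_glue[OF n1] assms] glue_iff[OF assms] by simp

lemma continuous_to_glass: "continuous_map (glass_pieces n) (top_of_set (glass n)) to_glass"
proof -
  have 1: "continuous_map (top_of_set (eball n 1)) euclidean (\<lambda>x. (x, lzero))"
    by (simp add: continuous_on_Pair)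
  have 2: "continuous_map (prod_topology (top_of_set (esphere n)) long_ray) (prod_topology euclidean euclidean)
      (\<lambda>z. (fst z, Abs_lray (snd z)))"
  proof (rule continuous_map_pairedI)
    show "continuous_map (prod_topology (top_of_set (esphere n)) long_ray) euclidean fst"
      using continuous_map_fst continuous_map_in_subtopology by blast
    show "continuous_map (prod_topology (top_of_set (esphere n)) long_ray) euclidean (\<lambda>z. Abs_lray (snd z))"
      using continuous_map_compose[OF continuous_map_snd continuous_Abs_lray] by (simp add: o_def)
  qed
  have "continuous_map (glass_pieces n) euclidean to_glass"
    unfolding continuous_map_def
  proof (intro conjI allI impI)
    fix U :: "((nat \<Rightarrow> real) \<times> lray) set" assume U: "openin euclidean U"
    have "openin (top_of_set (eball n 1)) {x \<in> eball n 1. (x, lzero) \<in> U}"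
      using openin_continuous_map_preimage[OF 1 U] by simp
    moreover have "Inl -` {z \<in> topspace (glass_pieces n). to_glass z \<in> U} = {x \<in> eball n 1. (x, lzero) \<in> U}"
      unfolding topspace_pieces by (auto simp: to_glass_def)
    moreover have "openin (prod_topology (top_of_set (esphere n)) long_ray)
        {z \<in> esphere n \<times> long_ray_points. (fst z, Abs_lray (snd z)) \<in> U}"
      using openin_continuous_map_preimage[OF 2, of U] U
      by (simp add: topspace_long_ray)
    moreover have "Inr -` {z \<in> topspace (glass_pieces n). to_glass z \<in> U}
        = {z \<in> esphere n \<times> long_ray_points. (fst z, Abs_lray (snd z)) \<in> U}"
      unfolding topspace_pieces by (auto simp: to_glass_def)
    ultimately show "openin (glass_pieces n) {z \<in> topspace (glass_pieces n). to_glass z \<in> U}"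
      unfolding glass_pieces_def openin_disjoint_union_topology nball_top_of_set nsphere_top_of_set[OF n1]
      by (simp add: glass_pieces_def nball_top_of_set nsphere_top_of_set[OF n1])
  qed simp
  then show ?thesis
    using to_glass_in by (simp add: continuous_map_in_subtopology image_subset_iff)
qed

lemma quotient_class: "continuous_map (glass_pieces n) (long_glass n) (\<lambda>z. glass_glue n `` {z})"
  unfolding long_glass_def by (rule quotient_imp_continuous_map[OF quotient_map_quotient_topology])

text \<open>The model is the union of two closed parts, on each of which the class map factors
  through one of the glued pieces.\<close>

lemma continuous_glass_class: "continuous_map (top_of_set (glass n)) (long_glass n) (glass_class n)"
proof -
  let ?q = "\<lambda>z. glass_glue n `` {z}"
  have L: "continuous_map (top_of_set (eball n 1)) (glass_pieces n) Inl"
    unfolding continuous_map_def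
  proof (intro conjI allI impI)
    fix U assume U: "openin (glass_pieces n) U"
    then have "openin (top_of_set (eball n 1)) (Inl -` U)"
      unfolding glass_pieces_def openin_disjoint_union_topology nball_top_of_set by blast
    moreover have "Inl -` U = {x \<in> topspace (top_of_set (eball n 1)). Inl x \<in> U}"
      using openin_subset[OF U] unfolding topspace_pieces by auto
    ultimately show "openin (top_of_set (eball n 1)) {x \<in> topspace (top_of_set (eball n 1)). Inl x \<in> U}"
      by simp
  qed (auto simp: topspace_pieces)
  have R: "continuous_map (prod_topology (top_of_set (esphere n)) long_ray) (glass_pieces n) Inr"
    unfolding continuous_map_def
  proof (intro conjI allI impI)
    fix U assume U: "openin (glass_pieces n) U"
    then have "openin (prod_topology (top_of_set (esphere n)) long_ray) (Inr -` U)"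
      unfolding glass_pieces_def openin_disjoint_union_topology nsphere_top_of_set[OF n1] by blast
    moreover have "Inr -` U = {x \<in> topspace (prod_topology (top_of_set (esphere n)) long_ray). Inr x \<in> U}"
      using openin_subset[OF U] unfolding topspace_pieces by (auto simp: topspace_long_ray)
    ultimately show "openin (prod_topology (top_of_set (esphere n)) long_ray)
        {x \<in> topspace (prod_topology (top_of_set (esphere n)) long_ray). Inr x \<in> U}"
      by simp
  qed (auto simp: topspace_pieces topspace_long_ray)
  define E0 where "E0 = eball n 1 \<times> {lzero}"
  define E1 where "E1 = esphere n \<times> (UNIV :: lray set)"
  have 0: "continuous_map (top_of_set E0) (long_glass n) (glass_class n)"
  proof (rule continuous_map_eq)
    have "continuous_map (top_of_set E0) (top_of_set (eball n 1)) fst"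
      by (auto simp: E0_def continuous_on_fst continuous_on_id continuous_map_in_subtopology)
    from continuous_map_compose[OF continuous_map_compose[OF this L] quotient_class]
    show "continuous_map (top_of_set E0) (long_glass n) (?q \<circ> (Inl \<circ> fst))" .
    show "(?q \<circ> (Inl \<circ> fst)) p = glass_class n p" if "p \<in> topspace (top_of_set E0)" for p
      using that by (auto simp: E0_def glass_class_def glass_point_def)
  qed
  have 1: "continuous_map (top_of_set E1) (long_glass n) (glass_class n)"
  proof (rule continuous_map_eq)
    have c: "continuous_map (top_of_set E1) (prod_topology (top_of_set (esphere n)) long_ray) (\<lambda>p. (fst p, Rep_lray (snd p)))"
    proof (rule continuous_map_pairedI)
      show "continuous_map (top_of_set E1) (top_of_set (esphere n)) fst"
        by (auto simp: E1_def continuous_on_fst continuous_on_id continuous_map_in_subtopology)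
      have "continuous_map (top_of_set E1) euclidean snd"
        by (simp add: continuous_on_snd continuous_on_id)
      from continuous_map_compose[OF this continuous_Rep_lray]
      show "continuous_map (top_of_set E1) long_ray (\<lambda>p. Rep_lray (snd p))" by (simp add: o_def)
    qed
    from continuous_map_compose[OF continuous_map_compose[OF c R] quotient_class]
    show "continuous_map (top_of_set E1) (long_glass n) (?q \<circ> (Inr \<circ> (\<lambda>p. (fst p, Rep_lray (snd p)))))" .
    show "(?q \<circ> (Inr \<circ> (\<lambda>p. (fst p, Rep_lray (snd p))))) p = glass_class n p" if "p \<in> topspace (top_of_set E1)" for p
    proof -
      have p: "p \<in> glass n" using that by (auto simp: E1_def glass_def)
      have i: "Inr (fst p, Rep_lray (snd p)) \<in> topspace (glass_pieces n)"
        unfolding topspace_pieces using that Rep_lray by (auto simp: E1_def)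
      \<comment> \<open>At the lowest level this representative is not \<open>glass_point p\<close>,
        which lies in the ball, but both have image \<open>p\<close>, so their classes
        agree.\<close>
      have "to_glass (Inr (fst p, Rep_lray (snd p))) = p" by (simp add: to_glass_def Rep_lray_inverse)
      then show ?thesis
        using glue_class_eq[OF i glass_point_in[OF p]] to_glass_point[OF p] by (simp add: glass_class_def)
    qed
  qed
  have un: "glass n = E0 \<union> E1" by (simp add: glass_def E0_def E1_def)
  have cl: "closed E0" "closed E1"
    unfolding E0_def E1_def
    by (intro closed_Times compact_imp_closed compact_eball compact_esphere closed_singleton closed_UNIV)+
  show ?thesis
    unfolding continuous_map_closedin
  proof (intro conjI allI impI)
    show "glass_class n \<in> topspace (top_of_set (glass n)) \<rightarrow> topspace (long_glass n)"
    proof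
      fix p assume "p \<in> topspace (top_of_set (glass n))"
      then have "p \<in> E0 \<or> p \<in> E1" unfolding un by simp
      moreover have "glass_class n ` E0 \<subseteq> topspace (long_glass n)" "glass_class n ` E1 \<subseteq> topspace (long_glass n)"
        using continuous_map_image_subset_topspace[OF 0] continuous_map_image_subset_topspace[OF 1] by simp_all
      ultimately show "glass_class n p \<in> topspace (long_glass n)" by blast
    qed
    fix C assume C: "closedin (long_glass n) C"
    have "closedin (top_of_set E0) {x \<in> E0. glass_class n x \<in> C}"
      using closedin_continuous_map_preimage[OF 0 C] by simp
    then have c0: "closed {x \<in> E0. glass_class n x \<in> C}" using cl closedin_closed_trans by blast
    have "closedin (top_of_set E1) {x \<in> E1. glass_class n x \<in> C}"
      using closedin_continuous_map_preimage[OF 1 C] by simp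
    then have c1: "closed {x \<in> E1. glass_class n x \<in> C}" using cl closedin_closed_trans by blast
    have eq: "{x \<in> glass n. glass_class n x \<in> C} = {x \<in> E0. glass_class n x \<in> C} \<union> {x \<in> E1. glass_class n x \<in> C}"
      unfolding un by blast
    have "closed {x \<in> glass n. glass_class n x \<in> C}" unfolding eq by (rule closed_Un[OF c0 c1])
    then show "closedin (top_of_set (glass n)) {x \<in> topspace (top_of_set (glass n)). glass_class n x \<in> C}"
      by (auto intro: closed_subset)
  qed
qed

lemma homeomorphic_glass_class: "homeomorphic_map (top_of_set (glass n)) (long_glass n) (glass_class n)"
proof -
  let ?q = "\<lambda>z. glass_glue n `` {z}"
  \<comment> \<open>Any representative will do, since \<open>to_glass\<close> is constant on
    classes.\<close>
  define \<Psi> where "\<Psi> X = to_glass (SOME z. z \<in> X)" for X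
  have \<Psi>q: "\<Psi> (?q z) = to_glass z" if z: "z \<in> topspace (glass_pieces n)" for z
  proof -
    have "z \<in> ?q z" using equiv_class_self[OF equiv_glass_glue[OF n1] z] .
    then have "(SOME y. y \<in> ?q z) \<in> ?q z" by (rule someI)
    then have "(z, SOME y. y \<in> ?q z) \<in> glass_glue n" by simp
    moreover from this have "(SOME y. y \<in> ?q z) \<in> topspace (glass_pieces n)"
      using equiv_glass_glue[OF n1] unfolding equiv_def by blast
    ultimately show ?thesis unfolding \<Psi>_def using glue_iff[OF z] by metis
  qed
  have "continuous_map (glass_pieces n) (top_of_set (glass n)) (\<Psi> \<circ> ?q)"
    by (rule continuous_map_eq[OF continuous_to_glass]) (simp add: \<Psi>q)
  then have c: "continuous_map (long_glass n) (top_of_set (glass n)) \<Psi>"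
    unfolding long_glass_def
    by (rule continuous_compose_quotient_map[OF quotient_map_quotient_topology])
  have "homeomorphic_maps (top_of_set (glass n)) (long_glass n) (glass_class n) \<Psi>"
    unfolding homeomorphic_maps_def
  proof (intro conjI ballI c continuous_glass_class)
    show "\<Psi> (glass_class n p) = p" if "p \<in> topspace (top_of_set (glass n))" for p
      using that \<Psi>q[OF glass_point_in] to_glass_point by (simp add: glass_class_def)
    show "glass_class n (\<Psi> X) = X" if X: "X \<in> topspace (long_glass n)" for X
    proof -
      obtain z where z: "z \<in> topspace (glass_pieces n)" "X = ?q z"
        using X unfolding long_glass_def topspace_quotient_topology quotient_def by blast
      have p: "to_glass z \<in> glass n" by (rule to_glass_in[OF z(1)])
      have "to_glass (glass_point (to_glass z)) = to_glass z" by (rule to_glass_point[OF p])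
      then have "?q (glass_point (to_glass z)) = ?q z"
        using glue_class_eq[OF glass_point_in[OF p] z(1)] by blast
      then show ?thesis using \<Psi>q[OF z(1)] z(2) by (simp add: glass_class_def)
    qed
  qed
  then show ?thesis using homeomorphic_map_maps by blast
qed

end

section \<open>Flow boxes of a foliated atlas\<close>

text \<open>Points of \<open>espace k\<close> share all coordinates from \<open>k\<close> on with
  \<open>b\<close>, so the smallest of the first \<open>k\<close> radii suffices.\<close>

lemma espace_nbhd:
  assumes T: "open T" and b: "b \<in> espace k \<inter> T"
  obtains r where "r > 0" "\<And>y. y \<in> espace k \<Longrightarrow> (\<And>i. i < k \<Longrightarrow> \<bar>y i - b i\<bar> < r) \<Longrightarrow> y \<in> T"
proof -
  have "openin (product_topology (\<lambda>i. euclidean) UNIV) T"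
    using T by (simp add: open_fun_def)
  then obtain X where X: "b \<in> (\<Pi>\<^sub>E i\<in>UNIV. X i)" "\<And>i. openin (euclidean :: real topology) (X i)" "(\<Pi>\<^sub>E i\<in>UNIV. X i) \<subseteq> T"
    using product_topology_open_contains_basis[of "\<lambda>i. euclidean" UNIV T b] b by auto
  have "\<exists>e>0. ball (b i) e \<subseteq> X i" for i
  proof -
    have "open (X i)" "b i \<in> X i" using X(1,2) by (auto simp: PiE_iff)
    then show ?thesis by (rule openE) blast
  qed
  then obtain e where e: "\<And>i. e i > 0" "\<And>i. ball (b i) (e i) \<subseteq> X i" by metis
  define r where "r = Min (insert 1 (e ` {..<k}))"
  have r: "r > 0" unfolding r_def using e(1) by (subst Min_gr_iff) auto
  have re: "r \<le> e i" if "i < k" for i unfolding r_def using that by (intro Min_le) auto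
  have "y \<in> T" if y: "y \<in> espace k" "\<And>i. i < k \<Longrightarrow> \<bar>y i - b i\<bar> < r" for y
  proof -
    have "y i \<in> X i" for i
    proof (cases "i < k")
      case True
      then have "y i \<in> ball (b i) (e i)" using y(2)[OF True] re[OF True] by (simp add: dist_real_def abs_minus_commute)
      then show ?thesis using e(2) by blast
    next
      case False
      then have "y i = b i" using y(1) b by (simp add: espace_def)
      then show ?thesis using X(1) by (simp add: PiE_iff)
    qed
    then show ?thesis using X(3) by (auto simp: PiE_iff)
  qed
  with r show ?thesis by (rule that)
qed

text \<open>Boxes whose plaques are cut out by the transversal coordinate of some chart of the
  atlas. Nothing is said about the direction of \<open>ht\<close>, so that the family is closed
  under \<open>flip\<close>.\<close>

definition flow_boxes :: "nat \<Rightarrow> glass_point set fol_chart set \<Rightarrow> ((nat \<Rightarrow> real) \<times> lray) flowbox set" where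
  "flow_boxes n \<A> = {c. is_flowbox (n - 1) (glass n) c \<and> (\<exists>(U, \<phi>)\<in>\<A>. (\<forall>p\<in>dom c. glass_class n p \<in> U) \<and>
     (\<forall>p\<in>dom c. \<forall>q\<in>dom c. tr c p = tr c q \<longleftrightarrow> snd (\<phi> (glass_class n p)) = snd (\<phi> (glass_class n q))))}"

text \<open>A chart of the quotient, read in the model as a homeomorphism between sets.\<close>

lemma chart_homeomorphism:
  assumes n: "n \<ge> 1" and c: "is_chart 1 n (long_glass n) (U, \<phi>)"
  defines "U' \<equiv> {p \<in> glass n. glass_class n p \<in> U}"
  obtains g where "openin (top_of_set (glass n)) U'" "openin (top_of_set (espace 1 \<times> espace (n - 1))) (\<phi> ` U)"
    "homeomorphism U' (\<phi> ` U) (\<lambda>p. \<phi> (glass_class n p)) g"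
proof -
  let ?E = "prod_topology (Euclidean_space 1) (Euclidean_space (n - 1))"
  have E: "?E = top_of_set (espace 1 \<times> espace (n - 1))"
    by (simp only: Euclidean_space_top_of_set prod_topology_subtopology_eu)
  have ch: "openin (long_glass n) U" "openin ?E (\<phi> ` U)"
    "homeomorphic_map (subtopology (long_glass n) U) (subtopology ?E (\<phi> ` U)) \<phi>"
    using c unfolding is_chart_def Let_def by auto
  have h: "homeomorphic_map (top_of_set (glass n)) (long_glass n) (glass_class n)"
    by (rule homeomorphic_glass_class[OF n])
  have op: "openin (top_of_set (glass n)) U'"
    unfolding U'_def using openin_continuous_map_preimage[OF homeomorphic_imp_continuous_map[OF h] ch(1)] by simp
  have U'g: "U' \<subseteq> glass n" by (auto simp: U'_def)
  have "glass_class n ` (topspace (top_of_set (glass n)) \<inter> U') = topspace (long_glass n) \<inter> U"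
  proof -
    have "glass_class n ` (glass n \<inter> U') = glass_class n ` glass n \<inter> U"
      unfolding U'_def by blast
    then show ?thesis using homeomorphic_imp_surjective_map[OF h] by simp
  qed
  from homeomorphic_map_subtopologies[OF h this]
  have "homeomorphic_map (top_of_set U') (subtopology (long_glass n) U) (glass_class n)"
    using U'g by (simp add: subtopology_subtopology Int_absorb1)
  from homeomorphic_map_compose[OF this ch(3)]
  have "homeomorphic_map (top_of_set U') (subtopology ?E (\<phi> ` U)) (\<phi> \<circ> glass_class n)" .
  moreover have "subtopology ?E (\<phi> ` U) = top_of_set (\<phi> ` U)"
    unfolding E using openin_subset[OF ch(2)] unfolding E by (simp add: subtopology_subtopology Int_absorb1)
  ultimately have "homeomorphic_map (top_of_set U') (top_of_set (\<phi> ` U)) (\<phi> \<circ> glass_class n)" by simp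
  then obtain g where "homeomorphic_maps (top_of_set U') (top_of_set (\<phi> ` U)) (\<phi> \<circ> glass_class n) g"
    unfolding homeomorphic_map_maps by blast
  then have "homeomorphism U' (\<phi> ` U) (\<lambda>p. \<phi> (glass_class n p)) g"
    by (simp add: o_def)
  then show ?thesis using that op ch(2) unfolding E by blast
qed

text \<open>Affine rescaling makes the standard cube the image of a small chart around a given point.\<close>

lemma small_flow_box:
  assumes n: "n \<ge> 1" and c: "is_chart 1 n (long_glass n) (U, \<phi>)" and mem: "(U, \<phi>) \<in> \<A>"
    and p: "p \<in> glass n" "glass_class n p \<in> U" and O: "openin (top_of_set (glass n)) O'" "p \<in> O'"
  shows "\<exists>c\<in>flow_boxes n \<A>. p \<in> dom c \<and> dom c \<subseteq> O' \<and> crd c p = (0, \<lambda>_. 0)"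
proof -
  define m where "m = n - 1"
  define U' where "U' = {p \<in> glass n. glass_class n p \<in> U}"
  define V where "V = \<phi> ` U"
  define ch where "ch p = \<phi> (glass_class n p)" for p
  define E where "E = espace 1 \<times> espace m"
  obtain g where op: "openin (top_of_set (glass n)) U'" and opV: "openin (top_of_set E) V"
    and h: "homeomorphism U' V ch g"
    by (rule chart_homeomorphism[OF n c]) (use that in \<open>simp add: U'_def V_def ch_def[abs_def] E_def m_def\<close>)
  have VE: "V \<subseteq> E" using opV openin_imp_subset by blast
  have pU: "p \<in> U'" using p by (simp add: U'_def)
  have "openin (top_of_set (glass n)) (U' \<inter> O')" using op O by blast
  then have "openin (top_of_set U') (U' \<inter> O')"
    using op by (meson Int_lower1 openin_imp_subset openin_subset_trans)
  then have "openin (top_of_set V) (ch ` (U' \<inter> O'))" by (rule homeomorphism_imp_open_map[OF h])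
  then have "openin (top_of_set E) (ch ` (U' \<inter> O'))" using openin_trans opV by blast
  then obtain T where T: "open T" "ch ` (U' \<inter> O') = E \<inter> T" by (auto simp: openin_open)
  define a b where "a = fst (ch p)" and "b = snd (ch p)"
  have ab: "(a, b) \<in> E \<inter> T" unfolding T(2)[symmetric] using pU O(2) by (simp add: a_def b_def)
  then have ab': "a \<in> espace 1" "b \<in> espace m" "(a, b) \<in> T" by (auto simp: E_def)
  obtain A B where AB: "open A" "open B" "(a, b) \<in> A \<times> B" "A \<times> B \<subseteq> T"
    by (rule open_prod_elim[OF T(1) ab'(3)])
  obtain r1 where r1: "r1 > 0" "\<And>y. y \<in> espace 1 \<Longrightarrow> (\<And>i. i < 1 \<Longrightarrow> \<bar>y i - a i\<bar> < r1) \<Longrightarrow> y \<in> A"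
    by (rule espace_nbhd[OF AB(1), of a 1]) (use AB(3) ab'(1) that in auto)
  obtain r2 where r2: "r2 > 0" "\<And>y. y \<in> espace m \<Longrightarrow> (\<And>i. i < m \<Longrightarrow> \<bar>y i - b i\<bar> < r2) \<Longrightarrow> y \<in> B"
    by (rule espace_nbhd[OF AB(2), of b m]) (use AB(3) ab'(2) that in auto)
  define r where "r = min r1 r2"
  have r: "r > 0" "r \<le> r1" "r \<le> r2" using r1(1) r2(1) by (auto simp: r_def)
  define \<eta> where "\<eta> z = ((\<lambda>i::nat. if i = 0 then a 0 + r * fst z else 0), (\<lambda>i::nat. b i + r * snd z i))"
    for z :: "real \<times> (nat \<Rightarrow> real)"
  define \<kappa> where "\<kappa> w = ((fst w 0 - a 0) / r, (\<lambda>i::nat. (snd w i - b i) / r))"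
    for w :: "(nat \<Rightarrow> real) \<times> (nat \<Rightarrow> real)"
  \<comment> \<open>A cube about the image of \<open>p\<close>, small enough to lie in the image of
    \<open>O'\<close>; the maps \<open>\<eta>\<close> and \<open>\<kappa>\<close> identify it with
    the standard cube.\<close>
  define Q where "Q = E \<inter> {w. \<bar>fst w 0 - a 0\<bar> < r \<and> (\<forall>i<m. \<bar>snd w i - b i\<bar> < r)}"
  have QT: "Q \<subseteq> ch ` (U' \<inter> O')"
  proof
    fix w assume w: "w \<in> Q"
    then have wE: "fst w \<in> espace 1" "snd w \<in> espace m" "w \<in> E" by (auto simp: Q_def E_def)
    have "fst w \<in> A" by (rule r1(2)[OF wE(1)]) (use w r in \<open>auto simp: Q_def\<close>)
    moreover have "snd w \<in> B" by (rule r2(2)[OF wE(2)]) (use w r in \<open>auto simp: Q_def intro: less_le_trans\<close>)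
    ultimately have "w \<in> A \<times> B" by (simp add: mem_Times_iff)
    then have "w \<in> T" using AB(4) by blast
    then show "w \<in> ch ` (U' \<inter> O')" unfolding T(2) using wE(3) by blast
  qed
  have QV: "Q \<subseteq> V" using QT homeomorphism_image1[OF h] by blast
  have opQ: "openin (top_of_set V) Q"
  proof -
    have c: "continuous_on UNIV (\<lambda>w::(nat \<Rightarrow> real) \<times> (nat \<Rightarrow> real). fst w i)"
      "continuous_on UNIV (\<lambda>w::(nat \<Rightarrow> real) \<times> (nat \<Rightarrow> real). snd w i)" for i
      by (rule continuous_on_product_then_coordinatewise[OF continuous_on_fst[OF continuous_on_id]],
        rule continuous_on_product_then_coordinatewise[OF continuous_on_snd[OF continuous_on_id]])
    have eq: "{w :: (nat \<Rightarrow> real) \<times> (nat \<Rightarrow> real). \<bar>fst w 0 - a 0\<bar> < r \<and> (\<forall>i<m. \<bar>snd w i - b i\<bar> < r)}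
       = {w. \<bar>fst w 0 - a 0\<bar> < r} \<inter> (\<Inter>i\<in>{..<m}. {w. \<bar>snd w i - b i\<bar> < r})" by auto
    have "open {w :: (nat \<Rightarrow> real) \<times> (nat \<Rightarrow> real). \<bar>fst w 0 - a 0\<bar> < r \<and> (\<forall>i<m. \<bar>snd w i - b i\<bar> < r)}"
      unfolding eq
      by (intro open_Int open_INT ballI open_Collect_less continuous_on_rabs continuous_on_diff
          continuous_on_const finite_lessThan) (simp_all add: c)
    moreover have "Q = V \<inter> {w. \<bar>fst w 0 - a 0\<bar> < r \<and> (\<forall>i<m. \<bar>snd w i - b i\<bar> < r)}"
      using QV VE unfolding Q_def by blast
    ultimately show ?thesis by (auto simp: openin_open)
  qed
  have \<eta>Q: "\<eta> z \<in> Q" "\<kappa> (\<eta> z) = z" if z: "z \<in> fcube m" for z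
  proof -
    have z': "\<bar>fst z\<bar> < 1" "\<And>i. i < m \<Longrightarrow> \<bar>snd z i\<bar> < 1" "\<And>i. m \<le> i \<Longrightarrow> snd z i = 0"
      using z by (auto simp: fcube_def cell_def)
    have lt: "\<bar>r * x\<bar> < r" if "\<bar>x\<bar> < 1" for x using that r(1) by (simp add: abs_mult)
    show "\<eta> z \<in> Q"
      using z' lt ab' unfolding Q_def E_def \<eta>_def espace_def by auto
    show "\<kappa> (\<eta> z) = z" using r(1) by (simp add: \<kappa>_def \<eta>_def)
  qed
  have \<kappa>Q: "\<kappa> w \<in> fcube m" "\<eta> (\<kappa> w) = w" if w: "w \<in> Q" for w
  proof -
    have w': "\<bar>fst w 0 - a 0\<bar> < r" "\<And>i. i < m \<Longrightarrow> \<bar>snd w i - b i\<bar> < r" "fst w \<in> espace 1" "snd w \<in> espace m"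
      using w by (auto simp: Q_def E_def)
    have lt: "\<bar>x / r\<bar> < 1" if "\<bar>x\<bar> < r" for x using that r(1) by (simp add: abs_divide)
    have "\<bar>fst (\<kappa> w)\<bar> < 1" using lt[OF w'(1)] by (simp add: \<kappa>_def)
    moreover have "\<bar>snd (\<kappa> w) i\<bar> < 1" if "i < m" for i using lt[OF w'(2)[OF that]] by (simp add: \<kappa>_def)
    moreover have "snd (\<kappa> w) i = 0" if "m \<le> i" for i
      using w'(4) ab'(2) that by (simp add: \<kappa>_def espace_def)
    ultimately show "\<kappa> w \<in> fcube m"
      by (simp add: fcube_def cell_def mem_Times_iff abs_less_iff)
    have "(\<lambda>i. if i = 0 then fst w 0 else 0) = fst w" using w'(3) by (auto simp: espace_def)
    then show "\<eta> (\<kappa> w) = w" using r(1) by (simp add: \<eta>_def \<kappa>_def prod_eq_iff cong: if_cong)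
  qed
  define c where "c = \<lparr>dom = {q \<in> U'. ch q \<in> Q}, crd = (\<lambda>q. \<kappa> (ch q)), pt = (\<lambda>z. g (\<eta> z))\<rparr>"
  have cs: "dom c = {q \<in> U'. ch q \<in> Q}" "crd c = (\<lambda>q. \<kappa> (ch q))" "pt c = (\<lambda>z. g (\<eta> z))"
    by (simp_all add: c_def)
  have "openin (top_of_set U') (dom c)"
  proof -
    obtain T' where T': "open T'" "Q = V \<inter> T'" using opQ by (auto simp: openin_open)
    have "dom c = U' \<inter> ch -` T'" unfolding cs T'(2) using homeomorphism_image1[OF h] by blast
    then show ?thesis using continuous_openin_preimage_gen[OF homeomorphism_cont1[OF h] T'(1)] by simp
  qed
  then have opd: "openin (top_of_set (glass n)) (dom c)" using openin_trans op by blast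
  have "homeomorphism (dom c) (fcube m) (crd c) (pt c)"
  proof (rule homeomorphismI)
    have "continuous_on (dom c) ch"
      by (rule continuous_on_subset[OF homeomorphism_cont1[OF h]]) (auto simp: cs)
    then show "continuous_on (dom c) (crd c)"
      unfolding cs(2) \<kappa>_def using r(1)
      by (intro continuous_on_Pair continuous_on_coordinatewise_then_product continuous_intros
          continuous_on_product_then_coordinatewise[OF continuous_on_fst]
          continuous_on_product_then_coordinatewise[OF continuous_on_snd]) auto
    have "continuous_on (fcube m) (\<lambda>z. if i = (0::nat) then a 0 + r * fst z else 0)" for i
      by (cases "i = 0") (auto intro!: continuous_intros)
    then have "continuous_on (fcube m) \<eta>"
      unfolding \<eta>_def
      by (intro continuous_on_Pair continuous_on_coordinatewise_then_product continuous_intros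
          continuous_on_product_then_coordinatewise[OF continuous_on_snd[OF continuous_on_id]])
    then show "continuous_on (fcube m) (pt c)"
      unfolding cs(3) by (rule continuous_on_compose2[OF homeomorphism_cont2[OF h]]) (use \<eta>Q QV in blast)
    show "crd c ` dom c \<subseteq> fcube m" unfolding cs using \<kappa>Q by blast
    have gU: "g w \<in> U' \<and> ch (g w) = w" if "w \<in> V" for w
      using homeomorphism_image2[OF h] homeomorphism_apply2[OF h that] that by blast
    show "pt c ` fcube m \<subseteq> dom c"
    proof
      fix q assume "q \<in> pt c ` fcube m"
      then obtain z where z: "z \<in> fcube m" "q = g (\<eta> z)" unfolding cs by blast
      have "g (\<eta> z) \<in> U' \<and> ch (g (\<eta> z)) = \<eta> z" by (rule gU) (use \<eta>Q(1)[OF z(1)] QV in blast)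
      then show "q \<in> dom c" using z(2) \<eta>Q(1)[OF z(1)] by (simp add: cs)
    qed
    show "pt c (crd c q) = q" if "q \<in> dom c" for q
      using that \<kappa>Q(2) homeomorphism_apply1[OF h] unfolding cs by auto
    show "crd c (pt c z) = z" if "z \<in> fcube m" for z
      using \<eta>Q[OF that] gU[of "\<eta> z"] QV unfolding cs by auto
  qed
  then have fb: "is_flowbox (n - 1) (glass n) c" using opd by (simp add: is_flowbox_def m_def)
  have trc: "tr c q = tr c q' \<longleftrightarrow> snd (ch q) = snd (ch q')" for q q'
  proof
    assume e: "tr c q = tr c q'"
    have "snd (ch q) i = snd (ch q') i" for i
      using fun_cong[OF e, of i] r(1) by (simp add: cs \<kappa>_def)
    then show "snd (ch q) = snd (ch q')" by blast
  qed (simp add: cs \<kappa>_def)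
  have cF: "c \<in> flow_boxes n \<A>"
    unfolding flow_boxes_def mem_Collect_eq
  proof (intro conjI fb bexI[OF _ mem] case_prodI ballI)
    show "glass_class n q \<in> U" if "q \<in> dom c" for q using that by (auto simp: cs U'_def)
    show "(tr c q = tr c q') = (snd (\<phi> (glass_class n q)) = snd (\<phi> (glass_class n q')))" for q q'
      using trc[of q q'] by (simp add: ch_def)
  qed
  have "(a, b) \<in> Q" using ab r(1) by (simp add: Q_def)
  then have pc: "p \<in> dom c" unfolding cs using pU by (simp add: a_def b_def)
  have cO: "dom c \<subseteq> O'"
  proof
    fix q assume "q \<in> dom c"
    then have q: "q \<in> U'" "ch q \<in> Q" by (auto simp: cs)
    then obtain q' where q': "q' \<in> U' \<inter> O'" "ch q = ch q'" using QT by blast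
    have "q = g (ch q)" by (rule homeomorphism_apply1[OF h q(1), symmetric])
    also have "\<dots> = g (ch q')" by (rule arg_cong[OF q'(2)])
    also have "\<dots> = q'" by (rule homeomorphism_apply1[OF h]) (use q'(1) in blast)
    finally have "q = q'" .
    then show "q \<in> O'" using q'(1) by blast
  qed
  have "crd c p = (0, \<lambda>_. 0)" by (simp add: cs \<kappa>_def a_def b_def)
  then show ?thesis using cF pc cO by (intro bexI[of _ c]) simp_all
qed

text \<open>For \<open>agree\<close>, the transversal part of a coordinate change is a function
  \<open>h\<close> of the transversal coordinate alone, so equal coordinates go to equal ones; the
  change in the other direction gives the converse.\<close>

lemma flow_boxes_family:
  assumes n: "n \<ge> 1" and \<A>: "foliated_atlas 1 n (long_glass n) \<A>"
  shows "flip_family (n - 1) (glass n) (flow_boxes n \<A>)"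
proof
  have charts: "is_chart 1 n (long_glass n) (U, \<phi>)" if "(U, \<phi>) \<in> \<A>" for U \<phi>
    using \<A> that unfolding foliated_atlas_def by blast
  show "is_flowbox (n - 1) (glass n) c" if "c \<in> flow_boxes n \<A>" for c
    using that by (simp add: flow_boxes_def)
  have key: "snd (\<phi> x) = snd (\<phi> y) \<Longrightarrow> snd (\<psi> x) = snd (\<psi> y)"
    if UV: "(U, \<phi>) \<in> \<A>" "(V, \<psi>) \<in> \<A>" and xy: "x \<in> U \<inter> V" "y \<in> U \<inter> V" for U \<phi> V \<psi> x y
  proof -
    have "foliated_change 1 n (U, \<phi>) (V, \<psi>)" using \<A> UV unfolding foliated_atlas_def by blast
    then obtain f h where fh: "\<forall>(s, t)\<in>\<phi> ` (U \<inter> V). \<psi> (inv_into U \<phi> (s, t)) = (f (s, t), h t)"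
      unfolding foliated_change_def by auto
    have U: "openin (long_glass n) U"
      "homeomorphic_map (subtopology (long_glass n) U)
        (subtopology (prod_topology (Euclidean_space 1) (Euclidean_space (n - 1))) (\<phi> ` U)) \<phi>"
      using charts[OF UV(1)] unfolding is_chart_def Let_def by auto
    have "inj_on \<phi> U"
      using homeomorphic_imp_injective_map[OF U(2)] openin_subset[OF U(1)] by (simp add: Int_absorb1)
    then have inv: "inv_into U \<phi> (\<phi> z) = z" if "z \<in> U \<inter> V" for z using that by (simp add: inv_into_f_f)
    have "snd (\<psi> z) = h (snd (\<phi> z))" if z: "z \<in> U \<inter> V" for z
    proof -
      have "\<phi> z \<in> \<phi> ` (U \<inter> V)" using z by blast
      with fh have "case \<phi> z of (s, t) \<Rightarrow> \<psi> (inv_into U \<phi> (s, t)) = (f (s, t), h t)" by (rule bspec)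
      then have "\<psi> (inv_into U \<phi> (\<phi> z)) = (f (\<phi> z), h (snd (\<phi> z)))"
        by (cases "\<phi> z") simp
      then show ?thesis using inv[OF z] by simp
    qed
    then show "snd (\<phi> x) = snd (\<phi> y) \<Longrightarrow> snd (\<psi> x) = snd (\<psi> y)" using xy by simp
  qed
  show "(tr c p = tr c q) = (tr d p = tr d q)"
    if cd: "c \<in> flow_boxes n \<A>" "d \<in> flow_boxes n \<A>" and pq: "p \<in> dom c \<inter> dom d" "q \<in> dom c \<inter> dom d" for c d p q
  proof -
    obtain U \<phi> where U: "(U, \<phi>) \<in> \<A>" "\<forall>p\<in>dom c. glass_class n p \<in> U"
      "\<forall>p\<in>dom c. \<forall>q\<in>dom c. tr c p = tr c q \<longleftrightarrow> snd (\<phi> (glass_class n p)) = snd (\<phi> (glass_class n q))"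
      using cd(1) unfolding flow_boxes_def by blast
    obtain V \<psi> where V: "(V, \<psi>) \<in> \<A>" "\<forall>p\<in>dom d. glass_class n p \<in> V"
      "\<forall>p\<in>dom d. \<forall>q\<in>dom d. tr d p = tr d q \<longleftrightarrow> snd (\<psi> (glass_class n p)) = snd (\<psi> (glass_class n q))"
      using cd(2) unfolding flow_boxes_def by blast
    have xy: "glass_class n p \<in> U \<inter> V" "glass_class n q \<in> U \<inter> V" "glass_class n p \<in> V \<inter> U" "glass_class n q \<in> V \<inter> U"
      using U(2) V(2) pq by blast+
    have "tr c p = tr c q \<longleftrightarrow> snd (\<phi> (glass_class n p)) = snd (\<phi> (glass_class n q))" using U(3) pq by blast
    also have "\<dots> \<longleftrightarrow> snd (\<psi> (glass_class n p)) = snd (\<psi> (glass_class n q))"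
      using key[OF U(1) V(1) xy(1,2)] key[OF V(1) U(1) xy(3,4)] by blast
    also have "\<dots> \<longleftrightarrow> tr d p = tr d q" using V(3) pq by blast
    finally show ?thesis .
  qed
  show "\<exists>c\<in>flow_boxes n \<A>. p \<in> dom c \<and> dom c \<subseteq> O' \<and> crd c p = (0, \<lambda>_. 0)"
    if p: "p \<in> glass n" and O: "openin (top_of_set (glass n)) O'" "p \<in> O'" for p O'
  proof -
    have "glass_class n p \<in> topspace (long_glass n)"
      using homeomorphic_imp_surjective_map[OF homeomorphic_glass_class[OF n]] p by auto
    then have "glass_class n p \<in> (\<Union>c\<in>\<A>. fst c)" using \<A> unfolding foliated_atlas_def by simp
    then obtain c where c: "c \<in> \<A>" "glass_class n p \<in> fst c" by blast
    obtain U \<phi> where "c = (U, \<phi>)" by (cases c)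
    with c have U: "(U, \<phi>) \<in> \<A>" "glass_class n p \<in> U" by simp_all
    show ?thesis by (rule small_flow_box[OF n charts[OF U(1)] U(1) p U(2) O])
  qed
  show "flip c \<in> flow_boxes n \<A>" if "c \<in> flow_boxes n \<A>" for c
    using that is_flowbox_flip unfolding flow_boxes_def by auto
qed

section \<open>Nonexistence\<close>

lemma glass_upper: "lzero < t \<Longrightarrow> (x, t) \<in> glass n \<longleftrightarrow> x \<in> esphere n"
  by (auto simp: glass_def)

text \<open>Polar coordinates: points of norm at most 1 form the bottom ball, and the shell between
  the radii 1 and 1 + \<open>\<rho>\<close> is unrolled to the sphere times the levels up to
  \<open>\<alpha>\<close>. The two formulas are merged by the maximum with 1 and by \<open>g\<close>
  being constant on negative parameters.\<close>

lemma glass_segment_ball: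
  obtains R E where "1 \<le> R" "continuous_on (eball n R) E" "inj_on E (eball n R)"
    "E ` eball n R = {p \<in> glass n. snd p \<le> \<alpha>}"
proof -
  obtain \<rho> :: real and g where g: "0 \<le> \<rho>" "g ` {0..\<rho>} = {..\<alpha>}" "strict_mono_on {0..\<rho>} g"
    "\<And>s. s \<le> 0 \<Longrightarrow> g s = lzero" "continuous_on {..\<rho>} g" "g \<rho> = \<alpha>"
    by (rule lray_param[of \<alpha>]) (rule that)
  define R where "R = 1 + \<rho>"
  define E where "E z = ((\<lambda>i. z i / max 1 (nrm n z)), g (nrm n z - 1))" for z
  have gpos: "g s \<noteq> lzero" if "0 < s" "s \<le> \<rho>" for s
    using strict_mono_onD[OF g(3), of 0 s] that g(1) g(4)[of 0] by simp
  have ginj: "s = s'" if "g s = g s'" "0 \<le> s" "s \<le> \<rho>" "0 \<le> s'" "s' \<le> \<rho>" for s s'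
    using strict_mono_onD[OF g(3), of s s'] strict_mono_onD[OF g(3), of s' s] that
    by (cases s s' rule: linorder_cases) auto
  have small: "E z = (z, lzero)" if "nrm n z \<le> 1" for z
    using that g(4)[of "nrm n z - 1"] by (simp add: E_def max_def)
  have big: "fst (E z) = (\<lambda>i. z i / nrm n z)" "snd (E z) = g (nrm n z - 1)" if "1 \<le> nrm n z" for z
    using that by (simp_all add: E_def max_def)
  have cont: "continuous_on (eball n R) E"
    unfolding E_def
  proof (intro continuous_on_Pair continuous_on_coordinatewise_then_product)
    fix i
    show "continuous_on (eball n R) (\<lambda>z. z i / max 1 (nrm n z))"
      by (intro continuous_on_divide continuous_coord continuous_on_max continuous_on_const
          continuous_nrm continuous_on_id) auto
  next
    show "continuous_on (eball n R) (\<lambda>z. g (nrm n z - 1))"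
      by (rule continuous_on_compose2[OF g(5)])
        (auto intro!: continuous_on_diff continuous_nrm continuous_on_id continuous_on_const simp: eball_def R_def)
  qed
  have sphere: "(\<lambda>i. z i / nrm n z) \<in> esphere n" if "z \<in> eball n R" "1 \<le> nrm n z" for z
  proof (rule normalise_in)
    show "z \<in> espace n" using that(1) by (simp add: eball_def)
    show "z \<noteq> (\<lambda>_. 0)"
    proof
      assume "z = (\<lambda>_. 0)"
      then have "nrm n z = 0" by (simp add: L2_set_def)
      with that(2) show False by simp
    qed
  qed
  have "E z \<in> {p \<in> glass n. snd p \<le> \<alpha>}" if z: "z \<in> eball n R" for z
  proof (cases "nrm n z \<le> 1")
    case True
    then show ?thesis using small[OF True] z lzero_le by (auto simp: glass_def eball_def)
  next
    case False
    then have 1: "1 \<le> nrm n z" by simp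
    have "nrm n z - 1 \<in> {0..\<rho>}" using z 1 by (simp add: eball_def R_def)
    then have "g (nrm n z - 1) \<in> {..\<alpha>}" using g(2) by blast
    then show ?thesis using big[OF 1] sphere[OF z 1] by (auto simp: glass_def mem_Times_iff)
  qed
  moreover have "p \<in> E ` eball n R" if p: "p \<in> glass n" "snd p \<le> \<alpha>" for p
  proof (cases "snd p = lzero")
    case True
    then have "fst p \<in> eball n 1" using p(1) esphere_subset[of n] by (auto simp: glass_def)
    then have "nrm n (fst p) \<le> 1" "fst p \<in> eball n R" using g(1) by (auto simp: eball_def R_def)
    then show ?thesis using small[of "fst p"] True by (intro image_eqI[of _ _ "fst p"]) (auto simp: prod_eq_iff)
  next
    case False
    then have x: "fst p \<in> esphere n" using p(1) by (auto simp: glass_def)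
    have "snd p \<in> g ` {0..\<rho>}" using p(2) g(2) by simp
    then obtain s where s: "0 \<le> s" "s \<le> \<rho>" "snd p = g s" by auto
    define z where "z = (\<lambda>i. (1 + s) * fst p i)"
    have nz: "nrm n z = 1 + s" unfolding z_def nrm_scale using x s(1) by (simp add: esphere_def)
    have "z \<in> eball n R" using nz x s(2) by (simp add: eball_def R_def z_def esphere_def espace_def)
    moreover have "E z = p"
      using big[of z] nz s by (simp add: prod_eq_iff z_def)
    ultimately show ?thesis by blast
  qed
  ultimately have im: "E ` eball n R = {p \<in> glass n. snd p \<le> \<alpha>}" by blast
  have "inj_on E (eball n R)"
  proof (rule inj_onI)
    fix z z' assume z: "z \<in> eball n R" "z' \<in> eball n R" "E z = E z'"
    have r: "nrm n z - 1 \<le> \<rho>" "nrm n z' - 1 \<le> \<rho>" using z by (auto simp: eball_def R_def)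
    have geq: "g (nrm n z - 1) = g (nrm n z' - 1)" using z(3) by (simp add: E_def)
    \<comment> \<open>The level exceeds \<open>lzero\<close> as soon as the norm exceeds 1, so it
      tells the shell from the inner ball.\<close>
    have le1: "nrm n z' \<le> 1" if "nrm n z \<le> 1" "g (nrm n z - 1) = g (nrm n z' - 1)" "nrm n z' - 1 \<le> \<rho>" for z z'
      using gpos[of "nrm n z' - 1"] g(4)[of "nrm n z - 1"] that by (cases "nrm n z' \<le> 1") auto
    show "z = z'"
    proof (cases "nrm n z \<le> 1")
      case True
      have "(z, lzero) = (z', lzero)"
        by (rule box_equals[OF z(3) small[OF True] small[OF le1[OF True geq r(2)]]])
      then show ?thesis by simp
    next
      case False
      have F': "\<not> nrm n z' \<le> 1"
      proof
        assume "nrm n z' \<le> 1"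
        then have "nrm n z \<le> 1" using geq[symmetric] r(1) by (rule le1)
        with False show False by simp
      qed
      have "nrm n z - 1 = nrm n z' - 1"
        by (rule ginj[OF geq]) (use False F' r in auto)
      then have ne: "nrm n z = nrm n z'" by simp
      have "(\<lambda>i. z i / nrm n z) = (\<lambda>i. z' i / nrm n z')"
        using arg_cong[OF z(3), of fst] big(1)[of z] big(1)[of z'] False F' by simp
      then have "z i / nrm n z = z' i / nrm n z" for i
        unfolding ne by (rule fun_cong)
      moreover have "nrm n z \<noteq> 0" using False by auto
      ultimately have "z i = z' i" for i by simp
      then show ?thesis by blast
    qed
  qed
  then show ?thesis using that[of R E] cont im g(1) by (simp add: R_def)
qed

lemma glass_segment_compact_connected:
  "compact {p \<in> glass n. snd p \<le> \<alpha>}" "connected {p \<in> glass n. snd p \<le> \<alpha>}"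
proof -
  obtain R E where E: "1 \<le> R" "continuous_on (eball n R) E" "inj_on E (eball n R)"
    "E ` eball n R = {p \<in> glass n. snd p \<le> \<alpha>}"
    by (rule glass_segment_ball)
  show "compact {p \<in> glass n. snd p \<le> \<alpha>}"
    unfolding E(4)[symmetric] by (rule compact_continuous_image[OF E(2) compact_eball])
  show "connected {p \<in> glass n. snd p \<le> \<alpha>}"
    unfolding E(4)[symmetric]
    by (rule connected_continuous_image[OF E(2) segment_closed_connected[OF segment_closed_eball]])
qed

text \<open>The parametrisation is a continuous bijection from a compact space, hence a
  homeomorphism, and carries Brouwer's theorem over.\<close>

lemma glass_segment_fixed_point:
  assumes n: "n \<ge> 1" and f: "continuous_on K f" "f ` K \<subseteq> K" and K: "K = {p \<in> glass n. snd p \<le> \<alpha>}"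
  shows "\<exists>p\<in>K. f p = p"
proof -
  obtain R E where E: "1 \<le> R" "continuous_on (eball n R) E" "inj_on E (eball n R)" "E ` eball n R = K"
    unfolding K by (rule glass_segment_ball)
  have "\<exists>G. homeomorphism (eball n R) K E G"
    using homeomorphism_compact[OF compact_eball E(2,4,3)] by blast
  then obtain G where G: "homeomorphism (eball n R) K E G" by blast
  have "continuous_on (eball n R) (\<lambda>z. f (E z))"
    by (rule continuous_on_compose2[OF f(1) E(2)]) (use E(4) in blast)
  then have "continuous_on (eball n R) (\<lambda>z. G (f (E z)))"
    by (rule continuous_on_compose2[OF homeomorphism_cont2[OF G]]) (use E(4) f(2) in blast)
  moreover have "(\<lambda>z. G (f (E z))) ` eball n R \<subseteq> eball n R"
    using homeomorphism_image2[OF G] E(4) f(2) by blast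
  ultimately obtain z where z: "z \<in> eball n R" "G (f (E z)) = z"
    using brouwer_eball[OF n, of R "\<lambda>z. G (f (E z))"] E(1) by auto
  have "f (E z) \<in> K" using f(2) E(4) z(1) by blast
  then have "E (G (f (E z))) = f (E z)" by (rule homeomorphism_apply2[OF G])
  then have "f (E z) = E z" using z(2) by simp
  then show ?thesis using E(4) z(1) by blast
qed

text \<open>Pushing the points of a segment of the glass along the leaves and retracting to that segment
  has a fixed point, which must lie on the boundary and be pushed vertically upwards.\<close>

lemma oriented_glass:
  assumes n: "n \<ge> 2" and or: "oriented_family (n - 1) (glass n) \<P>"
  shows "glass_family (n - 1) (glass n) \<P> (esphere n)" "glass_family.rising (glass n) \<P> (esphere n)"
proof -
  interpret oriented_family "n - 1" "glass n" \<P> by (rule or)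
  show gf: "glass_family (n - 1) (glass n) \<P> (esphere n)"
    by unfold_locales (use glass_upper connected_esphere[OF n] compact_esphere in auto)
  interpret G: glass_family "n - 1" "glass n" \<P> "esphere n" by (rule gf)
  show G.rising
    unfolding G.rising_def
  proof (intro allI impI)
    fix \<alpha> \<Q> assume \<alpha>: "lzero < \<alpha>" and \<Q>: "\<Q> \<subseteq> \<P>"
      and sm: "\<forall>p\<in>glass n. \<exists>c\<in>\<Q>. p \<in> dom c \<and> crd c p = (0, \<lambda>_. 0)"
    define K where "K = {p \<in> glass n. snd p \<le> \<alpha>}"
    have cK: "compact K" unfolding K_def by (rule glass_segment_compact_connected)
    have KM: "K \<subseteq> glass n" by (auto simp: K_def)
    have "\<And>p. p \<in> K \<Longrightarrow> \<exists>c\<in>\<Q>. p \<in> dom c \<and> crd c p = (0, \<lambda>_. 0)" using sm KM by blast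
    then obtain f where f: "continuous_on K f" "f ` K \<subseteq> glass n"
      "\<And>p. p \<in> K \<Longrightarrow> \<exists>c\<in>\<Q>. before c p (f p) \<and> f p \<noteq> p"
      by (rule push_exists[OF cK KM \<Q>]) (assumption | rule that)+
    \<comment> \<open>Cutting off the level retracts the glass to the segment, because above the
      lowest level the glass is a product. Positions in the sphere are kept, which is why the fixed
      point is pushed vertically.\<close>
    define h where "h p = (fst (f p), min (snd (f p)) \<alpha>)" for p
    have "continuous_on K h"
      unfolding h_def
      by (intro continuous_on_Pair continuous_on_fst continuous_on_snd continuous_on_min continuous_on_const f(1))
    moreover have "h ` K \<subseteq> K"
    proof
      fix q assume "q \<in> h ` K"
      then obtain p where p: "p \<in> K" "q = h p" by blast
      have fp: "f p \<in> glass n" using f(2) p(1) by blast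
      show "q \<in> K"
      proof (cases "snd (f p) \<le> \<alpha>")
        case True
        then have "q = f p" using p(2) by (simp add: h_def min_def prod_eq_iff)
        then show ?thesis using fp True by (simp add: K_def)
      next
        case False
        then have "lzero < snd (f p)" using \<alpha> by simp
        then have "fst (f p) \<in> esphere n" using fp glass_upper[of "snd (f p)" "fst (f p)"] by simp
        moreover have "q = (fst (f p), \<alpha>)" using p(2) False by (simp add: h_def min_def)
        ultimately show ?thesis using glass_upper[OF \<alpha>] by (simp add: K_def)
      qed
    qed
    ultimately obtain p where p: "p \<in> K" "h p = p"
      using glass_segment_fixed_point[of n K h \<alpha>] n K_def by auto
    obtain c where c: "c \<in> \<Q>" "before c p (f p)" "f p \<noteq> p" using f(3)[OF p(1)] by blast
    have e: "fst (f p) = fst p" "min (snd (f p)) \<alpha> = snd p" using p(2) by (simp_all add: h_def prod_eq_iff)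
    have "\<not> snd (f p) \<le> \<alpha>"
    proof
      assume "snd (f p) \<le> \<alpha>"
      then have "f p = p" using e by (simp add: prod_eq_iff min_def)
      with c(3) show False by simp
    qed
    then have t: "\<alpha> < snd (f p)" "snd p = \<alpha>" using e(2) by (auto simp: min_def)
    have pf: "p = (fst p, \<alpha>)" "f p = (fst p, snd (f p))" using t(2) e(1) by (simp_all add: prod_eq_iff)
    have "fst p \<in> esphere n" using p(1) glass_upper[OF \<alpha>, of "fst p"] pf(1) by (metis KM subsetD)
    moreover have "before c (fst p, \<alpha>) (fst p, snd (f p))" using c(2) pf by metis
    ultimately show "\<exists>x\<in>esphere n. \<exists>t>\<alpha>. \<exists>c\<in>\<Q>. before c (x, \<alpha>) (x, t)"
      using t(1) c(1) by blast
  qed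
qed

text \<open>Every segment \<open>K \<alpha>\<close> is the image of a ball, hence orientable. Fixing
  the direction at the centre \<open>o'\<close> by one box \<open>c0\<close> makes the chosen
  orientations coherent on common segments, which are connected, so they fit together over all
  levels.\<close>

lemma glass_orientable:
  assumes F: "flip_family (n - 1) (glass n) \<B>"
  shows "\<exists>\<tau>. flip_family.orients (glass n) \<B> \<tau> (glass n)"
proof -
  interpret flip_family "n - 1" "glass n" \<B> by (rule F)
  define K where "K \<alpha> = {p \<in> glass n. snd p \<le> \<alpha>}" for \<alpha> :: lray
  define o' where "o' = ((\<lambda>_. 0) :: nat \<Rightarrow> real, lzero)"
  have oM: "o' \<in> glass n" by (simp add: o'_def glass_def eball_def espace_def L2_set_def)
  have oK: "o' \<in> K \<alpha>" for \<alpha> using oM lzero_le by (simp add: K_def o'_def)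
  obtain c0 where c0: "c0 \<in> \<B>" "o' \<in> dom c0" using small[OF oM, of "glass n"] oM by auto
  have "\<exists>\<tau>. orients \<tau> (K \<alpha>) \<and> coh (\<tau> o') c0 o'" for \<alpha>
  proof -
    obtain R E where E: "1 \<le> R" "continuous_on (eball n R) E" "inj_on E (eball n R)" "E ` eball n R = K \<alpha>"
      unfolding K_def by (rule glass_segment_ball)
    have "\<exists>\<tau>. orients \<tau> (E ` eball n R)"
    proof (rule orientable_image[OF compact_eball segment_closed_eball _ _ E(2,3)])
      show "z i = 0" if "z \<in> eball n R" "n \<le> i" for z i using that by (simp add: eball_def espace_def)
      show "\<bar>z i\<bar> \<le> \<bar>R\<bar>" if "z \<in> eball n R" for z i by (rule eball_coord_le[OF that])
      show "E ` eball n R \<subseteq> glass n" unfolding E(4) by (auto simp: K_def)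
    qed
    then obtain \<tau> where \<tau>: "orients \<tau> (K \<alpha>)" unfolding E(4) by blast
    have T: "\<tau> o' \<in> \<B>" "o' \<in> dom (\<tau> o')" using \<tau> oK unfolding orients_def by blast+
    show ?thesis
    proof (cases "coh (\<tau> o') c0 o'")
      case True
      with \<tau> show ?thesis by blast
    next
      case False
      then have "coh (flip (\<tau> o')) c0 o'" using coh_flip_left[OF T(1) c0(1) T(2) c0(2)] by simp
      then show ?thesis using orients_flip[OF \<tau>] by blast
    qed
  qed
  then have "\<forall>\<alpha>. \<exists>\<tau>. orients \<tau> (K \<alpha>) \<and> coh (\<tau> o') c0 o'" by blast
  from choice[OF this] obtain \<T> where \<T>: "\<And>\<alpha>. orients (\<T> \<alpha>) (K \<alpha>)" "\<And>\<alpha>. coh (\<T> \<alpha> o') c0 o'" by blast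
  have TB: "\<T> \<alpha> q \<in> \<B>" "q \<in> dom (\<T> \<alpha> q)" if "q \<in> K \<alpha>" for \<alpha> q
    using \<T>(1)[of \<alpha>] that unfolding orients_def by blast+
  have same: "coh (\<T> \<alpha> q) (\<T> \<alpha>' q) q" if "q \<in> K \<alpha>" "q \<in> K \<alpha>'" for \<alpha> \<alpha>' q
  proof -
    have "K (min \<alpha> \<alpha>') \<subseteq> K \<alpha>" "K (min \<alpha> \<alpha>') \<subseteq> K \<alpha>'" "q \<in> K (min \<alpha> \<alpha>')"
      using that by (auto simp: K_def)
    moreover have "connected (K (min \<alpha> \<alpha>'))" unfolding K_def by (rule glass_segment_compact_connected)
    moreover have "coh (\<T> \<alpha> o') (\<T> \<alpha>' o') o'"
      by (rule coh_trans[OF TB(1)[OF oK] c0(1) \<T>(2) coh_sym[OF TB(1)[OF oK] c0(1) \<T>(2)]])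
    ultimately show ?thesis
      using orients_unique[OF orients_subset[OF \<T>(1)] orients_subset[OF \<T>(1)], of "K (min \<alpha> \<alpha>')" \<alpha> \<alpha>' o' q] oK by blast
  qed
  \<comment> \<open>At \<open>p\<close> the orientation of a segment that ends strictly above
    \<open>p\<close> is used, since such a segment contains a neighbourhood of
    \<open>p\<close>.\<close>
  obtain up where up: "\<And>t. t < (up t :: lray)" using lray_no_max by metis
  define \<tau> where "\<tau> p = \<T> (up (snd p)) p" for p
  have inK: "p \<in> K (up (snd p))" if "p \<in> glass n" for p
    using that less_imp_le[OF up] by (simp add: K_def)
  have "orients \<tau> (glass n)"
    unfolding orients_def
  proof (intro conjI ballI subset_refl)
    show "\<tau> p \<in> \<B>" "p \<in> dom (\<tau> p)" if "p \<in> glass n" for p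
      unfolding \<tau>_def using TB[OF inK[OF that]] by blast+
    fix p assume p: "p \<in> glass n"
    define \<alpha> where "\<alpha> = up (snd p)"
    obtain N where N: "openin (top_of_set (glass n)) N" "p \<in> N" "\<forall>q\<in>N \<inter> K \<alpha>. coh (\<T> \<alpha> p) (\<T> \<alpha> q) q"
      using \<T>(1)[of \<alpha>] inK[OF p] unfolding orients_def \<alpha>_def by blast
    define N' where "N' = N \<inter> (glass n \<inter> UNIV \<times> {..<\<alpha>})"
    have "openin (top_of_set (glass n)) N'"
      unfolding N'_def by (intro openin_Int N(1) openin_open_Int open_Times) auto
    moreover have "p \<in> N'" using N(2) p up[of "snd p"] by (simp add: N'_def \<alpha>_def mem_Times_iff)
    moreover have "coh (\<tau> p) (\<tau> q) q" if q: "q \<in> N' \<inter> glass n" for q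
    proof -
      have qK: "q \<in> K \<alpha>" using q by (auto simp: N'_def K_def mem_Times_iff)
      have 1: "coh (\<T> \<alpha> p) (\<T> \<alpha> q) q" using N(3) q qK by (auto simp: N'_def)
      have 2: "coh (\<T> \<alpha> q) (\<tau> q) q" unfolding \<tau>_def by (rule same[OF qK inK]) (use q in blast)
      have pK: "p \<in> K \<alpha>" using inK[OF p] by (simp add: \<alpha>_def)
      have "coh (\<T> \<alpha> p) (\<tau> q) q" by (rule coh_trans[OF TB(1)[OF pK] TB(1)[OF qK] 1 2])
      then show ?thesis by (simp add: \<tau>_def \<alpha>_def)
    qed
    ultimately show "\<exists>N. openin (top_of_set (glass n)) N \<and> p \<in> N \<and> (\<forall>q\<in>N \<inter> glass n. coh (\<tau> p) (\<tau> q) q)"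
      by blast
  qed
  then show ?thesis by blast
qed

text \<open>Brouwer's theorem is applied once for the positive boxes and once for their reverses,
  which gives a rising and a falling leaf segment in the same glass.\<close>

lemma no_foliated_atlas:
  assumes n: "n \<ge> 2"
  shows "\<not> foliated_atlas 1 n (long_glass n) \<A>"
proof
  assume \<A>: "foliated_atlas 1 n (long_glass n) \<A>"
  have F: "flip_family (n - 1) (glass n) (flow_boxes n \<A>)"
    using flow_boxes_family[OF _ \<A>] n by simp
  interpret F: flip_family "n - 1" "glass n" "flow_boxes n \<A>" by (rule F)
  obtain \<tau> where \<tau>: "F.orients \<tau> (glass n)" using glass_orientable[OF F] by blast
  define \<P> where "\<P> = {c \<in> flow_boxes n \<A>. \<forall>p\<in>dom c. F.coh c (\<tau> p) p}"
  have P: "oriented_family (n - 1) (glass n) \<P>"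
    unfolding \<P>_def by (rule F.positive_boxes_oriented[OF \<tau>])
  interpret P: oriented_family "n - 1" "glass n" \<P> by (rule P)
  interpret G: glass_family "n - 1" "glass n" \<P> "esphere n" by (rule oriented_glass(1)[OF n P])
  show False
    by (rule G.rising_falling_False[OF oriented_glass(2)[OF n P] oriented_glass(2)[OF n P.reverse_oriented]])
qed

theorem corollary6p5:
  fixes n :: nat
  assumes "n \<ge> 2"
  shows "\<not> (\<exists>\<F>. foliation 1 n (long_glass n) \<F>)"
  using no_foliated_atlas[OF assms] unfolding foliation_def by blast

end
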